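(* For every finite nonempty $A\subset\mathbb{R}$ there exists $a\in A$ such that, for every $\epsilon>0$, \[|A(A+a)|\gg_\epsilon |A|^{229/152-\epsilon},\quad |A(A+A)|\gg_\epsilon |A|^{32/21-\epsilon},\quad |A(A-A)|\gg_\epsilon |A|^{7239/4733-\epsilon}.\]
   Context: For sets $X,Y\subset\mathbb{R}$, $XY=\{xy:x\in X,y\in Y\}$, $X\pm Y=\{x\pm y\}$, and $A+a=\{b+a:b\in A\}$. $X\ll_\epsilon Y$ (equivalently $Y\gg_\epsilon X$) means $X\le C_\epsilon Y$ with $C_\epsilon$ depending only on $\epsilon$. *)

theory Defs
  imports Complex_Main "HOL-Library.Set_Algebras"
begin

(* Theory Set_Algebras supplies the elementwise sum A + B and product A * B of sets
   and the translate a +o A.  On sets, A - B always denotes set-theoretic complement,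
   so the difference set {a - b} needs its own constant. *)

definition difference_set :: "'a::minus set \<Rightarrow> 'a set \<Rightarrow> 'a set" where
  "difference_set X Y = {x - y | x y. x \<in> X \<and> y \<in> Y}"

end

(*
  Szemeredi-Trotter for grids is elementary: cut a Cartesian product X x Y into k x k blocks of
  consecutive elements; a line visits at most 2k blocks and two points in a block determine a line.

  Let N = |A| and let E be the multiplicative energy of A.  Counting collinear triples in a Cartesian
  square gives |A(A+a)|^2 E >> N^6 / log N for some a in A, so E may be assumed large.  Then many
  elements of A have many representations v/h with v in a set W of popular products and h in A, and by
  Szemeredi-Trotter a set B of such elements (and W itself) has few popular differences.

  For S = A(A+A) or A(A-A): triples in B with a popular difference b - c are determined, up to a bounded
  third moment, by the pair (a - b, a - c).  All dilates by u in A of such pairs lie in S (or -S), and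
  incidences between the points (u, y) and the lines y = d u + c bound the number of pairs.  This gives
  E << N^(7/5) |S| up to logarithms, hence |S| >> N^(23/15), which beats both exponents.

  For A(A+a): if all these sets are small, then the quantity
  Phi = sum over a in A and g, g' in B of #{v in W. v + a(g - g') in W} is large.
  Averaged over a this is a positive semidefinite form in (g, g'), so the corresponding
  weighted count of triples (g1, g2, g3) is at least cubic in Phi.  Two sides of a triple are dilated
  by the same a, the third by the average, and bounding the triples by incidences again gives
  max |A(A+a)| >> N^(65/43) or >> N^(29/19), both above 229/152.  All exponents being exceeded strictly,
  the logarithms are absorbed and no loss of epsilon is needed.
*)
theory Submission
  imports Defs "HOL-Analysis.Harmonic_Numbers"
begin


section \<open>Incidences on grids\<close>

text \<open>The two upper bounds for E differ because of what can be dilated. A(A+A) and A(A-A)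
  contain, up to sign, all u (a - b) with u in A, so one configuration of differences reappears in a
  single small set for each of the N values of u. In A(A+a) the shift and the dilation are the same
  number. A coincidence there only says that a (g - g') is a difference of two popular products;
  membership in a small set has to be replaced by popularity, and positive semidefiniteness is what
  passes from a lower bound for pairs to one for triples. Level sets are not decomposed dyadically:
  a weak bound t^k #{f >= t} <= U is summed against 1/t, at the price of a harmonic number. If
  \<rho> is the popularity of the products in W, then E is at most \<rho>^2 |W| up to a logarithm.
  All fractional exponents are avoided by raising inequalities to integer powers, chosen so that in
  the end only \<rho>^2 |W| is left.\<close>

lemma card_power2_le_collisions:
  assumes "finite S"
  shows "(card S)\<^sup>2 \<le> card (f ` S) * card {(x, y). x \<in> S \<and> y \<in> S \<and> f x = f y}"
proof -
  let ?c = "\<lambda>v. card {x \<in> S. f x = v}"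
  have "card S = (\<Sum>v\<in>f ` S. ?c v)"
    using sum.image_gen[OF assms, of "\<lambda>_. 1::nat" f] by simp
  then have "(real (card S))\<^sup>2 = (\<Sum>v\<in>f ` S. 1 * real (?c v))\<^sup>2" by simp
  also have "\<dots> \<le> (\<Sum>v\<in>f ` S. 1\<^sup>2) * (\<Sum>v\<in>f ` S. (real (?c v))\<^sup>2)"
    by (rule Cauchy_Schwarz_ineq_sum)
  also have "(\<Sum>v\<in>f ` S. (real (?c v))\<^sup>2)
      = real (card (SIGMA v:f ` S. {x \<in> S. f x = v} \<times> {x \<in> S. f x = v}))"
    using assms by (simp add: card_cartesian_product power2_eq_square)
  also have "card (SIGMA v:f ` S. {x \<in> S. f x = v} \<times> {x \<in> S. f x = v})
      = card {(x, y). x \<in> S \<and> y \<in> S \<and> f x = f y}"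
    by (rule bij_betw_same_card[of snd]) (auto simp: bij_betw_def inj_on_def image_iff)
  finally have "(real (card S))\<^sup>2
      \<le> real (card (f ` S) * card {(x, y). x \<in> S \<and> y \<in> S \<and> f x = f y})" by simp
  then show ?thesis unfolding of_nat_power[symmetric] of_nat_le_iff .
qed

text \<open>Ranks are cut into intervals of length m, the quotient n / k rounded up. Rounding up
  leaves at most k blocks, and k <= n keeps k m <= 2 n. Ranks make sense for every element of the
  type, so b is monotone off X as well.\<close>

lemma ex_monotone_blocks:
  fixes X :: "'a::linorder set"
  assumes "finite X" "1 \<le> k" "k \<le> card X"
  obtains b :: "'a \<Rightarrow> nat" where "mono b" "\<And>x. x \<in> X \<Longrightarrow> b x < k"
    "\<And>i. k * card {x \<in> X. b x = i} \<le> 2 * card X"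
proof -
  define n where "n = card X"
  define m where "m = (n + k - 1) div k"
  define rk where "rk x = card {z \<in> X. z < x}" for x
  define b where "b x = rk x div m" for x
  have nkm: "n \<le> k * m" 
  proof -
    have "n + k - 1 < k * (m + 1)"
      using dividend_less_times_div[of k "n + k - 1"] assms(2) unfolding m_def by simp
    then show ?thesis using assms(2) by (simp add: algebra_simps)
  qed
  have kmn: "k * m \<le> 2 * n" 
  proof -
    have "k * m \<le> n + k - 1" unfolding m_def by simp
    then show ?thesis using assms n_def by linarith
  qed
  have m0: "0 < m" using nkm assms n_def by (cases m) auto
  have rkmono: "rk x \<le> rk y" if "x \<le> y" for x y
    unfolding rk_def using that assms(1) by (intro card_mono) auto
  have rkless: "rk x < rk y" if "x \<in> X" "x < y" for x y
    unfolding rk_def using that assms(1) by (intro psubset_card_mono) auto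
  have rklt: "rk x < n" if "x \<in> X" for x
    unfolding rk_def n_def using that assms(1) by (intro psubset_card_mono) auto
  have inj: "inj_on rk X"
    by (intro inj_onI) (metis rkless less_irrefl neqE)
  show thesis
  proof
    show "mono b" by (intro monoI) (simp add: b_def div_le_mono rkmono)
    show "b x < k" if "x \<in> X" for x
      using rklt[OF that] nkm m0 unfolding b_def by (simp add: div_less_iff_less_mult)
    show "k * card {x \<in> X. b x = i} \<le> 2 * card X" for i
    proof -
      have "card {x \<in> X. b x = i} \<le> card {i * m..<i * m + m}"
      proof (rule card_inj_on_le[of rk])
        show "inj_on rk {x \<in> X. b x = i}" using inj by (rule inj_on_subset) auto
        show "rk ` {x \<in> X. b x = i} \<subseteq> {i * m..<i * m + m}"
        proof
          fix r assume "r \<in> rk ` {x \<in> X. b x = i}"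
          then have "r div m = i" by (auto simp: b_def)
          then have "r = i * m + r mod m" by (metis div_mult_mod_eq)
          then show "r \<in> {i * m..<i * m + m}" using m0 by (metis atLeastLessThan_iff le_add1 mod_less_divisor nat_add_left_cancel_less)
        qed
      qed simp
      then have "card {x \<in> X. b x = i} \<le> m" by simp
      then have "k * card {x \<in> X. b x = i} \<le> k * m" by simp
      then show ?thesis using kmn n_def by linarith
    qed
  qed
qed

text \<open>Along an increasing staircase the sum i + j determines the cell (i, j), and i + j < 2
  k.\<close>

lemma card_monotone_cells:
  fixes u v :: "'a::linorder \<Rightarrow> nat"
  assumes "finite S" "\<And>x. x \<in> S \<Longrightarrow> u x < k" "\<And>x. x \<in> S \<Longrightarrow> v x < k"
    and "\<And>x y. \<lbrakk>x \<in> S; y \<in> S; x \<le> y\<rbrakk> \<Longrightarrow> u x \<le> u y"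
    and "\<And>x y. \<lbrakk>x \<in> S; y \<in> S; x \<le> y\<rbrakk> \<Longrightarrow> v x \<le> v y"
  shows "card ((\<lambda>x. (u x, v x)) ` S) \<le> 2 * k"
proof -
  have "card ((\<lambda>x. (u x, v x)) ` S) \<le> card {..<2 * k}"
  proof (rule card_inj_on_le[of "\<lambda>(i, j). i + j"])
    show "inj_on (\<lambda>(i, j). i + j) ((\<lambda>x. (u x, v x)) ` S)"
    proof (rule inj_onI, clarsimp)
      fix x y assume "x \<in> S" "y \<in> S" "u x + v x = u y + v y"
      then show "u x = u y \<and> v x = v y" 
        using assms(4,5)[of x y] assms(4,5)[of y x] linear[of x y] by auto
    qed
    show "(\<lambda>(i, j). i + j) ` (\<lambda>x. (u x, v x)) ` S \<subseteq> {..<2 * k}"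
      using assms(2,3) by force
  qed simp
  then show ?thesis by simp
qed

text \<open>Reversing the second coordinate, j to k - 1 - j, reduces this to the monotone
  case.\<close>

lemma card_antitone_cells:
  fixes u v :: "'a::linorder \<Rightarrow> nat"
  assumes "finite S" "\<And>x. x \<in> S \<Longrightarrow> u x < k" "\<And>x. x \<in> S \<Longrightarrow> v x < k"
    and "\<And>x y. \<lbrakk>x \<in> S; y \<in> S; x \<le> y\<rbrakk> \<Longrightarrow> u x \<le> u y"
    and "\<And>x y. \<lbrakk>x \<in> S; y \<in> S; x \<le> y\<rbrakk> \<Longrightarrow> v y \<le> v x"
  shows "card ((\<lambda>x. (u x, v x)) ` S) \<le> 2 * k"
proof -
  have "(\<lambda>x. (u x, v x)) ` S = (\<lambda>(i, j). (i, k - 1 - j)) ` (\<lambda>x. (u x, k - 1 - v x)) ` S"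
    unfolding image_image
  proof (rule image_cong[OF refl])
    fix x assume "x \<in> S"
    then show "(u x, v x) = (case (u x, k - 1 - v x) of (i, j) \<Rightarrow> (i, k - 1 - j))"
      using assms(3)[of x] by simp
  qed
  then have "card ((\<lambda>x. (u x, v x)) ` S) \<le> card ((\<lambda>x. (u x, k - 1 - v x)) ` S)"
    using card_image_le assms(1) by (metis (no_types, lifting) finite_imageI)
  also have "\<dots> \<le> 2 * k"
  proof (rule card_monotone_cells[OF assms(1)])
    show "k - 1 - v x < k" if "x \<in> S" for x using assms(2)[OF that] by linarith
    show "k - 1 - v x \<le> k - 1 - v y" if "x \<in> S" "y \<in> S" "x \<le> y" for x y
      using assms(5)[OF that] by linarith
  qed (use assms(2,4) in auto)
  finally show ?thesis .
qed

text \<open>Choose one representative in each fibre; every other element forms with its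
  representative a pair counted on the right.\<close>

lemma card_le_image_plus_collisions:
  assumes "finite S"
  shows "card S \<le> card (f ` S) + card {(x, y). x \<in> S \<and> y \<in> S \<and> x \<noteq> y \<and> f x = f y}"
proof -
  define r where "r = inv_into S f"
  have r: "r (f x) \<in> S" "f (r (f x)) = f x" if "x \<in> S" for x
    using that by (auto simp: r_def inv_into_into f_inv_into_f)
  have fin: "finite {(x, y). x \<in> S \<and> y \<in> S \<and> x \<noteq> y \<and> f x = f y}"
    by (rule finite_subset[of _ "S \<times> S"]) (use assms in auto)
  have "S \<subseteq> r ` f ` S \<union> {x \<in> S. r (f x) \<noteq> x}"
  proof
    fix x assume "x \<in> S"
    have "x \<in> r ` f ` S" if "r (f x) = x" using \<open>x \<in> S\<close> that by (metis imageI)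
    then show "x \<in> r ` f ` S \<union> {x \<in> S. r (f x) \<noteq> x}" using \<open>x \<in> S\<close> by blast
  qed
  then have "card S \<le> card (r ` f ` S \<union> {x \<in> S. r (f x) \<noteq> x})"
    using assms by (intro card_mono) auto
  also have "\<dots> \<le> card (r ` f ` S) + card {x \<in> S. r (f x) \<noteq> x}" by (rule card_Un_le)
  also have "\<dots> \<le> card (f ` S) + card {(x, y). x \<in> S \<and> y \<in> S \<and> x \<noteq> y \<and> f x = f y}"
  proof (rule add_mono)
    show "card (r ` f ` S) \<le> card (f ` S)" using assms by (intro card_image_le) auto
    show "card {x \<in> S. r (f x) \<noteq> x} \<le> card {(x, y). x \<in> S \<and> y \<in> S \<and> x \<noteq> y \<and> f x = f y}"
    proof (rule card_inj_on_le[OF _ _ fin, of "\<lambda>x. (x, r (f x))"])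
      show "(\<lambda>x. (x, r (f x))) ` {x \<in> S. r (f x) \<noteq> x}
          \<subseteq> {(x, y). x \<in> S \<and> y \<in> S \<and> x \<noteq> y \<and> f x = f y}"
      proof (rule image_subsetI, elim CollectE conjE)
        fix x assume "x \<in> S" "r (f x) \<noteq> x"
        then show "(x, r (f x)) \<in> {(x, y). x \<in> S \<and> y \<in> S \<and> x \<noteq> y \<and> f x = f y}"
          using r[of x] by auto
      qed
    qed (auto intro: inj_onI)
  qed
  finally show ?thesis .
qed


text \<open>On each line one point per visited cell gives the first term. The other points are
  charged to pairs of distinct points in a common cell. Cells have sides at most 2|X|/k and 2|Y|/k,
  so over the whole grid there are at most 4 (|X||Y|)^2 / k^2 such pairs, the second term.\<close>

lemma incidences_le_cells:
  fixes X Y :: "real set" and L :: "(real \<times> real) set"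
  assumes fin: "finite X" "finite Y" "finite L" and nz: "\<And>l. l \<in> L \<Longrightarrow> fst l \<noteq> 0"
    and k: "1 \<le> k" "k \<le> card X" "k \<le> card Y"
  shows "k\<^sup>2 * (\<Sum>l\<in>L. card {x \<in> X. fst l * x + snd l \<in> Y})
      \<le> 2 * k ^ 3 * card L + 4 * (card X * card Y)\<^sup>2"
proof -
  obtain b :: "real \<Rightarrow> nat" where b: "mono b" "\<And>x. x \<in> X \<Longrightarrow> b x < k"
    "\<And>i. k * card {x \<in> X. b x = i} \<le> 2 * card X"
    using ex_monotone_blocks[OF fin(1) k(1,2)] by metis
  obtain c :: "real \<Rightarrow> nat" where c: "mono c" "\<And>y. y \<in> Y \<Longrightarrow> c y < k"
    "\<And>i. k * card {y \<in> Y. c y = i} \<le> 2 * card Y"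
    using ex_monotone_blocks[OF fin(2) k(1,3)] by metis
  define f where "f l x = fst l * x + snd l" for l :: "real \<times> real" and x
  define S where "S l = {x \<in> X. f l x \<in> Y}" for l
  define cell where "cell l x = (b x, c (f l x))" for l x
  define coll where
    "coll l = {(x, x'). x \<in> S l \<and> x' \<in> S l \<and> x \<noteq> x' \<and> cell l x = cell l x'}" for l
  have finS: "finite (S l)" for l using fin by (simp add: S_def)
  have fincoll: "finite (coll l)" for l
    by (rule finite_subset[of _ "S l \<times> S l"]) (auto simp: coll_def finS)
  have cells: "card (cell l ` S l) \<le> 2 * k" if "l \<in> L" for l
  proof (cases "fst l > 0")
    case True
    then have "f l x \<le> f l y" if "x \<le> y" for x y using that by (simp add: f_def)
    then show ?thesis unfolding cell_def
      by (intro card_monotone_cells[OF finS]) (auto simp: S_def b c monoD[OF b(1)] monoD[OF c(1)])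
  next
    case False
    then have "f l y \<le> f l x" if "x \<le> y" for x y using that by (simp add: f_def mult_left_mono_neg)
    then show ?thesis unfolding cell_def
      by (intro card_antitone_cells[OF finS]) (auto simp: S_def b c monoD[OF b(1)] monoD[OF c(1)])
  qed
  \<comment> \<open>All ordered pairs of grid points in a common cell, independently of any
    line.\<close>
  define D where "D = (SIGMA p:X \<times> Y. {x' \<in> X. b x' = b (fst p)} \<times> {y' \<in> Y. c y' = c (snd p)})"
  have finD: "finite D" unfolding D_def using fin by (intro finite_SigmaI) auto
  have "(\<Sum>l\<in>L. card (coll l)) = card (SIGMA l:L. coll l)" using fin fincoll by simp
  also have "\<dots> \<le> card D"
  proof (rule card_inj_on_le[OF _ _ finD])
    let ?g = "\<lambda>(l, x, x'). ((x, f l x), (x', f l x'))"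
    show "inj_on ?g (SIGMA l:L. coll l)"
    proof (rule inj_onI, clarsimp)
      fix s i s' i' x x' assume "(x, x') \<in> coll (s, i)"
        and e: "f (s, i) x = f (s', i') x" "f (s, i) x' = f (s', i') x'"
      then have "x \<noteq> x'" by (simp add: coll_def)
      moreover have "(s - s') * (x - x') = 0" using e by (simp add: f_def algebra_simps)
      ultimately have "s = s'" by simp
      then show "s = s' \<and> i = i'" using e by (simp add: f_def)
    qed
    show "?g ` (SIGMA l:L. coll l) \<subseteq> D" by (auto simp: coll_def D_def S_def cell_def)
  qed
  finally have collD: "(\<Sum>l\<in>L. card (coll l)) \<le> card D" .
  have "k\<^sup>2 * card D = (\<Sum>p\<in>X \<times> Y. (k * card {x' \<in> X. b x' = b (fst p)}) *
      (k * card {y' \<in> Y. c y' = c (snd p)}))"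
    unfolding D_def using fin
    by (simp add: card_cartesian_product sum_distrib_left power2_eq_square mult_ac)
  also have "\<dots> \<le> (\<Sum>p\<in>X \<times> Y. (2 * card X) * (2 * card Y))"
    by (intro sum_mono mult_mono b c) auto
  also have "\<dots> = 4 * (card X * card Y)\<^sup>2"
    by (simp add: card_cartesian_product power2_eq_square)
  finally have kD: "k\<^sup>2 * card D \<le> 4 * (card X * card Y)\<^sup>2" .
  have "(\<Sum>l\<in>L. card (S l)) \<le> (\<Sum>l\<in>L. 2 * k + card (coll l))"
  proof (rule sum_mono)
    fix l assume "l \<in> L"
    then show "card (S l) \<le> 2 * k + card (coll l)"
      using card_le_image_plus_collisions[OF finS, of l "cell l"] cells[of l]
      unfolding coll_def by linarith
  qed
  also have "\<dots> \<le> 2 * k * card L + card D" using collD by (simp add: sum.distrib)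
  finally have "k\<^sup>2 * (\<Sum>l\<in>L. card (S l)) \<le> k\<^sup>2 * (2 * k * card L + card D)" by simp
  also have "\<dots> = 2 * k ^ 3 * card L + k\<^sup>2 * card D"
    by (simp add: algebra_simps power2_eq_square power3_eq_cube)
  finally show ?thesis using kD unfolding S_def f_def by linarith
qed

lemma incidences_le_rows:
  fixes X Y :: "real set" and L :: "(real \<times> real) set"
  assumes "finite X" "finite Y" "finite L" and nz: "\<And>l. l \<in> L \<Longrightarrow> fst l \<noteq> 0"
  shows "(\<Sum>l\<in>L. card {x \<in> X. fst l * x + snd l \<in> Y}) \<le> card L * min (card X) (card Y)"
proof -
  have "card {x \<in> X. fst l * x + snd l \<in> Y} \<le> min (card X) (card Y)" if "l \<in> L" for l
  proof -
    have "card {x \<in> X. fst l * x + snd l \<in> Y} \<le> card Y"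
      by (rule card_inj_on_le[of "\<lambda>x. fst l * x + snd l"]) (use nz[OF that] assms in \<open>auto intro!: inj_onI\<close>)
    then show ?thesis using assms by (simp add: card_mono)
  qed
  then show ?thesis using sum_bounded_above[of L _ "min (card X) (card Y)"] by simp
qed

text \<open>The usual extra terms, linear in the numbers of points and of lines, are absent:
  \<open>few\<close> absorbs the lines, and the bound min(|X|, |Y|) for each single line absorbs the
  points.\<close>

theorem szemeredi_trotter_grid:
  fixes X Y :: "real set" and L :: "(real \<times> real) set"
  assumes fin: "finite X" "finite Y" "finite L" and nz: "\<And>l. l \<in> L \<Longrightarrow> fst l \<noteq> 0"
    and few: "card L < (card X * card Y)\<^sup>2"
  shows "(\<Sum>l\<in>L. card {x \<in> X. fst l * x + snd l \<in> Y}) ^ 3 \<le> 1728 * (card X * card Y * card L)\<^sup>2"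
    (is "?I ^ 3 \<le> _")
proof (cases "card L = 0")
  case True
  then show ?thesis using fin by simp
next
  case False
  define n where "n = card L"
  define P where "P = card X * card Y"
  have n: "0 < n" using False by (simp add: n_def)
  have Pn: "n < P\<^sup>2" using few by (simp add: P_def n_def)
  have "P\<^sup>2 * 1 \<le> (P\<^sup>2) ^ 3 * n" using n Pn by (intro mult_le_mono self_le_power) linarith+
  then have ex: "\<exists>k. P\<^sup>2 \<le> k ^ 3 * n" by (intro exI[of _ "P\<^sup>2"]) simp
  \<comment> \<open>This k balances the two terms of \<open>incidences_le_cells\<close>. Minimality
    together with k <= 2 (k - 1) gives k^3 n < 8 P^2.\<close>
  define k where "k = (LEAST k. P\<^sup>2 \<le> k ^ 3 * n)"
  have k: "P\<^sup>2 \<le> k ^ 3 * n" unfolding k_def using LeastI_ex[OF ex] .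
  have kmin: "j ^ 3 * n < P\<^sup>2" if "j < k" for j
    using not_less_Least[of j "\<lambda>k. P\<^sup>2 \<le> k ^ 3 * n"] that unfolding k_def by simp
  have k2: "2 \<le> k"
  proof (rule ccontr)
    assume "\<not> 2 \<le> k"
    then have "k = 0 \<or> k = 1" by linarith
    then show False using k Pn by auto
  qed
  show ?thesis
  proof (cases "k \<le> card X \<and> k \<le> card Y")
    case True
    have "(k - 1) ^ 3 * n < P\<^sup>2" using k2 by (intro kmin) simp
    moreover have "k ^ 3 \<le> (2 * (k - 1)) ^ 3" using k2 by (intro power_mono) auto
    moreover have "(2 * (k - 1)) ^ 3 * n = 8 * ((k - 1) ^ 3 * n)" by (simp only: power_mult_distrib) simp
    ultimately have k8: "k ^ 3 * n < 8 * P\<^sup>2"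
      using mult_le_mono1[of "k ^ 3" "(2 * (k - 1)) ^ 3" n] by linarith
    define I where "I = real ?I"
    have "k\<^sup>2 * ?I \<le> 2 * k ^ 3 * n + 4 * P\<^sup>2"
      unfolding n_def P_def using incidences_le_cells[OF fin nz] True k2 by simp
    then have "real (k\<^sup>2 * ?I) \<le> real (2 * k ^ 3 * n + 4 * P\<^sup>2)" by (simp only: of_nat_le_iff)
    then have a: "real k ^ 2 * I \<le> 2 * real k ^ 3 * n + 4 * real P ^ 2" unfolding I_def by simp
    have "real (k ^ 3 * n) \<le> real (8 * P\<^sup>2)" "real (P\<^sup>2) \<le> real (k ^ 3 * n)"
      using k8 k by (simp_all only: of_nat_le_iff)
    then have b: "real k ^ 3 * n \<le> 8 * real P ^ 2" "real P ^ 2 \<le> real k ^ 3 * n" by simp_all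
    have "real k ^ 2 * I \<le> 6 * (real k ^ 3 * n)" using a b by linarith
    then have "I \<le> 6 * (k * n)" using k2 by (simp add: power2_eq_square power3_eq_cube)
    then have "I ^ 3 \<le> (6 * (real k * n)) ^ 3" unfolding I_def by (intro power_mono) (auto intro: sum_nonneg)
    also have "\<dots> = 216 * (real k ^ 3 * n) * real n ^ 2" by (simp add: power_mult_distrib power3_eq_cube power2_eq_square)
    also have "\<dots> \<le> 216 * (8 * real P ^ 2) * real n ^ 2" using b by (intro mult_right_mono mult_left_mono) auto
    also have "\<dots> = real (1728 * (P * n)\<^sup>2)" by (simp add: power_mult_distrib)
    finally have "real (?I ^ 3) \<le> real (1728 * (P * n)\<^sup>2)" unfolding I_def by simp
    then show ?thesis unfolding P_def n_def of_nat_le_iff .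
  next
    case False
    \<comment> \<open>The grid is too thin for k blocks on each side. Then x < k, and minimality of
      k at x makes the trivial bound n x strong enough.\<close>
    define x where "x = min (card X) (card Y)"
    have "x ^ 3 * n < P\<^sup>2" using False by (intro kmin) (auto simp: x_def)
    have "?I ^ 3 \<le> (n * x) ^ 3" unfolding n_def x_def
      by (intro power_mono incidences_le_rows fin nz) auto
    also have "\<dots> = (x ^ 3 * n) * n\<^sup>2" by (simp add: power_mult_distrib power3_eq_cube power2_eq_square)
    also have "\<dots> \<le> P\<^sup>2 * n\<^sup>2" using \<open>x ^ 3 * n < P\<^sup>2\<close> by (intro mult_right_mono) auto
    also have "\<dots> \<le> 1728 * (P * n)\<^sup>2" by (simp add: power_mult_distrib)
    finally show ?thesis by (simp add: P_def n_def)
  qed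
qed


text \<open>For a product of slopes and intercepts no restriction on the number of lines is needed.
  If |D||C| >= (|X||Y|)^2, two trivial bounds suffice: (x, y, d) fixes c and, since x is nonzero,
  (x, y, c) fixes d.\<close>

lemma szemeredi_trotter_cartesian:
  fixes X Y D C :: "real set"
  assumes fin: "finite X" "finite Y" "finite D" "finite C" and nz: "0 \<notin> X" "0 \<notin> D"
  shows "card {(x, y, d, c). x \<in> X \<and> y \<in> Y \<and> d \<in> D \<and> c \<in> C \<and> y = d * x + c} ^ 3
      \<le> 1728 * (card X * card Y * card D * card C)\<^sup>2"
proof -
  define T where "T = {(x, y, d, c). x \<in> X \<and> y \<in> Y \<and> d \<in> D \<and> c \<in> C \<and> y = d * x + c}"
  have "T \<subseteq> X \<times> Y \<times> D \<times> C" unfolding T_def by auto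
  then have finT: "finite T" by (rule finite_subset) (use fin in simp)
  show ?thesis
  proof (cases "card (D \<times> C) < (card X * card Y)\<^sup>2")
    case True
    have "(\<Sum>l\<in>D \<times> C. card {x \<in> X. fst l * x + snd l \<in> Y})
        = card (SIGMA l:D \<times> C. {x \<in> X. fst l * x + snd l \<in> Y})" using fin by simp
    also have "\<dots> = card T"
      by (rule bij_betw_same_card[of "\<lambda>((d, c), x). (x, d * x + c, d, c)"])
        (auto simp: bij_betw_def inj_on_def image_iff T_def)
    finally show ?thesis
      using szemeredi_trotter_grid[OF fin(1,2) _ _ True] fin nz unfolding T_def[symmetric]
      by (simp add: mult_ac) (metis mem_Sigma_iff prod.collapse)
  next
    case False
    have "card T \<le> card (X \<times> Y \<times> D)"
      by (rule card_inj_on_le[of "\<lambda>(x, y, d, c). (x, y, d)"]) (use fin in \<open>auto simp: inj_on_def T_def\<close>)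
    moreover have "card T \<le> card (X \<times> Y \<times> C)"
      by (rule card_inj_on_le[of "\<lambda>(x, y, d, c). (x, y, c)"])
        (use fin nz in \<open>auto simp: inj_on_def T_def\<close>)
    ultimately have "card T ^ 2 \<le> (card X * card Y)\<^sup>2 * (card D * card C)"
      using mult_le_mono[of "card T" "card (X \<times> Y \<times> D)" "card T" "card (X \<times> Y \<times> C)"]
      by (simp add: card_cartesian_product power2_eq_square mult_ac)
    then have "(card T ^ 2) ^ 3 \<le> ((card X * card Y)\<^sup>2 * (card D * card C)) ^ 3" by (rule power_mono) simp
    also have "\<dots> = (card X * card Y)\<^sup>2 * ((card X * card Y)\<^sup>2 * ((card X * card Y)\<^sup>2 * (card D * card C) ^ 3))"
      by (simp add: power_mult_distrib power2_eq_square power3_eq_cube mult_ac)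
    also have "\<dots> \<le> (card D * card C) * ((card X * card Y)\<^sup>2 * ((card X * card Y)\<^sup>2 * (card D * card C) ^ 3))"
      using False by (intro mult_le_mono1) (simp add: card_cartesian_product)
    also have "\<dots> = ((card X * card Y * card D * card C)\<^sup>2) ^ 2"
      by (simp add: power_mult_distrib power2_eq_square power3_eq_cube mult_ac)
    finally have "(card T ^ 3)\<^sup>2 \<le> ((card X * card Y * card D * card C)\<^sup>2) ^ 2"
      by (simp flip: power_mult add: mult.commute)
    then have "card T ^ 3 \<le> (card X * card Y * card D * card C)\<^sup>2"
      by (rule power2_le_imp_le) simp
    then show ?thesis unfolding T_def[symmetric] by linarith
  qed
qed

section \<open>Popular differences\<close>

text \<open>The representation function of p as a difference w - c. For C = W its second and third
  moments are the additive energy of W and the third-order energy.\<close>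

definition shifts :: "'a::plus set \<Rightarrow> 'a set \<Rightarrow> 'a \<Rightarrow> nat"
  where "shifts W C p = card {c \<in> C. p + c \<in> W}"

text \<open>Each y in Y has t values c with y + c in W, and each of these equals d x for \<rho>
  pairs (x, d): the point (x, y) lies on the line of slope d and intercept -c. The resulting |Y| t
  \<rho> incidences are compared with Szemeredi-Trotter, where two of the three factors |Y| cancel.
  In this way multiplicative structure of W limits its popular differences.\<close>

lemma card_rich_shifts_le:
  fixes W X D C Y :: "real set" and \<rho> t :: real
  assumes fin: "finite X" "finite D" "finite C" "finite Y" and nz: "0 \<notin> X" "0 \<notin> D"
    and \<rho>: "0 \<le> \<rho>" "\<And>w. w \<in> W \<Longrightarrow> \<rho> \<le> card {(x, d). x \<in> X \<and> d \<in> D \<and> w = d * x}"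
    and t: "0 \<le> t" "\<And>y. y \<in> Y \<Longrightarrow> t \<le> shifts W C y"
  shows "card Y * t ^ 3 * \<rho> ^ 3 \<le> 1728 * (real (card X) * card D * card C)\<^sup>2"
proof (cases "Y = {}")
  case True
  then show ?thesis by simp
next
  case False
  then have Y0: "0 < card Y" using fin by (simp add: card_gt_0_iff)
  define C' where "C' = uminus ` C"
  have C': "finite C'" "card C' = card C" using fin by (auto simp: C'_def card_image)
  define T where "T = {(x, y, d, c). x \<in> X \<and> y \<in> Y \<and> d \<in> D \<and> c \<in> C' \<and> y = d * x + c}"
  define R where "R w = {(x, d). x \<in> X \<and> d \<in> D \<and> w = d * x}" for w
  have finR: "finite (R w)" for w
    by (rule finite_subset[of _ "X \<times> D"]) (use fin in \<open>auto simp: R_def\<close>)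
  have finT: "finite T"
    by (rule finite_subset[of _ "X \<times> Y \<times> D \<times> C'"]) (use fin C' in \<open>auto simp: T_def\<close>)
  have "card Y * t * \<rho> = (\<Sum>y\<in>Y. t * \<rho>)" by simp
  also have "\<dots> \<le> (\<Sum>y\<in>Y. \<Sum>c\<in>{c \<in> C. y + c \<in> W}. real (card (R (y + c))))"
  proof (rule sum_mono)
    fix y assume "y \<in> Y"
    have "t * \<rho> \<le> (\<Sum>c\<in>{c \<in> C. y + c \<in> W}. \<rho>)"
      using t(2)[OF \<open>y \<in> Y\<close>] \<rho>(1) by (auto simp: shifts_def intro: mult_right_mono)
    also have "\<dots> \<le> (\<Sum>c\<in>{c \<in> C. y + c \<in> W}. real (card (R (y + c))))"
      using \<rho>(2) by (intro sum_mono) (auto simp: R_def)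
    finally show "t * \<rho> \<le> (\<Sum>c\<in>{c \<in> C. y + c \<in> W}. real (card (R (y + c))))" .
  qed
  also have "\<dots> = real (card (SIGMA y:Y. SIGMA c:{c \<in> C. y + c \<in> W}. R (y + c)))"
    using fin finR by simp
  also have "card (SIGMA y:Y. SIGMA c:{c \<in> C. y + c \<in> W}. R (y + c)) \<le> card T"
    by (rule card_inj_on_le[OF _ _ finT, of "\<lambda>(y, c, x, d). (x, y, d, - c)"])
      (auto simp: inj_on_def T_def R_def C'_def)
  finally have "(card Y * t * \<rho>) ^ 3 \<le> real (card T) ^ 3"
    using t \<rho> by (intro power_mono) auto
  also have "\<dots> = real (card T ^ 3)" by simp
  also have "\<dots> \<le> real (1728 * (card X * card Y * card D * card C)\<^sup>2)"
    using szemeredi_trotter_cartesian[OF fin(1,4,2) C'(1) nz] unfolding T_def C' of_nat_le_iff by blast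
  finally have "(real (card Y))\<^sup>2 * (card Y * t ^ 3 * \<rho> ^ 3)
      \<le> (real (card Y))\<^sup>2 * (1728 * (real (card X) * card D * card C)\<^sup>2)"
    by (simp add: power_mult_distrib power2_eq_square power3_eq_cube mult_ac)
  then show ?thesis using Y0 by simp
qed

text \<open>An upper Riemann sum for m^k as the integral of k t^(k-1).\<close>

lemma power_le_sum_derivative:
  assumes "k \<ge> 1"
  shows "real (m ^ k) \<le> (\<Sum>t=1..m. real k * real t ^ (k - 1))"
proof (induction m)
  case (Suc m)
  have "real (Suc m) ^ k - real m ^ k \<le> real k * real (Suc m) ^ (k - 1)"
  proof (cases k)
    case (Suc j)
    have "real (Suc m) ^ k - real m ^ k
        = (real (Suc m) - real m) * (\<Sum>i<Suc j. real m ^ (j - i) * real (Suc m) ^ i)"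
      unfolding Suc by (subst power_diff_sumr2) simp
    also have "\<dots> \<le> 1 * (\<Sum>i<Suc j. real (Suc m) ^ (j - i) * real (Suc m) ^ i)"
      by (intro mult_mono sum_mono power_mono sum_nonneg) auto
    also have "\<dots> = real k * real (Suc m) ^ (k - 1)"
      unfolding Suc by (simp flip: power_add)
    finally show ?thesis .
  qed simp
  then show ?case using Suc by simp
qed (use assms in \<open>simp add: power_0_left\<close>)

text \<open>Layer-cake summation: level t contributes k t^(k-1) #{f >= t}, which is at most k U /
  t.\<close>

lemma moment_le_weak_bound:
  fixes f :: "'a \<Rightarrow> nat" and U :: real
  assumes "finite S" "\<And>x. x \<in> S \<Longrightarrow> f x \<le> n" "k \<ge> 1"
    and U: "\<And>t. 1 \<le> t \<Longrightarrow> t \<le> n \<Longrightarrow> real t ^ k * card {x \<in> S. t \<le> f x} \<le> U"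
  shows "(\<Sum>x\<in>S. real (f x ^ k)) \<le> k * U * harm n"
proof -
  have "(\<Sum>x\<in>S. real (f x ^ k)) \<le> (\<Sum>x\<in>S. \<Sum>t=1..n. if t \<le> f x then k * real t ^ (k - 1) else 0)"
  proof (rule sum_mono)
    fix x assume "x \<in> S"
    then have "{t \<in> {1..n}. t \<le> f x} = {1..f x}" using assms(2) by force
    then show "real (f x ^ k) \<le> (\<Sum>t=1..n. if t \<le> f x then k * real t ^ (k - 1) else 0)"
      using power_le_sum_derivative[OF assms(3), of "f x"] by (simp add: sum.If_cases Int_def)
  qed
  also have "\<dots> = (\<Sum>t=1..n. \<Sum>x\<in>S. if t \<le> f x then k * real t ^ (k - 1) else 0)" by (rule sum.swap)
  also have "\<dots> = (\<Sum>t=1..n. k * real t ^ (k - 1) * card {x \<in> S. t \<le> f x})"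
    using assms(1) by (simp add: sum.If_cases Int_def mult_ac)
  also have "\<dots> \<le> (\<Sum>t=1..n. k * U * inverse (real t))"
  proof (rule sum_mono)
    fix t assume t: "t \<in> {1..n}"
    have "real t ^ (k - 1) * card {x \<in> S. t \<le> f x} = inverse t * (real t ^ k * card {x \<in> S. t \<le> f x})"
      using t assms(3) by (cases k) auto
    also have "\<dots> \<le> inverse t * U" using t by (intro mult_left_mono U) auto
    finally have "k * (real t ^ (k - 1) * card {x \<in> S. t \<le> f x}) \<le> k * (inverse t * U)"
      by (intro mult_left_mono) auto
    then show "k * real t ^ (k - 1) * card {x \<in> S. t \<le> f x} \<le> k * U * inverse (real t)"
      by (simp add: mult_ac)
  qed
  also have "\<dots> = k * U * harm n" by (simp add: harm_def sum_distrib_left)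
  finally show ?thesis .
qed

text \<open>Here U is taken to be the largest value of t^k #{f >= t}; the level attaining it carries
  the moment up to a harmonic number.\<close>

lemma ex_popular_level:
  fixes f :: "'a \<Rightarrow> nat"
  assumes "finite S" "\<And>x. x \<in> S \<Longrightarrow> f x \<le> n" "k \<ge> 1" "n \<ge> 1"
  obtains t where "1 \<le> t" "t \<le> n"
    "(\<Sum>x\<in>S. real (f x ^ k)) \<le> k * (real t ^ k * card {x \<in> S. t \<le> f x}) * harm n"
proof -
  let ?g = "\<lambda>t. real t ^ k * card {x \<in> S. t \<le> f x}"
  obtain t where t: "t \<in> {1..n}" "?g t = Max (?g ` {1..n})"
    using Max_in[of "?g ` {1..n}"] assms(4) by fastforce
  have "?g s \<le> ?g t" if "1 \<le> s" "s \<le> n" for s unfolding t(2) using that by (intro Max_ge) auto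
  from moment_le_weak_bound[OF assms(1-3) this] t(1) show thesis by (intro that) auto
qed


section \<open>Collinear triples and multiplicative energy\<close>

abbreviation coll :: "('a \<Rightarrow> 'b) \<Rightarrow> 'a set \<Rightarrow> ('a \<times> 'a) set"
  where "coll f S \<equiv> {(x, y). x \<in> S \<and> y \<in> S \<and> f x = f y}"

lemma finite_coll [simp]: "finite S \<Longrightarrow> finite (coll f S)"
  by (rule finite_subset[of _ "S \<times> S"]) auto

lemma card_matches_eq_sum_fibers:
  assumes "finite U" "finite V" "finite R" "f ` U \<subseteq> R"
  shows "card {(u, v). u \<in> U \<and> v \<in> V \<and> f u = g v}
    = (\<Sum>x\<in>R. card {u \<in> U. f u = x} * card {v \<in> V. g v = x})"
proof -
  have "(\<Sum>x\<in>R. card {u \<in> U. f u = x} * card {v \<in> V. g v = x})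
      = card (SIGMA x:R. {u \<in> U. f u = x} \<times> {v \<in> V. g v = x})"
    using assms by (simp add: card_cartesian_product)
  also have "\<dots> = card {(u, v). u \<in> U \<and> v \<in> V \<and> f u = g v}"
    by (rule bij_betw_same_card[of snd]) (use assms(4) in \<open>auto simp: bij_betw_def inj_on_def image_iff\<close>)
  finally show ?thesis by simp
qed

lemma card_matches_power2_le:
  assumes "finite U" "finite V"
  shows "(card {(u, v). u \<in> U \<and> v \<in> V \<and> f u = g v})\<^sup>2 \<le> card (coll f U) * card (coll g V)"
proof -
  let ?R = "f ` U \<union> g ` V"
  let ?a = "\<lambda>x. real (card {u \<in> U. f u = x})" and ?b = "\<lambda>x. real (card {v \<in> V. g v = x})"
  have "(real (card {(u, v). u \<in> U \<and> v \<in> V \<and> f u = g v}))\<^sup>2 = (\<Sum>x\<in>?R. ?a x * ?b x)\<^sup>2"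
    using card_matches_eq_sum_fibers[of U V ?R f g] assms by simp
  also have "\<dots> \<le> (\<Sum>x\<in>?R. (?a x)\<^sup>2) * (\<Sum>x\<in>?R. (?b x)\<^sup>2)" by (rule Cauchy_Schwarz_ineq_sum)
  also have "(\<Sum>x\<in>?R. (?a x)\<^sup>2) = real (card (coll f U))"
    using card_matches_eq_sum_fibers[of U U ?R f f] assms by (simp add: power2_eq_square)
  also have "(\<Sum>x\<in>?R. (?b x)\<^sup>2) = real (card (coll g V))"
    using card_matches_eq_sum_fibers[of V V ?R g g] assms by (simp add: power2_eq_square)
  finally show ?thesis unfolding of_nat_power[symmetric] of_nat_mult[symmetric] of_nat_le_iff .
qed

text \<open>The line y = s x + i is coded as (s, i), and a point on it by its abscissa; vertical
  lines never occur.\<close>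

definition line_points :: "real set \<Rightarrow> real \<times> real \<Rightarrow> real set"
  where "line_points Z l = {x \<in> Z. fst l * x + snd l \<in> Z}"

definition spanned_lines :: "real set \<Rightarrow> (real \<times> real) set"
  where "spanned_lines Z = {l. fst l \<noteq> 0 \<and> 2 \<le> card (line_points Z l)}"

text \<open>Two points with different abscissae determine the line. Pairs with equal abscissae are
  left over, and this makes the inequality strict, as \<open>szemeredi_trotter_grid\<close>
  demands.\<close>

lemma card_spanned_lines:
  assumes "finite Z" "Z \<noteq> {}"
  shows "finite (spanned_lines Z)" "card (spanned_lines Z) < (card Z * card Z)\<^sup>2"
proof -
  define g :: "(real \<times> real) \<times> (real \<times> real) \<Rightarrow> real \<times> real" where
    "g = (\<lambda>((x, y), (x', y')). let s = (y' - y) / (x' - x) in (s, y - s * x))"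
  define Q where "Q = (Z \<times> Z) \<times> (Z \<times> Z)"
  define Q' where "Q' = {((x, y), (x', y')). ((x, y), (x', y')) \<in> Q \<and> x \<noteq> x'}"
  have finQ: "finite Q" using assms by (simp add: Q_def)
  obtain z where "z \<in> Z" using assms by blast
  then have "((z, z), (z, z)) \<in> Q - Q'" by (auto simp: Q_def Q'_def)
  then have sub: "Q' \<subset> Q" unfolding Q'_def by blast
  then have finQ': "finite Q'" using finQ finite_subset by blast
  have "spanned_lines Z \<subseteq> g ` Q'"
  proof
    fix l assume l: "l \<in> spanned_lines Z"
    have "finite (line_points Z l)" using assms by (simp add: line_points_def)
    then obtain x x' where x: "x \<in> line_points Z l" "x' \<in> line_points Z l" "x \<noteq> x'"
      using l card_le_Suc0_iff_eq[of "line_points Z l"] unfolding spanned_lines_def by fastforce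
    define s where "s = fst l"
    define i where "i = snd l"
    have li: "l = (s, i)" by (simp add: s_def i_def)
    have "(s * x' + i - (s * x + i)) / (x' - x) = s" using x(3) by (simp add: field_simps)
    then have "l = g ((x, s * x + i), (x', s * x' + i))" unfolding g_def li Let_def prod.case by simp
    moreover have "((x, s * x + i), (x', s * x' + i)) \<in> Q'"
      using x by (auto simp: Q'_def Q_def line_points_def li)
    ultimately show "l \<in> g ` Q'" by (rule image_eqI)
  qed
  then show "finite (spanned_lines Z)" using finQ' finite_surj by blast
  have "card (spanned_lines Z) \<le> card Q'"
    using \<open>spanned_lines Z \<subseteq> g ` Q'\<close> surj_card_le[OF finQ'] by blast
  also have "\<dots> < card Q" using sub finQ by (rule psubset_card_mono[rotated])
  also have "card Q = (card Z * card Z)\<^sup>2"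
    by (simp add: Q_def card_cartesian_product power2_eq_square)
  finally show "card (spanned_lines Z) < (card Z * card Z)\<^sup>2" .
qed

text \<open>The left side counts ordered collinear triples, repetitions allowed. It is a third
  moment, and Szemeredi-Trotter is the weak bound: at most 1728 |Z|^4 / t^3 lines have t
  points.\<close>

lemma sum_cubed_line_points_le:
  assumes "finite Z" "Z \<noteq> {}"
  shows "(\<Sum>l\<in>spanned_lines Z. real (card (line_points Z l) ^ 3)) \<le> 5184 * real (card Z) ^ 4 * harm (card Z)"
proof -
  note fin = card_spanned_lines[OF assms]
  have "(\<Sum>l\<in>spanned_lines Z. real (card (line_points Z l) ^ 3))
      \<le> 3 * (1728 * real (card Z) ^ 4) * harm (card Z)"
  proof (rule order_trans[OF moment_le_weak_bound[where k = 3 and n = "card Z" and U = "1728 * real (card Z) ^ 4"]])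
    show "card (line_points Z l) \<le> card Z" for l
      unfolding line_points_def using assms by (intro card_mono) auto
    fix t assume "1 \<le> t" "t \<le> card Z"
    define L where "L = {l \<in> spanned_lines Z. t \<le> card (line_points Z l)}"
    have L: "finite L" "card L < (card Z * card Z)\<^sup>2" "\<And>l. l \<in> L \<Longrightarrow> fst l \<noteq> 0"
    proof -
      have sub: "L \<subseteq> spanned_lines Z" unfolding L_def by blast
      show "finite L" using sub fin(1) by (rule finite_subset)
      show "card L < (card Z * card Z)\<^sup>2" using card_mono[OF fin(1) sub] fin(2) by linarith
      show "fst l \<noteq> 0" if "l \<in> L" for l using that sub unfolding spanned_lines_def by blast
    qed
    have "(t * card L) ^ 3 \<le> (\<Sum>l\<in>L. card {x \<in> Z. fst l * x + snd l \<in> Z}) ^ 3"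
    proof (rule power_mono)
      have "t * card L = (\<Sum>l\<in>L. t)" by simp
      also have "\<dots> \<le> (\<Sum>l\<in>L. card {x \<in> Z. fst l * x + snd l \<in> Z})"
        by (intro sum_mono) (auto simp: L_def line_points_def)
      finally show "t * card L \<le> (\<Sum>l\<in>L. card {x \<in> Z. fst l * x + snd l \<in> Z})" .
    qed simp
    also have "\<dots> \<le> 1728 * (card Z * card Z * card L)\<^sup>2"
      by (rule szemeredi_trotter_grid[OF assms(1) assms(1) L(1) L(3) L(2)])
    finally have "(card L)\<^sup>2 * (t ^ 3 * card L) \<le> (card L)\<^sup>2 * (1728 * card Z ^ 4)"
      by (simp add: power_mult_distrib power2_eq_square power3_eq_cube power4_eq_xxxx mult_ac)
    then have "t ^ 3 * card L \<le> 1728 * card Z ^ 4" by (cases "card L = 0") auto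
    then have "real (t ^ 3 * card L) \<le> real (1728 * card Z ^ 4)" unfolding of_nat_le_iff .
    then show "real t ^ 3 * real (card {l \<in> spanned_lines Z. t \<le> card (line_points Z l)})
        \<le> 1728 * real (card Z) ^ 4" unfolding L_def by simp
  qed (use fin in auto)
  then show ?thesis by simp
qed

definition mult_energy :: "real set \<Rightarrow> nat"
  where "mult_energy A = card (coll (\<lambda>(g, h). g * h) (A \<times> A))"

lemma card_coll_quotient_le:
  assumes "finite A" "0 \<notin> A"
  shows "card (coll (\<lambda>(g, g'). g' / g) (A \<times> A)) \<le> mult_energy A"
  unfolding mult_energy_def
proof (rule card_inj_on_le[of "\<lambda>((g, g'), (h, h')). ((g', h), (h', g))"])
  show "(\<lambda>((g, g'), (h, h')). ((g', h), (h', g))) ` coll (\<lambda>(g, g'). g' / g) (A \<times> A)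
      \<subseteq> coll (\<lambda>(g, h). g * h) (A \<times> A)"
  proof clarsimp
    fix g g' h h' assume "g \<in> A" "h \<in> A" "g' / g = h' / h"
    moreover from this have "g \<noteq> 0" "h \<noteq> 0" using assms(2) by auto
    ultimately show "g' * h = h' * g" by (simp add: frac_eq_eq)
  qed
qed (use assms in \<open>auto simp: inj_on_def\<close>)

text \<open>If (h + a) / (h' + a) = (h1 + a1) / (h1' + a1), then the points (-a, -a1), (h, h1), (h',
  h1') of Z x Z lie on one line, of slope (h1 + a1) / (h + a). So coincidences of ratios are
  collinear triples.\<close>

lemma card_coll_shifted_ratio_le:
  fixes A A' Z :: "real set"
  assumes "finite Z" "A \<subseteq> Z" "uminus ` A' \<subseteq> Z"
  defines "V \<equiv> {(a, h, h'). a \<in> A' \<and> h \<in> A \<and> h' \<in> A \<and> h + a \<noteq> 0 \<and> h' + a \<noteq> 0}"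
  shows "real (card (coll (\<lambda>(a, h, h'). (h + a) / (h' + a)) V)) \<le> 5184 * real (card Z) ^ 4 * harm (card Z)"
proof (cases "Z = {}")
  case True
  then show ?thesis using assms by (auto simp: V_def)
next
  case False
  note fin = card_spanned_lines[OF assms(1) False]
  have finl: "finite (line_points Z l)" for l using assms by (simp add: line_points_def)
  define K where "K = (SIGMA l:spanned_lines Z. line_points Z l \<times> line_points Z l \<times> line_points Z l)"
  let ?c = "coll (\<lambda>(a, h, h'). (h + a) / (h' + a)) V"
  \<comment> \<open>\<open>G\<close> keeps the line and the three abscissae; the ordinates can be
    read off the line.\<close>
  define G :: "(real \<times> real \<times> real) \<times> (real \<times> real \<times> real) \<Rightarrow> (real \<times> real) \<times> real \<times> real \<times> real" where
    "G = (\<lambda>((a, h, h'), (a1, h1, h1')).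
      let s = (h1 + a1) / (h + a) in ((s, - a1 + s * a), - a, h, h'))"
  have on_line: "fst l * - a + snd l = - a1 \<and> fst l * h + snd l = h1 \<and> fst l * h' + snd l = h1' \<and> fst l \<noteq> 0"
    if "((a, h, h'), (a1, h1, h1')) \<in> ?c" "l = fst (G ((a, h, h'), (a1, h1, h1')))" for a h h' a1 h1 h1' l
  proof -
    have nz: "h + a \<noteq> 0" "h' + a \<noteq> 0" "h1 + a1 \<noteq> 0" "h1' + a1 \<noteq> 0"
      and e: "(h + a) / (h' + a) = (h1 + a1) / (h1' + a1)" using that(1) by (auto simp: V_def)
    define s where "s = (h1 + a1) / (h + a)"
    have s: "s * (h + a) = h1 + a1" "s * (h' + a) = h1' + a1"
    proof -
      show "s * (h + a) = h1 + a1" using nz by (simp add: s_def)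
      have "(h1 + a1) * (h' + a) = (h1' + a1) * (h + a)"
        using e nz by (simp add: frac_eq_eq mult.commute)
      then show "s * (h' + a) = h1' + a1" using nz by (simp add: s_def nonzero_divide_eq_eq)
    qed
    have "s \<noteq> 0" using nz by (simp add: s_def)
    moreover have "l = (s, - a1 + s * a)" using that(2) by (simp add: G_def s_def Let_def)
    ultimately show ?thesis using s by (auto simp: algebra_simps)
  qed
  have "card ?c \<le> card K"
  proof (rule card_inj_on_le)
    show "inj_on G ?c"
    proof (rule inj_onI)
      fix p q assume p: "p \<in> ?c" and q: "q \<in> ?c" and e: "G p = G q"
      obtain a h h' a1 h1 h1' where pe: "p = ((a, h, h'), (a1, h1, h1'))" by (metis prod.collapse)
      obtain b k k' b1 k1 k1' where qe: "q = ((b, k, k'), (b1, k1, k1'))" by (metis prod.collapse)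
      have "a = b" "h = k" "h' = k'" using e by (simp_all add: pe qe G_def Let_def)
      moreover note on_line[OF p[unfolded pe], folded pe, of "fst (G p)"]
        on_line[OF q[unfolded qe], folded qe, of "fst (G p)"]
      ultimately have "a1 = b1 \<and> h1 = k1 \<and> h1' = k1'" using e by (metis neg_equal_iff_equal)
      then show "p = q" using \<open>a = b\<close> \<open>h = k\<close> \<open>h' = k'\<close> by (simp add: pe qe)
    qed
    show "G ` ?c \<subseteq> K"
    proof
      fix r assume "r \<in> G ` ?c"
      then obtain p where p: "p \<in> ?c" and r: "r = G p" by blast
      obtain a h h' a1 h1 h1' where pe: "p = ((a, h, h'), (a1, h1, h1'))" by (metis prod.collapse)
      define l where "l = fst (G p)"
      have rl: "r = (l, - a, h, h')" by (simp add: r l_def pe G_def Let_def)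
      have Z: "- a \<in> Z" "h \<in> Z" "h' \<in> Z" "- a1 \<in> Z" "h1 \<in> Z" "h1' \<in> Z" "h + a \<noteq> 0"
        using p assms(2,3) by (auto simp: pe V_def)
      note ol = on_line[OF p[unfolded pe], of l, folded pe, OF l_def]
      have pts: "- a \<in> line_points Z l" "h \<in> line_points Z l" "h' \<in> line_points Z l"
        using ol Z by (auto simp: line_points_def)
      \<comment> \<open>Since h + a is nonzero, -a and h are two different abscissae, so the line is
        spanned.\<close>
      have "{- a, h} \<subseteq> line_points Z l" using pts by simp
      then have "card {- a, h} \<le> card (line_points Z l)" by (intro card_mono finl)
      moreover have "- a \<noteq> h" using Z(7) by auto
      ultimately have "l \<in> spanned_lines Z" using ol by (simp add: spanned_lines_def)
      then show "r \<in> K" using pts by (simp add: K_def rl)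
    qed
    show "finite K" unfolding K_def using fin finl by (intro finite_SigmaI) auto
  qed
  also have "card K = (\<Sum>l\<in>spanned_lines Z. card (line_points Z l) ^ 3)"
    unfolding K_def using fin finl by (simp add: card_cartesian_product power3_eq_cube mult.assoc)
  finally have "real (card ?c) \<le> real (\<Sum>l\<in>spanned_lines Z. card (line_points Z l) ^ 3)"
    unfolding of_nat_le_iff .
  also have "\<dots> = (\<Sum>l\<in>spanned_lines Z. real (card (line_points Z l) ^ 3))" by simp
  also note sum_cubed_line_points_le[OF assms(1) False]
  finally show ?thesis .
qed

text \<open>Cauchy-Schwarz for (g, h) -> g (h + a) forces many coincidences for each a. Such a
  coincidence is a match g' / g = (h + a) / (h' + a). Summed over a, a second Cauchy-Schwarz
  separates the two sides: repeated quotients are counted by the energy, repeated ratios by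
  collinear triples.\<close>

lemma shifted_products_energy_le:
  fixes A A' Z :: "real set"
  assumes "finite A" "0 \<notin> A" "finite Z" "A \<subseteq> Z" "uminus ` A' \<subseteq> Z" "finite A'"
    and M: "\<And>a. a \<in> A' \<Longrightarrow> card (A * (a +o A)) \<le> M"
  shows "(real (card A') * (real (card A) * (real (card A) - 1))\<^sup>2)\<^sup>2
    \<le> (real M)\<^sup>2 * (mult_energy A * (5184 * real (card Z) ^ 4 * harm (card Z)))"
proof -
  define S where "S a = {(g, h). g \<in> A \<and> h \<in> A \<and> h + a \<noteq> 0}" for a
  define \<phi> where "\<phi> a = (\<lambda>(g, h). g * (h + a))" for a :: real
  define V where "V = {(a, h, h'). a \<in> A' \<and> h \<in> A \<and> h' \<in> A \<and> h + a \<noteq> 0 \<and> h' + a \<noteq> 0}"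
  define T where "T = {(u, v). u \<in> A \<times> A \<and> v \<in> V \<and> (\<lambda>(g, g'). g' / g) u = (\<lambda>(a, h, h'). (h + a) / (h' + a)) v}"
  have finS: "finite (S a)" for a by (rule finite_subset[of _ "A \<times> A"]) (use assms in \<open>auto simp: S_def\<close>)
  have finV: "finite V" by (rule finite_subset[of _ "A' \<times> A \<times> A"]) (use assms in \<open>auto simp: V_def\<close>)
  have finT: "finite T"
    by (rule finite_subset[of _ "(A \<times> A) \<times> V"]) (use assms finV in \<open>auto simp: T_def\<close>)
  have N: "(real (card A) * (real (card A) - 1))\<^sup>2 \<le> M * real (card (coll (\<phi> a) (S a)))" if "a \<in> A'" for a
  proof (cases "A = {}")
    case False
    then have "1 \<le> card A" using assms(1) by (simp add: Suc_leI card_gt_0_iff)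
    \<comment> \<open>Only h = -a is discarded, hence the factor N - 1.\<close>
    have "S a = A \<times> (A - {- a})" by (auto simp: S_def add_eq_0_iff2)
    then have "card (S a) = card A * card (A - {- a})" by (simp add: card_cartesian_product)
    moreover have "card A - 1 \<le> card (A - {- a})" using assms(1) by (simp add: card_Diff_singleton_if)
    ultimately have "real (card A) * (real (card A) - 1) \<le> real (card (S a))" 
      using \<open>1 \<le> card A\<close> by (simp add: mult_left_mono)
    then have "(real (card A) * (real (card A) - 1))\<^sup>2 \<le> (real (card (S a)))\<^sup>2"
      using \<open>1 \<le> card A\<close> by (intro power_mono) auto
    also have "\<dots> = real ((card (S a))\<^sup>2)" by simp
    also have "\<dots> \<le> real (card (\<phi> a ` S a) * card (coll (\<phi> a) (S a)))"
      unfolding of_nat_le_iff by (rule card_power2_le_collisions[OF finS])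
    also have "\<dots> \<le> M * real (card (coll (\<phi> a) (S a)))"
    proof -
      have "a +o A = (+) a ` A" by (auto simp: elt_set_plus_def)
      then have "finite (A * (a +o A))" using assms(1) by (simp add: finite_set_times)
      moreover have "\<phi> a ` S a \<subseteq> A * (a +o A)"
        by (auto simp: \<phi>_def S_def set_times_def elt_set_plus_def add.commute)
      ultimately have "card (\<phi> a ` S a) \<le> M" using M[OF that] card_mono order_trans by blast
      then show ?thesis by (simp add: mult_right_mono)
    qed
    finally show ?thesis .
  qed simp
  have "real (card A') * (real (card A) * (real (card A) - 1))\<^sup>2
      \<le> (\<Sum>a\<in>A'. M * real (card (coll (\<phi> a) (S a))))"
    using sum_mono[of A' "\<lambda>_. (real (card A) * (real (card A) - 1))\<^sup>2"] N by simp
  also have "\<dots> = M * real (card (SIGMA a:A'. coll (\<phi> a) (S a)))"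
    using assms finS by (simp add: sum_distrib_left)
  also have "card (SIGMA a:A'. coll (\<phi> a) (S a)) \<le> card T"
  proof (rule card_inj_on_le[OF _ _ finT, of "\<lambda>(a, (g, h), (g', h')). ((g, g'), (a, h, h'))"])
    show "(\<lambda>(a, (g, h), (g', h')). ((g, g'), (a, h, h'))) ` (SIGMA a:A'. coll (\<phi> a) (S a)) \<subseteq> T"
    proof clarsimp
      fix a g h g' h' assume *: "a \<in> A'" "(g, h) \<in> S a" "(g', h') \<in> S a" "\<phi> a (g, h) = \<phi> a (g', h')"
      then have "g \<noteq> 0" "h' + a \<noteq> 0" using assms(2) by (auto simp: S_def)
      then have "g' / g = (h + a) / (h' + a)" using * by (simp add: frac_eq_eq \<phi>_def mult.commute)
      then show "((g, g'), a, h, h') \<in> T" using * by (auto simp: T_def S_def V_def)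
    qed
  qed (auto simp: inj_on_def)
  finally have "(real (card A') * (real (card A) * (real (card A) - 1))\<^sup>2)\<^sup>2 \<le> (real M * card T)\<^sup>2"
    by (intro power_mono) (auto simp: mult_left_mono)
  also have "\<dots> = (real M)\<^sup>2 * real ((card T)\<^sup>2)" by (simp add: power_mult_distrib)
  also have "\<dots> \<le> (real M)\<^sup>2 * (mult_energy A * (5184 * real (card Z) ^ 4 * harm (card Z)))"
  proof (rule mult_left_mono)
    have "(card T)\<^sup>2 \<le> card (coll (\<lambda>(g, g'). g' / g) (A \<times> A)) * card (coll (\<lambda>(a, h, h'). (h + a) / (h' + a)) V)"
      unfolding T_def by (rule card_matches_power2_le) (use assms finV in auto)
    then have "real ((card T)\<^sup>2) \<le> real (card (coll (\<lambda>(g, g'). g' / g) (A \<times> A)))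
        * real (card (coll (\<lambda>(a, h, h'). (h + a) / (h' + a)) V))"
      unfolding of_nat_mult[symmetric] of_nat_le_iff .
    also have "\<dots> \<le> mult_energy A * (5184 * real (card Z) ^ 4 * harm (card Z))"
      using card_coll_quotient_le[OF assms(1,2)] card_coll_shifted_ratio_le[OF assms(3-5)]
      unfolding V_def by (intro mult_mono) auto
    finally show "real ((card T)\<^sup>2) \<le> mult_energy A * (5184 * real (card Z) ^ 4 * harm (card Z))" .
  qed simp
  finally show ?thesis .
qed


section \<open>Growth of dilated sumsets\<close>

lemma third_moment_shifts_le:
  fixes W X D C S :: "real set" and \<rho> :: real
  assumes fin: "finite X" "finite D" "finite C" "finite S" and nz: "0 \<notin> X" "0 \<notin> D"
    and \<rho>: "0 < \<rho>" "\<And>w. w \<in> W \<Longrightarrow> \<rho> \<le> card {(x, d). x \<in> X \<and> d \<in> D \<and> w = d * x}"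
  shows "(\<Sum>p\<in>S. real (shifts W C p ^ 3))
    \<le> 5184 * (real (card X) * card D * card C)\<^sup>2 / \<rho> ^ 3 * harm (card C)"
proof -
  have "(\<Sum>p\<in>S. real (shifts W C p ^ 3))
      \<le> real 3 * (1728 * (real (card X) * card D * card C)\<^sup>2 / \<rho> ^ 3) * harm (card C)"
  proof (rule moment_le_weak_bound[OF fin(4)])
    show "shifts W C p \<le> card C" for p unfolding shifts_def using fin by (intro card_mono) auto
    fix t :: nat assume "1 \<le> t"
    have "card {p \<in> S. t \<le> shifts W C p} * real t ^ 3 * \<rho> ^ 3 \<le> 1728 * (real (card X) * card D * card C)\<^sup>2"
      by (rule card_rich_shifts_le[OF fin(1-3) _ nz _ \<rho>(2)]) (use fin \<rho> in auto)
    then show "real t ^ 3 * card {p \<in> S. t \<le> shifts W C p}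
        \<le> 1728 * (real (card X) * card D * card C)\<^sup>2 / \<rho> ^ 3"
      using \<rho>(1) by (simp add: pos_le_divide_eq mult_ac)
  qed auto
  then show ?thesis by simp
qed

text \<open>
  In the application \<open>B1\<close> is \<open>B\<close> for difference sets and \<open>-B\<close> for sumsets; this is why only the
  shift counts of \<open>B1\<close> and \<open>B\<close> are compared.
\<close>

lemma additive_growth:
  fixes A B B1 S' :: "real set" and Z :: real
  defines "Dif \<equiv> (\<lambda>(b, c). b - c) ` (B \<times> B)"
  assumes fin: "finite A" "finite B" "finite B1" "finite S'" and A: "0 \<notin> A" "A \<noteq> {}"
    and B1: "card B1 = card B" "\<And>d. shifts B1 B1 d = shifts B B d" and ne: "B \<noteq> {}"
    and S': "\<And>u a b. \<lbrakk>u \<in> A; a \<in> B1; b \<in> B\<rbrakk> \<Longrightarrow> u * (a - b) \<in> S'" "card A \<le> card S'"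
    and Z: "\<And>t. 1 \<le> t \<Longrightarrow> real t ^ 3 * card {d \<in> Dif. t \<le> shifts B B d} \<le> Z"
  shows "real (card B) ^ 30 * card A \<le> 11950848 * real (card S') ^ 10 * Z ^ 5 * harm (card B) ^ 9"
proof -
  define \<beta> N M H where "\<beta> = real (card B)" and "N = real (card A)" and "M = real (card S')"
    and "H = (harm (card B) :: real)"
  have \<beta>: "\<beta> > 0" and N: "N > 0" and NM: "N \<le> M" and M: "M > 0"
    using ne A fin S'(2) by (auto simp: \<beta>_def N_def M_def card_gt_0_iff)
  have H: "H \<ge> 0" by (simp add: H_def harm_nonneg)
  have finD: "finite Dif" using fin by (simp add: Dif_def)
  have finsh: "finite {c \<in> B. d + c \<in> B}" "finite {c \<in> B1. d + c \<in> B1}" for d using fin by auto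
  define E2 E3 where "E2 = (\<Sum>d\<in>Dif. real (shifts B B d ^ 2))" and "E3 = (\<Sum>d\<in>Dif. real (shifts B B d ^ 3))"
  have shle: "shifts B B d \<le> card B" for d unfolding shifts_def using fin by (intro card_mono) auto
  have Z0: "0 \<le> Z" using Z[of 1] by (rule order_trans[rotated]) auto
  obtain u where u: "u \<in> A" using A by blast
  \<comment> \<open>Dilation by one fixed u embeds the differences a - b into
    \<open>S'\<close>.\<close>
  have diffs: "card ((\<lambda>(a, b). a - b) ` (B1 \<times> B)) \<le> card S'"
    by (rule card_inj_on_le[of "\<lambda>s. u * s"]) (use u A fin S' in \<open>auto simp: inj_on_def\<close>)
  \<comment> \<open>A coincidence a - b = a' - b' is the same as a - a' = b - b', so the equal shift
    counts of \<open>B1\<close> and \<open>B\<close> turn these into the additive energy of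
    \<open>B\<close>.\<close>
  have E2: "\<beta> ^ 4 \<le> M * E2"
  proof -
    let ?f = "\<lambda>(a, b). a - b :: real"
    let ?K = "SIGMA d:Dif. {c \<in> B1. d + c \<in> B1} \<times> {c \<in> B. d + c \<in> B}"
    have "card (coll ?f (B1 \<times> B)) \<le> card ?K"
    proof (rule card_inj_on_le[of "\<lambda>((a, b), (a', b')). (b - b', a', b')"])
      show "inj_on (\<lambda>((a, b), (a', b')). (b - b', a', b')) (coll ?f (B1 \<times> B))"
        by (auto simp: inj_on_def)
      show "(\<lambda>((a, b), (a', b')). (b - b', a', b')) ` coll ?f (B1 \<times> B) \<subseteq> ?K"
      proof clarsimp
        fix a b a' b' assume *: "a \<in> B1" "b \<in> B" "a' \<in> B1" "b' \<in> B" "a - b = a' - b'"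
        then have "b - b' + a' = a" by simp
        then show "b - b' \<in> Dif \<and> b - b' + a' \<in> B1" using * by (force simp: Dif_def)
      qed
      show "finite ?K" using finD finsh by (intro finite_SigmaI) auto
    qed
    also have "card ?K = (\<Sum>d\<in>Dif. shifts B B d ^ 2)"
      using finD finsh B1(2) by (simp add: card_cartesian_product power2_eq_square flip: shifts_def)
    finally have "real (card (coll ?f (B1 \<times> B))) \<le> E2"
      unfolding E2_def of_nat_sum[symmetric] of_nat_le_iff .
    moreover have "real ((card (B1 \<times> B))\<^sup>2) \<le> real (card (?f ` (B1 \<times> B)) * card (coll ?f (B1 \<times> B)))"
      unfolding of_nat_le_iff by (rule card_power2_le_collisions) (use fin in simp)
    moreover have "real (card (?f ` (B1 \<times> B))) \<le> M" using diffs by (simp add: M_def)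
    ultimately have "real ((card (B1 \<times> B))\<^sup>2) \<le> M * E2"
      using M by (smt (verit) mult_mono of_nat_0_le_iff of_nat_mult)
    then show ?thesis using B1(1) by (simp add: card_cartesian_product \<beta>_def power2_eq_square power4_eq_xxxx mult_ac)
  qed
  have E3: "E3 \<le> 3 * Z * H"
    unfolding E3_def H_def using moment_le_weak_bound[OF finD shle, where k = 3 and U = Z] Z by simp
  \<comment> \<open>The sixth power of a weak second-moment bound. Here 186732 = 27 * 6916, with 27
    from the cube of \<open>E3\<close> <= 3 Z H and 6916 = 4 * (1728 + 1) from the cube of a sum of
    two terms.\<close>
  define Y where "Y = 186732 * M ^ 4 * Z ^ 5 * H ^ 3 / (\<beta> ^ 6 * N)"
  have Y: "Y \<ge> 0" using M Z0 H \<beta> N by (simp add: Y_def)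
  have level: "real t ^ 2 * card {d \<in> Dif. t \<le> shifts B B d} \<le> root 6 Y" if t: "1 \<le> t" for t
  proof (cases "{d \<in> Dif. t \<le> shifts B B d} = {}")
    case True
    then show ?thesis using Y by (simp only: card.empty) simp
  next
    case False
    define P where "P = {d \<in> Dif. t \<le> shifts B B d}"
    define p where "p = real (card P)"
    have finP: "finite P" using finD by (simp add: P_def)
    then have p1: "p \<ge> 1" using False unfolding P_def[symmetric] p_def by (simp add: Suc_leI card_gt_0_iff)
    \<comment> \<open>Triples with b - c popular, recorded by (a - b, a - c). Two triples with the
      same record differ by a common translation, so \<open>E3\<close> bounds the coincidences and
      the image must be large.\<close>
    define S where "S = {(a, b, c). a \<in> B1 \<and> b \<in> B \<and> c \<in> B \<and> b - c \<in> P}"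
    define \<phi> where "\<phi> = (\<lambda>(a, b, c). (a - b, a - c :: real))"
    have finS: "finite S" by (rule finite_subset[of _ "B1 \<times> B \<times> B"]) (use fin in \<open>auto simp: S_def\<close>)
    have "\<beta> * p * t \<le> card S"
    proof -
      have "p * t \<le> (\<Sum>d\<in>P. real (shifts B B d))"
        using sum_mono[of P "\<lambda>_. real t" "\<lambda>d. real (shifts B B d)"] by (simp add: P_def p_def)
      also have "\<dots> = real (card (SIGMA d:P. {c \<in> B. d + c \<in> B}))"
        using finP finsh by (simp add: shifts_def)
      finally have "\<beta> * (p * t) \<le> real (card (B1 \<times> (SIGMA d:P. {c \<in> B. d + c \<in> B})))"
        using \<beta> by (simp add: card_cartesian_product B1 \<beta>_def)
      also have "card (B1 \<times> (SIGMA d:P. {c \<in> B. d + c \<in> B})) \<le> card S"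
        by (rule card_inj_on_le[of "\<lambda>(a, d, c). (a, d + c, c)"]) (use finS in \<open>auto simp: inj_on_def S_def\<close>)
      finally show ?thesis by (simp add: mult.assoc)
    qed
    then have "(\<beta> * p * t)\<^sup>2 \<le> (real (card S))\<^sup>2" using \<beta> p1 by (intro power_mono) auto
    also have "\<dots> = real ((card S)\<^sup>2)" by simp
    also have "\<dots> \<le> real (card (\<phi> ` S) * card (coll \<phi> S))"
      unfolding of_nat_le_iff by (rule card_power2_le_collisions[OF finS])
    also have "\<dots> \<le> real (card (\<phi> ` S)) * E3"
    proof -
      let ?K = "SIGMA d:Dif. {c \<in> B1. d + c \<in> B1} \<times> {c \<in> B. d + c \<in> B} \<times> {c \<in> B. d + c \<in> B}"
      have "card (coll \<phi> S) \<le> card ?K"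
      proof (rule card_inj_on_le[of "\<lambda>((a, b, c), (a', b', c')). (b - b', a', b', c')"])
        show "inj_on (\<lambda>((a, b, c), (a', b', c')). (b - b', a', b', c')) (coll \<phi> S)"
          by (auto simp: inj_on_def \<phi>_def)
        show "(\<lambda>((a, b, c), (a', b', c')). (b - b', a', b', c')) ` coll \<phi> S \<subseteq> ?K"
        proof clarsimp
          fix a b c a' b' c' assume *: "(a, b, c) \<in> S" "(a', b', c') \<in> S" "\<phi> (a, b, c) = \<phi> (a', b', c')"
          then have "b - b' + a' = a" "b - b' + c' = c" by (auto simp: \<phi>_def)
          then show "b - b' \<in> Dif \<and> a' \<in> B1 \<and> b - b' + a' \<in> B1 \<and> b' \<in> B \<and> b \<in> B \<and> c' \<in> B \<and> b - b' + c' \<in> B"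
            using * by (force simp: Dif_def S_def)
        qed
        show "finite ?K" using finD finsh by (intro finite_SigmaI) auto
      qed
      also have "card ?K = (\<Sum>d\<in>Dif. shifts B B d ^ 3)"
        using finD finsh B1(2)
        by (simp add: card_cartesian_product power3_eq_cube mult.assoc flip: shifts_def)
      finally have "real (card (coll \<phi> S)) \<le> E3" unfolding E3_def of_nat_sum[symmetric] of_nat_le_iff .
      then show ?thesis by (simp add: mult_left_mono)
    qed
    finally have S_le: "(\<beta> * p * t)\<^sup>2 \<le> real (card (\<phi> ` S)) * E3" .
    define k where "k = real (card (\<phi> ` S))"
    \<comment> \<open>For s = a - b and s' = a - c one has x s' = (s' - s) x + x s. This is an
      incidence with popular slope s' - s = b - c, while ordinate and intercept both lie in
      \<open>S'\<close>.\<close>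
    define T where "T = {(x, y, d, c). x \<in> A \<and> y \<in> S' \<and> d \<in> P - {0} \<and> c \<in> S' \<and> y = d * x + c}"
    have finT: "finite T"
      by (rule finite_subset[of _ "A \<times> S' \<times> P \<times> S'"]) (use fin finP in \<open>auto simp: T_def\<close>)
    have "N * k \<le> card T + N * M"
    proof -
      \<comment> \<open>Pairs with s = s' have slope 0 and must be set aside. There are at most M of
        them, and the resulting term N M is absorbed because N <= M.\<close>
      define K0 where "K0 = {q \<in> \<phi> ` S. fst q = snd q}"
      define K1 where "K1 = {q \<in> \<phi> ` S. fst q \<noteq> snd q}"
      have finK: "finite K0" "finite K1" using finS by (auto simp: K0_def K1_def)
      have "\<phi> ` S = K0 \<union> K1" unfolding K0_def K1_def by blast
      then have "card (\<phi> ` S) \<le> card K0 + card K1" using card_Un_le by metis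
      moreover have "card K0 \<le> card S'"
      proof (rule order_trans[OF _ diffs], rule card_inj_on_le[of fst])
        show "inj_on fst K0" by (auto simp: inj_on_def K0_def)
        show "fst ` K0 \<subseteq> (\<lambda>(a, b). a - b) ` (B1 \<times> B)" by (force simp: K0_def \<phi>_def S_def)
      qed (use fin in auto)
      moreover have "card (A \<times> K1) \<le> card T"
      proof (rule card_inj_on_le[OF _ _ finT, of "\<lambda>(x, s, s'). (x, x * s', s' - s, x * s)"])
        show "inj_on (\<lambda>(x, s, s'). (x, x * s', s' - s, x * s)) (A \<times> K1)"
          using A by (auto simp: inj_on_def)
        show "(\<lambda>(x, s, s'). (x, x * s', s' - s, x * s)) ` (A \<times> K1) \<subseteq> T"
        proof clarsimp
          fix x s s' assume x: "x \<in> A" and "(s, s') \<in> K1"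
          then obtain a b c where *: "a \<in> B1" "b \<in> B" "c \<in> B" "b - c \<in> P" "s = a - b" "s' = a - c" "s \<noteq> s'"
            by (auto simp: K1_def \<phi>_def S_def)
          have "s' - s = b - c" using * by simp
          then have "s' - s \<in> P" "s' - s \<noteq> 0" using * by simp_all
          moreover have "x * s \<in> S'" "x * s' \<in> S'" using * S'(1)[OF x] by simp_all
          moreover have "x * s' = (s' - s) * x + x * s" by (simp add: algebra_simps)
          ultimately show "(x, x * s', s' - s, x * s) \<in> T" using x unfolding T_def by blast
        qed
      qed
      ultimately have "card A * card (\<phi> ` S) \<le> card A * (card S' + card K1)" "card A * card K1 \<le> card T"
        by (auto simp: card_cartesian_product)
      then have "card A * card (\<phi> ` S) \<le> card A * card S' + card T" unfolding distrib_left by linarith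
      then have "real (card A * card (\<phi> ` S)) \<le> real (card A * card S' + card T)" unfolding of_nat_le_iff .
      then show ?thesis by (simp add: N_def k_def M_def)
    qed
    moreover have T3: "real (card T) ^ 3 \<le> 1728 * (N * M * p * M)\<^sup>2"
    proof -
      have "card T ^ 3 \<le> 1728 * (card A * card S' * card (P - {0}) * card S')\<^sup>2"
        unfolding T_def by (rule szemeredi_trotter_cartesian) (use fin finP A in auto)
      also have "\<dots> \<le> 1728 * (card A * card S' * card P * card S')\<^sup>2"
        by (intro mult_le_mono power_mono le_refl card_Diff1_le) auto
      finally have "real (card T ^ 3) \<le> real (1728 * (card A * card S' * card P * card S')\<^sup>2)"
        unfolding of_nat_le_iff .
      then show ?thesis by (simp add: N_def M_def p_def)
    qed
    moreover have "(N * M) ^ 3 \<le> (N * M * p * M)\<^sup>2"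
    proof -
      have "(N * M) ^ 3 = (N * M)\<^sup>2 * (N * M)" by (simp add: power2_eq_square power3_eq_cube)
      also have "\<dots> \<le> (N * M)\<^sup>2 * (p\<^sup>2 * M\<^sup>2)"
      proof (rule mult_left_mono)
        have "N * M \<le> M * M" using NM M by simp
        also have "\<dots> \<le> p\<^sup>2 * (M * M)" using p1 M by simp
        finally show "N * M \<le> p\<^sup>2 * M\<^sup>2" by (simp add: power2_eq_square)
      qed simp
      finally show ?thesis by (simp add: power_mult_distrib mult_ac)
    qed
    ultimately have "(N * k) ^ 3 \<le> 6916 * (N * M * p * M)\<^sup>2"
    proof -
      have cube: "(x + y) ^ 3 \<le> 4 * (x ^ 3 + y ^ 3)" if "x \<ge> 0" "y \<ge> 0" for x y :: real
      proof -
        have "4 * (x ^ 3 + y ^ 3) - (x + y) ^ 3 = 3 * ((x + y) * (x - y)\<^sup>2)" by algebra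
        moreover have "\<dots> \<ge> 0" using that by simp
        ultimately show ?thesis by linarith
      qed
      assume a: "N * k \<le> card T + N * M" and b: "real (card T) ^ 3 \<le> 1728 * (N * M * p * M)\<^sup>2"
        and c: "(N * M) ^ 3 \<le> (N * M * p * M)\<^sup>2"
      have "(N * k) ^ 3 \<le> (card T + N * M) ^ 3" using a N by (intro power_mono) (auto simp: k_def)
      also have "\<dots> \<le> 4 * (real (card T) ^ 3 + (N * M) ^ 3)" using N M by (intro cube) auto
      also have "\<dots> \<le> 4 * (1728 * (N * M * p * M)\<^sup>2 + (N * M * p * M)\<^sup>2)"
        using b c by (intro mult_left_mono add_mono) simp_all
      finally show ?thesis by simp
    qed
    then have "N\<^sup>2 * (N * k ^ 3) \<le> N\<^sup>2 * (6916 * M ^ 4 * p\<^sup>2)"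
      by (simp add: power_mult_distrib power2_eq_square power3_eq_cube power4_eq_xxxx mult_ac)
    then have k3: "N * k ^ 3 \<le> 6916 * M ^ 4 * p\<^sup>2" using N by simp
    have E30: "E3 \<ge> 0" unfolding E3_def by (intro sum_nonneg) auto
    have "((\<beta> * p * t)\<^sup>2) ^ 3 * N \<le> (k * E3) ^ 3 * N"
      using S_le N unfolding k_def by (intro mult_right_mono power_mono) auto
    also have "\<dots> = (N * k ^ 3) * E3 ^ 3" by (simp add: power_mult_distrib mult_ac)
    also have "\<dots> \<le> (6916 * M ^ 4 * p\<^sup>2) * (3 * Z * H) ^ 3"
      by (rule mult_mono[OF k3 power_mono[OF E3 E30]]) (use E30 in simp_all)
    finally have "p\<^sup>2 * (\<beta> ^ 6 * p ^ 4 * t ^ 6 * N) \<le> p\<^sup>2 * (186732 * M ^ 4 * Z ^ 3 * H ^ 3)"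
      by (simp add: power_mult_distrib eval_nat_numeral mult_ac)
    then have a: "\<beta> ^ 6 * p ^ 4 * t ^ 6 * N \<le> 186732 * M ^ 4 * Z ^ 3 * H ^ 3" using p1 by simp
    \<comment> \<open>The weak third-moment bound, used twice more, completes p^4 t^6 to (t^2
      p)^6.\<close>
    have b: "(real t ^ 3 * p)\<^sup>2 \<le> Z\<^sup>2" using Z[OF t] p1 by (intro power_mono) (auto simp: p_def P_def)
    have "(\<beta> ^ 6 * N) * (real t ^ 2 * p) ^ 6 = (\<beta> ^ 6 * p ^ 4 * t ^ 6 * N) * (real t ^ 3 * p)\<^sup>2"
      by (simp add: power_mult_distrib eval_nat_numeral mult_ac)
    also have "\<dots> \<le> (186732 * M ^ 4 * Z ^ 3 * H ^ 3) * Z\<^sup>2"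
      by (rule mult_mono[OF a b]) (use M Z0 H in simp_all)
    also have "\<dots> = (\<beta> ^ 6 * N) * Y"
      using \<beta> N by (simp add: Y_def eval_nat_numeral mult_ac)
    finally have "(real t ^ 2 * p) ^ 6 \<le> Y" using \<beta> N by simp
    then have "root 6 ((real t ^ 2 * p) ^ 6) \<le> root 6 Y" by (intro real_root_le_mono) auto
    then have "real t ^ 2 * p \<le> root 6 Y" using p1 by (subst (asm) real_root_power_cancel) auto
    then show ?thesis unfolding p_def P_def .
  qed
  \<comment> \<open>The weak bounds give an upper bound for \<open>E2\<close>, to be compared with
    \<beta>^4 <= M \<open>E2\<close>. The final constant is 11950848 = 2^6 * 186732.\<close>
  have "E2 \<le> 2 * root 6 Y * H"
    unfolding E2_def H_def using moment_le_weak_bound[OF finD shle, where k = 2 and U = "root 6 Y"] level by simp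
  moreover have "E2 \<ge> 0" unfolding E2_def by (intro sum_nonneg) auto
  ultimately have "E2 ^ 6 \<le> (2 * root 6 Y * H) ^ 6" by (intro power_mono)
  also have "\<dots> = 64 * Y * H ^ 6" using Y by (simp add: power_mult_distrib real_root_pow_pos2)
  finally have E26: "E2 ^ 6 \<le> 64 * Y * H ^ 6" .
  have "(\<beta> ^ 4) ^ 6 \<le> (M * E2) ^ 6" using E2 \<beta> by (intro power_mono) auto
  also have "\<dots> \<le> M ^ 6 * (64 * Y * H ^ 6)"
    unfolding power_mult_distrib using E26 M by (intro mult_left_mono) auto
  finally have "(\<beta> ^ 6 * N) * (\<beta> ^ 4) ^ 6 \<le> (\<beta> ^ 6 * N) * (M ^ 6 * (64 * Y * H ^ 6))"
    using \<beta> N by (intro mult_left_mono) auto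
  also have "\<dots> = 11950848 * M ^ 10 * Z ^ 5 * H ^ 9"
    using \<beta> N by (simp add: Y_def field_simps flip: power_add)
  also have "(\<beta> ^ 6 * N) * (\<beta> ^ 4) ^ 6 = \<beta> ^ 30 * N" by (simp add: mult_ac flip: power_add power_mult)
  finally show ?thesis unfolding \<beta>_def N_def M_def H_def .
qed


section \<open>Triples weighted by a positive semidefinite form\<close>

text \<open>
  The matrix \<open>F g g' = (\<Sum>k\<in>K. \<xi> k g * \<xi> k g')\<close> is positive semidefinite and \<open>s\<close> lists the
  coordinates of the all-ones vector in its Gram representation. The hypothesis says that the vectors
  \<open>f \<tau>\<close> add up to \<open>F 1\<close>, so the claim is \<open>\<langle>1, F 1\<rangle>\<^sup>3 \<le> |B|\<^sup>2 \<langle>F 1, F (F 1)\<rangle>\<close> after one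
  Cauchy-Schwarz over \<open>\<tau>\<close>.
\<close>

lemma gram_form_power3_le:
  fixes \<xi> :: "'k \<Rightarrow> 'g \<Rightarrow> real" and f :: "'t \<Rightarrow> 'g \<Rightarrow> real"
  defines "s \<equiv> \<lambda>B k. \<Sum>g\<in>B. \<xi> k g"
  assumes fin: "finite K" "finite B" "finite T"
    and f: "\<And>g. g \<in> B \<Longrightarrow> (\<Sum>\<tau>\<in>T. f \<tau> g) = (\<Sum>k\<in>K. s B k * \<xi> k g)"
  shows "(\<Sum>k\<in>K. (s B k)\<^sup>2) ^ 3
    \<le> card T * (card B)\<^sup>2 * (\<Sum>\<tau>\<in>T. \<Sum>k\<in>K. (\<Sum>g\<in>B. \<xi> k g * f \<tau> g)\<^sup>2)"
proof -
  define \<Phi> X where "\<Phi> = (\<Sum>k\<in>K. (s B k)\<^sup>2)" and "X = (\<Sum>\<tau>\<in>T. \<Sum>k\<in>K. (\<Sum>g\<in>B. \<xi> k g * f \<tau> g)\<^sup>2)"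
  define u where "u g = (\<Sum>\<tau>\<in>T. f \<tau> g)" for g
  define v where "v k = (\<Sum>g\<in>B. \<xi> k g * u g)" for k
  have \<Phi>0: "\<Phi> \<ge> 0" unfolding \<Phi>_def by (intro sum_nonneg) auto
  have "v k = (\<Sum>\<tau>\<in>T. 1 * (\<Sum>g\<in>B. \<xi> k g * f \<tau> g))" for k
    unfolding v_def u_def sum_distrib_left mult_1 by (rule sum.swap)
  then have "(v k)\<^sup>2 \<le> (\<Sum>\<tau>\<in>T. 1\<^sup>2) * (\<Sum>\<tau>\<in>T. (\<Sum>g\<in>B. \<xi> k g * f \<tau> g)\<^sup>2)" for k
    by (simp only: Cauchy_Schwarz_ineq_sum)
  then have "(\<Sum>k\<in>K. (v k)\<^sup>2) \<le> (\<Sum>k\<in>K. card T * (\<Sum>\<tau>\<in>T. (\<Sum>g\<in>B. \<xi> k g * f \<tau> g)\<^sup>2))"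
    by (intro sum_mono) simp
  also have "\<dots> = card T * X" unfolding X_def by (simp add: sum_distrib_left sum.swap[of _ K T])
  finally have v: "(\<Sum>k\<in>K. (v k)\<^sup>2) \<le> card T * X" .
  have "(\<Sum>g\<in>B. u g) = (\<Sum>g\<in>B. \<Sum>k\<in>K. s B k * \<xi> k g)" using f by (simp add: u_def)
  also have "\<dots> = (\<Sum>k\<in>K. s B k * s B k)"
    by (subst sum.swap) (simp add: s_def flip: sum_distrib_left)
  finally have sum_u: "(\<Sum>g\<in>B. 1 * u g) = \<Phi>" by (simp add: \<Phi>_def power2_eq_square)
  have "(\<Sum>g\<in>B. (u g)\<^sup>2) = (\<Sum>g\<in>B. \<Sum>k\<in>K. s B k * (\<xi> k g * u g))"
    using f by (intro sum.cong refl) (simp add: u_def power2_eq_square sum_distrib_right mult.assoc)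
  also have "\<dots> = (\<Sum>k\<in>K. s B k * v k)"
    by (subst sum.swap) (simp add: v_def sum_distrib_left)
  finally have sum_u2: "(\<Sum>g\<in>B. (u g)\<^sup>2) = (\<Sum>k\<in>K. s B k * v k)" .
  \<comment> \<open>With u = F 1, Cauchy-Schwarz gives \<Phi>^2 <= |B| |u|^2. Also |u|^2 is the
    inner product of s and v, whose square is at most \<Phi> |v|^2. Cancelling one \<Phi> leaves the
    cube.\<close>
  have "\<Phi>\<^sup>2 \<le> card B * (\<Sum>g\<in>B. (u g)\<^sup>2)"
    using Cauchy_Schwarz_ineq_sum[of "\<lambda>_. 1" u B] unfolding sum_u by simp
  then have "(\<Phi>\<^sup>2)\<^sup>2 \<le> (card B * (\<Sum>g\<in>B. (u g)\<^sup>2))\<^sup>2" by (intro power_mono) auto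
  also have "\<dots> = (card B)\<^sup>2 * (\<Sum>k\<in>K. s B k * v k)\<^sup>2" by (simp add: power_mult_distrib sum_u2)
  also have "\<dots> \<le> (card B)\<^sup>2 * (\<Phi> * (\<Sum>k\<in>K. (v k)\<^sup>2))"
    unfolding \<Phi>_def by (intro mult_left_mono Cauchy_Schwarz_ineq_sum) auto
  also have "\<dots> \<le> (card B)\<^sup>2 * (\<Phi> * (card T * X))"
    using v \<Phi>0 by (intro mult_left_mono) auto
  finally have "\<Phi> * \<Phi> ^ 3 \<le> \<Phi> * (card T * (card B)\<^sup>2 * X)"
    by (simp add: eval_nat_numeral mult_ac)
  then have "\<Phi> ^ 3 \<le> card T * (card B)\<^sup>2 * X"
  proof (cases "\<Phi> = 0")
    case True
    have "X \<ge> 0" unfolding X_def by (intro sum_nonneg) auto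
    then show ?thesis using True by simp
  qed (use \<Phi>0 in auto)
  then show ?thesis unfolding \<Phi>_def X_def .
qed

text \<open>The product f1 f2 f3 counts the level triples (t1, t2, t3) below the three values. Each
  level triple contributes at most U / (t1 t2 t3), and the sum splits into three harmonic
  sums.\<close>

lemma sum_product3_le_weak_bound:
  fixes f1 f2 f3 :: "'a \<Rightarrow> nat" and U :: real
  assumes "finite S" and n: "\<And>x. x \<in> S \<Longrightarrow> f1 x \<le> n" "\<And>x. x \<in> S \<Longrightarrow> f2 x \<le> n" "\<And>x. x \<in> S \<Longrightarrow> f3 x \<le> n"
    and U: "\<And>t1 t2 t3. \<lbrakk>1 \<le> t1; 1 \<le> t2; 1 \<le> t3\<rbrakk> \<Longrightarrow>
      real (card {x \<in> S. t1 \<le> f1 x \<and> t2 \<le> f2 x \<and> t3 \<le> f3 x}) * (real t1 * real t2 * real t3) \<le> U"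
  shows "(\<Sum>x\<in>S. real (f1 x * f2 x * f3 x)) \<le> U * harm n ^ 3"
proof -
  define R where "R = (\<lambda>(t1, t2, t3). {x \<in> S. t1 \<le> f1 x \<and> t2 \<le> f2 x \<and> t3 \<le> f3 x})"
  have finR: "finite (R t)" for t using assms(1) by (cases t) (simp add: R_def)
  have "(\<Sum>x\<in>S. f1 x * f2 x * f3 x) = card (SIGMA x:S. {1..f1 x} \<times> {1..f2 x} \<times> {1..f3 x})"
    using assms(1) by (simp add: card_cartesian_product mult.assoc)
  also have "\<dots> = card (SIGMA t:{1..n} \<times> {1..n} \<times> {1..n}. R t)"
    by (rule bij_betw_same_card[of prod.swap])
      (use n in \<open>fastforce simp: bij_betw_def inj_on_def image_iff R_def\<close>)
  also have "\<dots> = (\<Sum>t\<in>{1..n} \<times> {1..n} \<times> {1..n}. card (R t))" using finR by simp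
  finally have "(\<Sum>x\<in>S. real (f1 x * f2 x * f3 x)) = (\<Sum>t\<in>{1..n} \<times> {1..n} \<times> {1..n}. real (card (R t)))"
    by (metis of_nat_sum)
  also have "\<dots> \<le> (\<Sum>(t1, t2, t3)\<in>{1..n} \<times> {1..n} \<times> {1..n}.
      U * (inverse (real t1) * (inverse (real t2) * inverse (real t3))))"
  proof (rule sum_mono, clarify)
    fix t1 t2 t3 assume t: "t1 \<in> {1..n}" "t2 \<in> {1..n}" "t3 \<in> {1..n}"
    then show "real (card (R (t1, t2, t3)))
        \<le> U * (inverse (real t1) * (inverse (real t2) * inverse (real t3)))"
      using U[of t1 t2 t3] by (simp add: R_def field_simps)
  qed
  also have "\<dots> = U * harm n ^ 3"
    by (simp add: harm_def power3_eq_cube sum_distrib_left sum_distrib_right mult_ac flip: sum.cartesian_product)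
  finally show ?thesis .
qed

lemma shifts_pos_imp_difference:
  fixes W :: "'a::group_add set"
  assumes "1 \<le> shifts W W p"
  shows "p \<in> (\<lambda>(b, c). b - c) ` (W \<times> W)"
proof -
  have "{c \<in> W. p + c \<in> W} \<noteq> {}" using assms unfolding shifts_def by (metis card.empty not_one_le_zero)
  then obtain c where "c \<in> W" "p + c \<in> W" by blast
  then show ?thesis by (intro image_eqI[of _ _ "(p + c, c)"]) auto
qed

text \<open>The number of incidences of A x W with the lines of slope d and intercept in W; hence
  its level sets are within reach of Szemeredi-Trotter.\<close>

definition dilated_shifts :: "real set \<Rightarrow> real set \<Rightarrow> real \<Rightarrow> nat"
  where "dilated_shifts A W d = (\<Sum>a\<in>A. shifts W W (a * d))"

text \<open>The number of y with both y + a g and y + a g' in W is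
  \<open>shifts W W (a * (g - g'))\<close>, so the form is a Gram matrix indexed by pairs (a, y).
  The vectors \<open>f\<close> split F 1 into pieces, each belonging to one a and one g1; therefore
  two sides of every triple carry the same dilation and the third carries the sum over
  dilations.\<close>

lemma dilated_energy_power3_le:
  fixes A B W :: "real set"
  assumes fin: "finite A" "finite B" "finite W"
  shows "real (\<Sum>g\<in>B. \<Sum>g'\<in>B. dilated_shifts A W (g - g')) ^ 3
    \<le> real (card A) * card B ^ 3 * real (\<Sum>(a, g1, g2, g3)\<in>A \<times> B \<times> B \<times> B.
        shifts W W (a * (g1 - g2)) * shifts W W (a * (g1 - g3)) * dilated_shifts A W (g2 - g3))"
proof -
  \<comment> \<open>Every y for which some y + a g lies in W, so that a finite index set loses no
    solution.\<close>
  define Y where "Y = (\<lambda>(v, a, g). v - a * g) ` (W \<times> A \<times> B)"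
  define \<xi> :: "real \<times> real \<Rightarrow> real \<Rightarrow> real" where "\<xi> = (\<lambda>(a, y) g. of_bool (y + a * g \<in> W))"
  define f :: "real \<times> real \<Rightarrow> real \<Rightarrow> real" where "f = (\<lambda>(a, g1) g. real (shifts W W (a * (g1 - g))))"
  let ?F = "dilated_shifts A W"
  have finY: "finite Y" using fin by (simp add: Y_def)
  have gram: "(\<Sum>k\<in>A \<times> Y. \<xi> k g * \<xi> k g') = real (?F (g - g'))" if "g \<in> B" "g' \<in> B" for g g'
  proof -
    have "(\<Sum>y\<in>Y. \<xi> (a, y) g * \<xi> (a, y) g') = real (shifts W W (a * (g - g')))" if "a \<in> A" for a
    proof -
      have "(\<Sum>y\<in>Y. \<xi> (a, y) g * \<xi> (a, y) g') = (\<Sum>y\<in>Y. if y + a * g \<in> W \<and> y + a * g' \<in> W then 1 else 0)"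
        unfolding \<xi>_def by (intro sum.cong) auto
      also have "\<dots> = real (card {y \<in> Y. y + a * g \<in> W \<and> y + a * g' \<in> W})"
        using finY by (simp add: sum.If_cases Int_def)
      also have "card {y \<in> Y. y + a * g \<in> W \<and> y + a * g' \<in> W} = card {c \<in> W. a * (g - g') + c \<in> W}"
      proof (rule bij_betw_same_card[of "\<lambda>y. y + a * g'"], rule bij_betw_byWitness[of _ "\<lambda>v. v - a * g'"])
        show "(\<lambda>v. v - a * g') ` {c \<in> W. a * (g - g') + c \<in> W} \<subseteq> {y \<in> Y. y + a * g \<in> W \<and> y + a * g' \<in> W}"
        proof clarsimp
          fix c assume c: "c \<in> W" "a * (g - g') + c \<in> W"
          have "c - a * g' \<in> Y" unfolding Y_def using c \<open>a \<in> A\<close> \<open>g' \<in> B\<close>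
            by (intro image_eqI[of _ _ "(c, a, g')"]) auto
          moreover have "c - a * g' + a * g = a * (g - g') + c" by (simp add: algebra_simps)
          ultimately show "c - a * g' \<in> Y \<and> c - a * g' + a * g \<in> W" using c by metis
        qed
      qed (auto simp: algebra_simps)
      finally show ?thesis by (simp add: shifts_def)
    qed
    then have "(\<Sum>a\<in>A. \<Sum>y\<in>Y. \<xi> (a, y) g * \<xi> (a, y) g') = real (?F (g - g'))"
      by (simp add: dilated_shifts_def)
    then show ?thesis by (simp add: sum.cartesian_product case_prod_unfold)
  qed
  have sq: "(\<Sum>k\<in>A \<times> Y. (\<Sum>g\<in>B. \<xi> k g * w g)\<^sup>2) = (\<Sum>g\<in>B. \<Sum>g'\<in>B. w g * w g' * real (?F (g - g')))" for w
  proof -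
    have "(\<Sum>k\<in>A \<times> Y. (\<Sum>g\<in>B. \<xi> k g * w g)\<^sup>2)
        = (\<Sum>k\<in>A \<times> Y. \<Sum>g\<in>B. \<Sum>g'\<in>B. w g * w g' * (\<xi> k g * \<xi> k g'))"
      by (simp add: power2_eq_square sum_product mult_ac)
    also have "\<dots> = (\<Sum>g\<in>B. \<Sum>k\<in>A \<times> Y. \<Sum>g'\<in>B. w g * w g' * (\<xi> k g * \<xi> k g'))" by (rule sum.swap)
    also have "\<dots> = (\<Sum>g\<in>B. \<Sum>g'\<in>B. \<Sum>k\<in>A \<times> Y. w g * w g' * (\<xi> k g * \<xi> k g'))"
      by (intro sum.cong refl sum.swap)
    also have "\<dots> = (\<Sum>g\<in>B. \<Sum>g'\<in>B. w g * w g' * real (?F (g - g')))"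
      using gram by (simp flip: sum_distrib_left)
    finally show ?thesis .
  qed
  have sym: "(\<Sum>\<tau>\<in>A \<times> B. f \<tau> g) = (\<Sum>k\<in>A \<times> Y. (\<Sum>g1\<in>B. \<xi> k g1) * \<xi> k g)" if "g \<in> B" for g
  proof -
    have "(\<Sum>\<tau>\<in>A \<times> B. f \<tau> g) = (\<Sum>a\<in>A. \<Sum>g1\<in>B. real (shifts W W (a * (g1 - g))))"
      by (simp add: f_def sum.cartesian_product case_prod_unfold)
    also have "\<dots> = (\<Sum>g1\<in>B. real (?F (g1 - g)))"
      by (subst sum.swap) (simp add: dilated_shifts_def)
    also have "\<dots> = (\<Sum>g1\<in>B. \<Sum>k\<in>A \<times> Y. \<xi> k g1 * \<xi> k g)" using gram that by simp
    also have "\<dots> = (\<Sum>k\<in>A \<times> Y. (\<Sum>g1\<in>B. \<xi> k g1) * \<xi> k g)"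
      by (subst sum.swap) (simp add: sum_distrib_right)
    finally show ?thesis .
  qed
  have "(\<Sum>k\<in>A \<times> Y. (\<Sum>g\<in>B. \<xi> k g)\<^sup>2) ^ 3 \<le> card (A \<times> B) * (card B)\<^sup>2 *
      (\<Sum>\<tau>\<in>A \<times> B. \<Sum>k\<in>A \<times> Y. (\<Sum>g\<in>B. \<xi> k g * f \<tau> g)\<^sup>2)"
    by (rule gram_form_power3_le) (use fin finY sym in auto)
  moreover have "(\<Sum>k\<in>A \<times> Y. (\<Sum>g\<in>B. \<xi> k g)\<^sup>2) = real (\<Sum>g\<in>B. \<Sum>g'\<in>B. ?F (g - g'))"
    using sq[of "\<lambda>_. 1"] by simp
  moreover have "(\<Sum>\<tau>\<in>A \<times> B. \<Sum>k\<in>A \<times> Y. (\<Sum>g\<in>B. \<xi> k g * f \<tau> g)\<^sup>2)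
      = real (\<Sum>(a, g1, g2, g3)\<in>A \<times> B \<times> B \<times> B.
        shifts W W (a * (g1 - g2)) * shifts W W (a * (g1 - g3)) * ?F (g2 - g3))"
    unfolding sq by (simp add: f_def sum.cartesian_product')
  moreover have "real (card (A \<times> B)) * (real (card B))\<^sup>2 = real (card A) * card B ^ 3"
    by (simp add: card_cartesian_product power2_eq_square power3_eq_cube)
  ultimately show ?thesis by simp
qed


text \<open>For fixed levels the scheme is that of \<open>additive_growth\<close>. A quadruple is
  recorded by (a, d1, d2) with d1 = g1 - g2 and d2 = g1 - g3; coincidences are common translations,
  counted by |A| \<open>E3\<close>; and a d2 = (d2 - d1) a + a d1 is an incidence of slope g2 - g3.
  Excluding g2 = g3 keeps this slope nonzero.\<close>

lemma dilated_off_diagonal_le: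
  fixes A B W :: "real set" and Zp Zd :: real
  defines "r \<equiv> shifts W W" and "F \<equiv> dilated_shifts A W"
  defines "DB \<equiv> (\<lambda>(b, c). b - c) ` (B \<times> B)" and "DW \<equiv> (\<lambda>(b, c). b - c) ` (W \<times> W)"
  defines "E3 \<equiv> (\<Sum>d\<in>DB. real (shifts B B d ^ 3))"
  assumes fin: "finite A" "finite B" "finite W" and A: "0 \<notin> A"
    and Zp: "\<And>t. 1 \<le> t \<Longrightarrow> real t ^ 3 * card {p \<in> DW. t \<le> r p} \<le> Zp"
    and Zd: "\<And>t. 1 \<le> t \<Longrightarrow> real t ^ 3 * card {d \<in> DB - {0}. t \<le> F d} \<le> Zd"
    and n: "\<And>p. r p \<le> n" "\<And>d. F d \<le> n"
  shows "real (\<Sum>(a, g1, g2, g3)\<in>{(a, g1, g2, g3) \<in> A \<times> B \<times> B \<times> B. g2 \<noteq> g3}.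
        r (a * (g1 - g2)) * r (a * (g1 - g3)) * F (g2 - g3)) ^ 6
    \<le> 1728 * real (card A) ^ 5 * E3 ^ 3 * Zp ^ 4 * Zd ^ 2 * harm n ^ 18"
proof -
  define N where "N = real (card A)"
  define Q where "Q = {(a, g1, g2, g3) \<in> A \<times> B \<times> B \<times> B. g2 \<noteq> g3}"
  define f1 f2 f3 where "f1 = (\<lambda>(a, g1, g2, g3 :: real). r (a * (g1 - g2)))"
    and "f2 = (\<lambda>(a, g1, g2 :: real, g3). r (a * (g1 - g3)))"
    and "f3 = (\<lambda>(a :: real, g1 :: real, g2, g3). F (g2 - g3))"
  have finQ: "finite Q" by (rule finite_subset[of _ "A \<times> B \<times> B \<times> B"]) (use fin in \<open>auto simp: Q_def\<close>)
  have finD: "finite DB" "finite DW" using fin by (simp_all add: DB_def DW_def)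
  have finsh: "finite {c \<in> B. d + c \<in> B}" for d using fin by auto
  have Z0: "0 \<le> Zp" "0 \<le> Zd"
    using Zp[of 1] Zd[of 1] by (auto intro: order_trans[rotated])
  have E30: "0 \<le> E3" unfolding E3_def by (intro sum_nonneg) auto
  \<comment> \<open>The sixth power combines the square of Cauchy-Schwarz with the cube of
    Szemeredi-Trotter. Each t^6 is then the square of the t^3 in a weak third-moment bound.\<close>
  define Y where "Y = 1728 * N ^ 5 * E3 ^ 3 * Zp ^ 4 * Zd ^ 2"
  have Y0: "Y \<ge> 0" using Z0 E30 by (simp add: Y_def N_def)
  have level: "real (card {x \<in> Q. t1 \<le> f1 x \<and> t2 \<le> f2 x \<and> t3 \<le> f3 x}) * (real t1 * real t2 * real t3) \<le> root 6 Y"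
    if t: "1 \<le> t1" "1 \<le> t2" "1 \<le> t3" for t1 t2 t3
  proof -
    define S where "S = {x \<in> Q. t1 \<le> f1 x \<and> t2 \<le> f2 x \<and> t3 \<le> f3 x}"
    define P1 P2 D where "P1 = {p \<in> DW. t1 \<le> r p}" and "P2 = {p \<in> DW. t2 \<le> r p}"
      and "D = {d \<in> DB - {0}. t3 \<le> F d}"
    have finP: "finite P1" "finite P2" "finite D" using finD by (simp_all add: P1_def P2_def D_def)
    have finS: "finite S" using finQ by (simp add: S_def)
    define \<phi> where "\<phi> = (\<lambda>(a :: real, g1, g2, g3). (a, g1 - g2, g1 - g3 :: real))"
    define k where "k = real (card (\<phi> ` S))"
    have S_mem: "a \<in> A" "g1 \<in> B" "g2 \<in> B" "g3 \<in> B" "g2 \<noteq> g3" "t1 \<le> r (a * (g1 - g2))"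
      "t2 \<le> r (a * (g1 - g3))" "t3 \<le> F (g2 - g3)" if "(a, g1, g2, g3) \<in> S" for a g1 g2 g3
      using that by (auto simp: S_def Q_def f1_def f2_def f3_def)
    have "card (coll \<phi> S) \<le> card A * (\<Sum>d\<in>DB. shifts B B d ^ 3)"
    proof -
      let ?K = "A \<times> (SIGMA d:DB. {c \<in> B. d + c \<in> B} \<times> {c \<in> B. d + c \<in> B} \<times> {c \<in> B. d + c \<in> B})"
      have "card (coll \<phi> S) \<le> card ?K"
      proof (rule card_inj_on_le[of "\<lambda>((a, g1, g2, g3), (a', h1, h2, h3)). (a, g1 - h1, h1, h2, h3)"])
        show "inj_on (\<lambda>((a, g1, g2, g3), (a', h1, h2, h3)). (a, g1 - h1, h1, h2, h3)) (coll \<phi> S)"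
          by (auto simp: inj_on_def \<phi>_def)
        show "(\<lambda>((a, g1, g2, g3), (a', h1, h2, h3)). (a, g1 - h1, h1, h2, h3)) ` coll \<phi> S \<subseteq> ?K"
        proof clarsimp
          fix a g1 g2 g3 a' h1 h2 h3
          assume *: "(a, g1, g2, g3) \<in> S" "(a', h1, h2, h3) \<in> S" "\<phi> (a, g1, g2, g3) = \<phi> (a', h1, h2, h3)"
          then have "g1 - h1 + h2 = g2" "g1 - h1 + h3 = g3" by (auto simp: \<phi>_def)
          then show "a \<in> A \<and> g1 - h1 \<in> DB \<and> h1 \<in> B \<and> g1 \<in> B \<and> h2 \<in> B \<and> g1 - h1 + h2 \<in> B \<and> h3 \<in> B \<and> g1 - h1 + h3 \<in> B"
            using S_mem[OF *(1)] S_mem[OF *(2)] by (force simp: DB_def)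
        qed
        show "finite ?K" using fin finD finsh by (intro finite_SigmaI finite_cartesian_product) auto
      qed
      also have "card ?K = card A * (\<Sum>d\<in>DB. shifts B B d ^ 3)"
        using finD finsh by (simp add: card_cartesian_product power3_eq_cube mult.assoc flip: shifts_def)
      finally show ?thesis .
    qed
    then have coll_le: "real (card (coll \<phi> S)) \<le> N * E3"
      unfolding N_def E3_def of_nat_sum[symmetric] of_nat_mult[symmetric] of_nat_le_iff .
    have "card (\<phi> ` S) \<le> card {(x, y, d, c). x \<in> A \<and> y \<in> P2 \<and> d \<in> D \<and> c \<in> P1 \<and> y = d * x + c}" (is "_ \<le> card ?T")
    proof (rule card_inj_on_le[of "\<lambda>(a, d1, d2). (a, a * d2, d2 - d1, a * d1)"])
      show "inj_on (\<lambda>(a, d1, d2). (a, a * d2, d2 - d1, a * d1)) (\<phi> ` S)"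
      proof (rule inj_onI)
        fix q q' assume q: "q \<in> \<phi> ` S" "q' \<in> \<phi> ` S"
          and e: "(\<lambda>(a, d1, d2). (a, a * d2, d2 - d1, a * d1)) q = (\<lambda>(a, d1, d2). (a, a * d2, d2 - d1, a * d1)) q'"
        have "fst q \<in> A" using q(1) S_mem(1) by (auto simp: \<phi>_def)
        then have "fst q \<noteq> 0" using A by metis
        then show "q = q'" using e by (cases q; cases q') auto
      qed
      show "(\<lambda>(a, d1, d2). (a, a * d2, d2 - d1, a * d1)) ` \<phi> ` S \<subseteq> ?T"
      proof (clarsimp simp: \<phi>_def)
        fix a g1 g2 g3 assume s: "(a, g1, g2, g3) \<in> S"
        note m = S_mem[OF s]
        have "a * (g1 - g2) \<in> P1" "a * (g1 - g3) \<in> P2"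
          using m t shifts_pos_imp_difference[of W] unfolding P1_def P2_def DW_def r_def by fastforce+
        moreover have "g2 - g3 \<in> D" using m by (auto simp: D_def DB_def)
        ultimately show "a \<in> A \<and> a * (g1 - g3) \<in> P2 \<and> g2 - g3 \<in> D \<and> a * (g1 - g2) \<in> P1 \<and>
            a * (g1 - g3) = (g2 - g3) * a + a * (g1 - g2)" using m(1) by (auto simp: algebra_simps)
      qed
      show "finite ?T" by (rule finite_subset[of _ "A \<times> P2 \<times> D \<times> P1"]) (use fin finP in auto)
    qed
    then have "card (\<phi> ` S) ^ 3 \<le> card ?T ^ 3" by (rule power_mono) simp
    also have "\<dots> \<le> 1728 * (card A * card P2 * card D * card P1)\<^sup>2"
      by (rule szemeredi_trotter_cartesian) (use fin finP A in \<open>auto simp: D_def\<close>)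
    finally have "real (card (\<phi> ` S) ^ 3) \<le> real (1728 * (card A * card P2 * card D * card P1)\<^sup>2)"
      unfolding of_nat_le_iff .
    then have k3: "k ^ 3 \<le> 1728 * (N * card P2 * card D * card P1)\<^sup>2" by (simp add: k_def N_def)
    define c where "c = real (card S)"
    have "c\<^sup>2 = real ((card S)\<^sup>2)" by (simp add: c_def)
    also have "\<dots> \<le> real (card (\<phi> ` S) * card (coll \<phi> S))"
      unfolding of_nat_le_iff by (rule card_power2_le_collisions[OF finS])
    also have "\<dots> \<le> k * (N * E3)" unfolding of_nat_mult k_def using coll_le by (intro mult_left_mono) auto
    finally have "(c\<^sup>2) ^ 3 \<le> (k * (N * E3)) ^ 3" by (intro power_mono) auto
    also have "\<dots> = k ^ 3 * (N * E3) ^ 3" by (simp add: power_mult_distrib)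
    also have "\<dots> \<le> (1728 * (N * card P2 * card D * card P1)\<^sup>2) * (N * E3) ^ 3"
      using k3 E30 by (intro mult_right_mono) (auto simp: N_def)
    finally have "(c\<^sup>2) ^ 3 * (real t1 * real t2 * real t3) ^ 6
        \<le> (1728 * (N * card P2 * card D * card P1)\<^sup>2) * (N * E3) ^ 3 * (real t1 * real t2 * real t3) ^ 6"
      by (intro mult_right_mono) auto
    also have "\<dots> = 1728 * N ^ 5 * E3 ^ 3 * ((real t1 ^ 3 * card P1)\<^sup>2 * (real t2 ^ 3 * card P2)\<^sup>2) * (real t3 ^ 3 * card D)\<^sup>2"
      by (simp add: power_mult_distrib eval_nat_numeral mult_ac)
    also have "\<dots> \<le> 1728 * N ^ 5 * E3 ^ 3 * (Zp\<^sup>2 * Zp\<^sup>2) * Zd\<^sup>2"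
      by (intro mult_mono mult_nonneg_nonneg power_mono zero_le_power order_refl Zp[OF t(1), folded P1_def]
          Zp[OF t(2), folded P2_def] Zd[OF t(3), folded D_def]) (use E30 Z0 in \<open>auto simp: N_def\<close>)
    finally have "(c * (real t1 * real t2 * real t3)) ^ 6 \<le> Y"
      unfolding Y_def by (simp add: power_mult_distrib mult.assoc flip: power_mult power_add)
    then have "root 6 ((c * (real t1 * real t2 * real t3)) ^ 6) \<le> root 6 Y" by (intro real_root_le_mono) auto
    then show ?thesis unfolding S_def[symmetric] c_def[symmetric]
      by (subst (asm) real_root_power_cancel) (auto simp: c_def)
  qed
  have "(\<Sum>x\<in>Q. real (f1 x * f2 x * f3 x)) \<le> root 6 Y * harm n ^ 3"
    by (rule sum_product3_le_weak_bound[OF finQ _ _ _ level]) (use n in \<open>auto simp: f1_def f2_def f3_def\<close>)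
  moreover have "(\<Sum>x\<in>Q. real (f1 x * f2 x * f3 x)) \<ge> 0" by (intro sum_nonneg) auto
  ultimately have "(\<Sum>x\<in>Q. real (f1 x * f2 x * f3 x)) ^ 6 \<le> (root 6 Y * harm n ^ 3) ^ 6"
    by (intro power_mono)
  also have "\<dots> = Y * harm n ^ 18" using Y0 by (simp add: power_mult_distrib real_root_pow_pos2 flip: power_mult)
  also have "(\<Sum>x\<in>Q. real (f1 x * f2 x * f3 x))
      = real (\<Sum>(a, g1, g2, g3)\<in>Q. r (a * (g1 - g2)) * r (a * (g1 - g3)) * F (g2 - g3))"
    unfolding f1_def f2_def f3_def of_nat_sum by (intro sum.cong) auto
  finally show ?thesis unfolding Y_def Q_def N_def .
qed

text \<open>Writing r^2 as r^(1/2) r^(3/2), Cauchy-Schwarz bounds the second moment by the first,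
  which is the form itself, and the third. For fixed a and g the map g' -> a (g - g') is injective,
  so the third moment is at most |A||B| times that of W.\<close>

lemma dilated_diagonal_le:
  fixes A B W :: "real set"
  defines "r \<equiv> shifts W W" and "DW \<equiv> (\<lambda>(b, c). b - c) ` (W \<times> W)"
  assumes fin: "finite A" "finite B" "finite W" and A: "0 \<notin> A"
  shows "(\<Sum>(a, g1, g2)\<in>A \<times> B \<times> B. (real (r (a * (g1 - g2))))\<^sup>2)\<^sup>2
    \<le> real (\<Sum>g\<in>B. \<Sum>g'\<in>B. dilated_shifts A W (g - g'))
      * (real (card A) * card B * (\<Sum>p\<in>DW. real (r p ^ 3)))"
proof -
  let ?R = "\<lambda>(a, g1, g2). real (r (a * (g1 - g2)))" and ?T = "A \<times> B \<times> B"
  have finD: "finite DW" using fin by (simp add: DW_def)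
  have "sqrt (real m) * sqrt (real m ^ 3) = (real m)\<^sup>2" for m :: nat
  proof -
    have "sqrt (real m) * sqrt (real m ^ 3) = sqrt (((real m)\<^sup>2)\<^sup>2)"
      unfolding real_sqrt_mult[symmetric]
      by (rule arg_cong[of _ _ sqrt]) (simp add: power2_eq_square power3_eq_cube)
    also have "\<dots> = (real m)\<^sup>2" unfolding real_sqrt_abs by simp
    finally show ?thesis .
  qed
  then have "(\<Sum>x\<in>?T. (?R x)\<^sup>2)\<^sup>2 = (\<Sum>x\<in>?T. sqrt (?R x) * sqrt (?R x ^ 3))\<^sup>2"
    by (simp add: case_prod_unfold)
  also have "\<dots> \<le> (\<Sum>x\<in>?T. (sqrt (?R x))\<^sup>2) * (\<Sum>x\<in>?T. (sqrt (?R x ^ 3))\<^sup>2)"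
    by (rule Cauchy_Schwarz_ineq_sum)
  also have "\<dots> = (\<Sum>x\<in>?T. ?R x) * (\<Sum>x\<in>?T. ?R x ^ 3)" by (simp add: case_prod_unfold)
  also have "(\<Sum>x\<in>?T. ?R x) = real (\<Sum>g\<in>B. \<Sum>g'\<in>B. dilated_shifts A W (g - g'))"
  proof -
    have "(\<Sum>x\<in>?T. ?R x) = (\<Sum>a\<in>A. \<Sum>g\<in>B. \<Sum>g'\<in>B. real (r (a * (g - g'))))"
      unfolding sum.cartesian_product' by simp
    also have "\<dots> = (\<Sum>g\<in>B. \<Sum>a\<in>A. \<Sum>g'\<in>B. real (r (a * (g - g'))))" by (rule sum.swap)
    also have "\<dots> = (\<Sum>g\<in>B. \<Sum>g'\<in>B. \<Sum>a\<in>A. real (r (a * (g - g'))))"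
      by (intro sum.cong refl sum.swap)
    finally show ?thesis by (simp add: dilated_shifts_def r_def)
  qed
  finally have "(\<Sum>x\<in>?T. (?R x)\<^sup>2)\<^sup>2
      \<le> real (\<Sum>g\<in>B. \<Sum>g'\<in>B. dilated_shifts A W (g - g')) * (\<Sum>x\<in>?T. ?R x ^ 3)" .
  also have "\<dots> \<le> real (\<Sum>g\<in>B. \<Sum>g'\<in>B. dilated_shifts A W (g - g'))
      * (real (card A) * card B * (\<Sum>p\<in>DW. real (r p ^ 3)))"
  proof (rule mult_left_mono)
    have inner: "(\<Sum>g'\<in>B. real (r (a * (g - g'))) ^ 3) \<le> (\<Sum>p\<in>DW. real (r p ^ 3))" if "a \<in> A" for a g
    proof -
      have "a \<noteq> 0" using that A by auto
      have "(\<Sum>g'\<in>B. real (r (a * (g - g'))) ^ 3) = (\<Sum>g'\<in>{g' \<in> B. r (a * (g - g')) \<noteq> 0}. real (r (a * (g - g'))) ^ 3)"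
        using fin by (intro sum.mono_neutral_right) auto
      also have "\<dots> = (\<Sum>p\<in>(\<lambda>g'. a * (g - g')) ` {g' \<in> B. r (a * (g - g')) \<noteq> 0}. real (r p ^ 3))"
        using \<open>a \<noteq> 0\<close> by (subst sum.reindex) (auto simp: inj_on_def)
      also have "\<dots> \<le> (\<Sum>p\<in>DW. real (r p ^ 3))"
        using shifts_pos_imp_difference[of W] unfolding DW_def r_def
        by (intro sum_mono2) (use finD in \<open>auto simp: DW_def Suc_le_eq\<close>)
      finally show ?thesis .
    qed
    have "(\<Sum>x\<in>?T. ?R x ^ 3) = (\<Sum>a\<in>A. \<Sum>g\<in>B. \<Sum>g'\<in>B. real (r (a * (g - g'))) ^ 3)"
      unfolding sum.cartesian_product' by simp
    also have "\<dots> \<le> (\<Sum>a\<in>A. \<Sum>g\<in>B. \<Sum>p\<in>DW. real (r p ^ 3))"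
      by (intro sum_mono inner)
    finally show "(\<Sum>x\<in>?T. ?R x ^ 3) \<le> real (card A) * card B * (\<Sum>p\<in>DW. real (r p ^ 3))" by simp
  qed (rule of_nat_0_le_iff)
  finally show ?thesis by (simp add: case_prod_unfold)
qed


section \<open>Popular products and the energy bound for dilated sums and differences\<close>

lemma popular_products:
  fixes A :: "real set"
  assumes "finite A" "A \<noteq> {}" "0 \<notin> A"
  obtains W \<rho> where "finite W" "W \<noteq> {}" "0 \<notin> W" "1 \<le> \<rho>"
    "\<And>w. w \<in> W \<Longrightarrow> \<rho> \<le> card {(x, d). x \<in> A \<and> d \<in> A \<and> w = d * x}"
    "real (mult_energy A) \<le> 2 * ((real \<rho>)\<^sup>2 * card W) * harm (card A)"
    "\<rho> * card W \<le> (card A)\<^sup>2" "\<rho> * card W \<le> (\<Sum>g\<in>A. card {h \<in> A. g * h \<in> W})"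
proof -
  define S where "S = (\<lambda>(g, h). g * h) ` (A \<times> A)"
  define R where "R w = {(x, d). x \<in> A \<and> d \<in> A \<and> w = d * x}" for w
  have finS: "finite S" using assms by (simp add: S_def)
  have finR: "finite (R w)" for w
    by (rule finite_subset[of _ "A \<times> A"]) (use assms in \<open>auto simp: R_def\<close>)
  have A1: "1 \<le> card A" using assms by (simp add: Suc_leI card_gt_0_iff)
  have "{u \<in> A \<times> A. (\<lambda>(g, h). g * h) u = w} = R w" for w by (auto simp: R_def mult.commute)
  then have energy: "real (mult_energy A) = (\<Sum>w\<in>S. real (card (R w) ^ 2))"
    using card_matches_eq_sum_fibers[of "A \<times> A" "A \<times> A" S "\<lambda>(g, h). g * h" "\<lambda>(g, h). g * h"] assms finS
    unfolding mult_energy_def by (simp add: S_def power2_eq_square)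
  have Rle: "card (R w) \<le> card A" for w
    by (rule card_inj_on_le[of fst]) (use assms in \<open>auto simp: R_def inj_on_def\<close>)
  obtain t where t: "1 \<le> t" "t \<le> card A"
    "(\<Sum>w\<in>S. real (card (R w) ^ 2)) \<le> real 2 * (real t ^ 2 * card {w \<in> S. t \<le> card (R w)}) * harm (card A)"
    using ex_popular_level[where f = "\<lambda>w. card (R w)" and k = 2, OF finS Rle _ A1] by auto
  define W where "W = {w \<in> S. t \<le> card (R w)}"
  have finW: "finite W" using finS by (simp add: W_def)
  \<comment> \<open>Pairs (g, h) with popular product are counted twice: by the product, then by
    g.\<close>
  have "t * card W = (\<Sum>w\<in>W. t)" by simp
  also have "\<dots> \<le> (\<Sum>w\<in>W. card (R w))" by (intro sum_mono) (simp add: W_def)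
  also have "\<dots> = card (SIGMA w:W. R w)" using finW finR by simp
  also have "\<dots> = card (SIGMA g:A. {h \<in> A. g * h \<in> W})"
    by (rule bij_betw_same_card[of "\<lambda>(w, x, d). (d, x)"]) (auto simp: bij_betw_def inj_on_def R_def image_iff)
  finally have *: "t * card W \<le> card (SIGMA g:A. {h \<in> A. g * h \<in> W})" .
  have **: "card (SIGMA g:A. {h \<in> A. g * h \<in> W}) \<le> card (A \<times> A)"
    using assms by (intro card_mono) auto
  show thesis
  proof
    show "finite W" by (rule finW)
    obtain a where "a \<in> A" using assms by blast
    then have "((a, a), (a, a)) \<in> coll (\<lambda>(g, h). g * h) (A \<times> A)" by simp
    moreover have "finite (coll (\<lambda>(g, h). g * h) (A \<times> A))" using assms(1) by (intro finite_coll) simp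
    ultimately have "mult_energy A \<noteq> 0" unfolding mult_energy_def using card_0_eq by blast
    then have "card W \<noteq> 0" using t(3) unfolding energy[symmetric] W_def[symmetric] by (intro notI) simp
    then show "W \<noteq> {}" by auto
    show "0 \<notin> W" using assms(3) by (auto simp: W_def S_def)
    show "1 \<le> t" by (rule t)
    show "t \<le> card {(x, d). x \<in> A \<and> d \<in> A \<and> w = d * x}" if "w \<in> W" for w
      using that by (simp add: W_def R_def)
    show "real (mult_energy A) \<le> 2 * ((real t)\<^sup>2 * card W) * harm (card A)"
      using t(3) unfolding energy W_def by simp
    show "t * card W \<le> (card A)\<^sup>2" using * ** by (simp add: card_cartesian_product power2_eq_square)
    show "t * card W \<le> (\<Sum>g\<in>A. card {h \<in> A. g * h \<in> W})" using * assms by simp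
  qed
qed

text \<open>From g h = w follows g = h^(-1) w. So an element with many popular products has many
  representations itself, with factors from W and the inverses of A, and
  \<open>card_rich_shifts_le\<close> becomes applicable to sets of such elements.\<close>

lemma quotient_representations:
  fixes A W :: "real set"
  assumes "finite A" "0 \<notin> A" "g \<noteq> 0"
  shows "card {h \<in> A. g * h \<in> W} \<le> card {(x, d). x \<in> W \<and> d \<in> inverse ` A \<and> g = d * x}"
proof (rule card_inj_on_le[of "\<lambda>h. (g * h, inverse h)"])
  show "(\<lambda>h. (g * h, inverse h)) ` {h \<in> A. g * h \<in> W} \<subseteq> {(x, d). x \<in> W \<and> d \<in> inverse ` A \<and> g = d * x}"
  proof (rule image_subsetI)
    fix h assume h: "h \<in> {h \<in> A. g * h \<in> W}"
    then have "h \<noteq> 0" using assms by auto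
    then have "g = inverse h * (g * h)" by simp
    then show "(g * h, inverse h) \<in> {(x, d). x \<in> W \<and> d \<in> inverse ` A \<and> g = d * x}" using h by blast
  qed
  have "{(x, d). x \<in> W \<and> d \<in> inverse ` A \<and> g = d * x} \<subseteq> (\<lambda>d. (g / d, d)) ` inverse ` A"
    using assms by (auto simp: image_iff)
  then show "finite {(x, d). x \<in> W \<and> d \<in> inverse ` A \<and> g = d * x}"
    by (rule finite_subset) (use assms in simp)
qed (auto simp: inj_on_def)

text \<open>The twentieth power of \<rho> w <= t \<beta> H contains \<beta>^20 t^15, which
  \<open>main\<close> controls, and t^5 <= N^5. Cancelling w^10 leaves (\<rho>^2 w)^10, hence E^10.
  Up to constants and H the outcome is E <= N^(7/5) M.\<close>

lemma additive_growth_arith: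
  fixes N \<beta> w \<rho> t H M E K :: real
  assumes pos: "0 < N" "0 < \<beta>" "0 < w" "0 < \<rho>" "0 < t" "0 \<le> H" "0 < M" "0 \<le> E" "0 \<le> K"
    and "t \<le> N" and a: "\<rho> * w \<le> t * \<beta> * H" and e: "E \<le> 2 * (\<rho>\<^sup>2 * w) * H"
    and main: "\<beta> ^ 30 * N \<le> K * M ^ 10 * (1728 * (w * N * \<beta>)\<^sup>2 / t ^ 3) ^ 5 * H ^ 9"
  shows "E ^ 10 \<le> 1024 * K * 1728 ^ 5 * (N ^ 14 * M ^ 10 * H ^ 39)"
proof -
  define K' where "K' = K * 1728 ^ 5"
  have K': "0 \<le> K'" using pos by (simp add: K'_def)
  have "t ^ 15 * (\<beta> ^ 30 * N) \<le> t ^ 15 * (K * M ^ 10 * (1728 * (w * N * \<beta>)\<^sup>2 / t ^ 3) ^ 5 * H ^ 9)"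
    using main pos by (intro mult_left_mono) auto
  also have "(1728 * (w * N * \<beta>)\<^sup>2 / t ^ 3) ^ 5 = 1728 ^ 5 * (w * N * \<beta>) ^ 10 / t ^ 15"
    by (simp add: power_divide power_mult_distrib flip: power_mult)
  also have "t ^ 15 * (K * M ^ 10 * (1728 ^ 5 * (w * N * \<beta>) ^ 10 / t ^ 15) * H ^ 9)
      = \<beta> ^ 10 * N * (K' * M ^ 10 * w ^ 10 * N ^ 9 * H ^ 9)"
    using pos by (simp add: K'_def power_mult_distrib field_simps flip: power_Suc)
  also have "t ^ 15 * (\<beta> ^ 30 * N) = \<beta> ^ 10 * N * (\<beta> ^ 20 * t ^ 15)" by (simp flip: power_add)
  finally have b: "\<beta> ^ 20 * t ^ 15 \<le> K' * M ^ 10 * w ^ 10 * N ^ 9 * H ^ 9" using pos by simp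
  have "(\<rho> * w) ^ 20 \<le> (t * \<beta> * H) ^ 20" using a pos by (intro power_mono) auto
  also have "\<dots> = (\<beta> ^ 20 * t ^ 15) * t ^ 5 * H ^ 20" by (simp add: power_mult_distrib flip: power_add)
  also have "\<dots> \<le> (K' * M ^ 10 * w ^ 10 * N ^ 9 * H ^ 9) * N ^ 5 * H ^ 20"
    using pos K' by (intro mult_right_mono mult_mono[OF b power_mono[OF \<open>t \<le> N\<close>]]) simp_all
  also have "\<dots> = w ^ 10 * (K' * M ^ 10 * (N ^ 9 * N ^ 5) * (H ^ 9 * H ^ 20))" by (simp only: mult_ac)
  also have "\<dots> = w ^ 10 * (K' * M ^ 10 * N ^ 14 * H ^ 29)" by (simp flip: power_add)
  also have "(\<rho> * w) ^ 20 = w ^ 10 * (\<rho>\<^sup>2 * w) ^ 10"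
    by (simp add: power_mult_distrib mult.left_commute flip: power_add power_mult)
  finally have "w ^ 10 * (\<rho>\<^sup>2 * w) ^ 10 \<le> w ^ 10 * (K' * M ^ 10 * N ^ 14 * H ^ 29)" .
  then have c: "(\<rho>\<^sup>2 * w) ^ 10 \<le> K' * M ^ 10 * N ^ 14 * H ^ 29" using pos by simp
  have "E ^ 10 \<le> (2 * (\<rho>\<^sup>2 * w) * H) ^ 10" using e pos by (intro power_mono) auto
  also have "\<dots> = 1024 * (\<rho>\<^sup>2 * w) ^ 10 * H ^ 10" by (simp add: power_mult_distrib)
  also have "\<dots> \<le> 1024 * (K' * M ^ 10 * N ^ 14 * H ^ 29) * H ^ 10"
    using c pos by (intro mult_right_mono mult_left_mono) auto
  also have "\<dots> = 1024 * K * 1728 ^ 5 * (N ^ 14 * M ^ 10 * (H ^ 29 * H ^ 10))"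
    unfolding K'_def by (simp only: mult_ac)
  also have "H ^ 29 * H ^ 10 = H ^ 39" by (simp flip: power_add)
  finally show ?thesis .
qed

lemma shifts_scale_sign:
  fixes B :: "real set"
  assumes "finite B" "\<tau> = 1 \<or> \<tau> = -1"
  shows "shifts ((*) \<tau> ` B) ((*) \<tau> ` B) d = shifts B B d"
proof (cases "\<tau> = 1")
  case False
  then have \<tau>: "\<tau> = -1" using assms by simp
  have mem: "x \<in> (*) \<tau> ` B \<longleftrightarrow> - x \<in> B" for x
    unfolding \<tau> by (auto intro: image_eqI[of _ _ "- x"])
  \<comment> \<open>The reflection c -> -c - d exchanges the two membership conditions.\<close>
  have "bij_betw (\<lambda>c. - c - d) {c. - c \<in> B \<and> - (d + c) \<in> B} {c \<in> B. d + c \<in> B}"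
    by (rule bij_betw_byWitness[where f' = "\<lambda>c. - c - d"]) (auto simp: algebra_simps)
  then have "bij_betw (\<lambda>c. - c - d) {c \<in> (*) \<tau> ` B. d + c \<in> (*) \<tau> ` B} {c \<in> B. d + c \<in> B}"
    by (simp only: mem)
  then show ?thesis unfolding shifts_def by (rule bij_betw_same_card)
qed simp

text \<open>\<open>\<tau>\<close> = 1 serves differences; \<open>\<tau>\<close> = -1 serves sums,
  with -(a + b) read as the difference of -a and b.\<close>

lemma energy_le_of_dilated_sumset:
  fixes A S' :: "real set"
  assumes fin: "finite A" "finite S'" and A: "A \<noteq> {}" "0 \<notin> A" and \<tau>: "\<tau> = 1 \<or> \<tau> = -1"
    and S': "\<And>u a b. \<lbrakk>u \<in> A; a \<in> A; b \<in> A\<rbrakk> \<Longrightarrow> u * (\<tau> * a - b) \<in> S'" "card A \<le> card S'"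
  shows "real (mult_energy A) ^ 10
    \<le> 1024 * 11950848 * 1728 ^ 5 * (real (card A) ^ 14 * real (card S') ^ 10 * harm (card A) ^ 39)"
proof -
  obtain W \<rho> where W: "finite W" "W \<noteq> {}" "0 \<notin> W" "1 \<le> \<rho>"
    "\<And>w. w \<in> W \<Longrightarrow> \<rho> \<le> card {(x, d). x \<in> A \<and> d \<in> A \<and> w = d * x}"
    "real (mult_energy A) \<le> 2 * ((real \<rho>)\<^sup>2 * card W) * harm (card A)"
    "\<rho> * card W \<le> (card A)\<^sup>2" "\<rho> * card W \<le> (\<Sum>g\<in>A. card {h \<in> A. g * h \<in> W})"
    by (rule popular_products[OF fin(1) A]) (rule that, assumption+)
  define f where "f g = card {h \<in> A. g * h \<in> W}" for g
  have fle: "f g \<le> card A" for g unfolding f_def using fin by (intro card_mono) auto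
  have A1: "1 \<le> card A" using fin A by (simp add: Suc_leI card_gt_0_iff)
  \<comment> \<open>A best level instead of the average: at the cost of a harmonic number, t |B| is
    as large as the number of popular pairs.\<close>
  obtain t where t: "1 \<le> t" "t \<le> card A"
    "(\<Sum>g\<in>A. real (f g ^ 1)) \<le> real 1 * (real t ^ 1 * card {g \<in> A. t \<le> f g}) * harm (card A)"
    using ex_popular_level[where f = f and k = 1, OF fin(1) fle _ A1] by auto
  define B where "B = {g \<in> A. t \<le> f g}"
  have finB: "finite B" and BA: "B \<subseteq> A" using fin by (auto simp: B_def)
  have w0: "card W > 0" using W(1,2) by (simp add: card_gt_0_iff)
  have \<Gamma>: "real \<rho> * real (card W) \<le> real t * real (card B) * harm (card A)"
  proof -
    have "real (\<rho> * card W) \<le> real (\<Sum>g\<in>A. f g)" using W(8) unfolding f_def of_nat_le_iff .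
    then show ?thesis using t(3) by (simp add: B_def)
  qed
  have "B \<noteq> {}"
  proof
    assume "B = {}"
    then have "real \<rho> * card W \<le> 0" using \<Gamma> by simp
    then show False using W(4) w0 by (simp add: mult_le_0_iff)
  qed
  then have b0: "card B > 0" using finB by (simp add: card_gt_0_iff)
  have inv: "card (inverse ` A) = card A" by (simp add: card_image inj_on_def)
  \<comment> \<open>The bound of \<open>card_rich_shifts_le\<close> with B as the structured set:
    its elements have t representations as products from W and the inverses of A.\<close>
  define Z where "Z = 1728 * (real (card W) * card A * card B)\<^sup>2 / real t ^ 3"
  have Z: "real s ^ 3 * card {d \<in> (\<lambda>(b, c). b - c) ` (B \<times> B). s \<le> shifts B B d} \<le> Z" for s
  proof -
    have "real (card {d \<in> (\<lambda>(b, c). b - c) ` (B \<times> B). s \<le> shifts B B d}) * real s ^ 3 * real t ^ 3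
        \<le> 1728 * (real (card W) * card (inverse ` A) * card B)\<^sup>2"
    proof (rule card_rich_shifts_le[OF _ _ finB])
      show "finite W" "0 \<notin> W" by (rule W)+
      show "finite (inverse ` A)" "0 \<notin> inverse ` A" using fin A by auto
      show "real t \<le> card {(x, d). x \<in> W \<and> d \<in> inverse ` A \<and> g = d * x}" if g: "g \<in> B" for g
      proof -
        have "t \<le> f g" "g \<noteq> 0" using g A(2) by (auto simp: B_def)
        then show ?thesis using quotient_representations[OF fin(1) A(2), of g W] unfolding f_def by simp
      qed
    qed (use finB in auto)
    then show ?thesis using t(1) unfolding Z_def inv by (simp add: pos_le_divide_eq mult_ac)
  qed
  have "real (card B) ^ 30 * card A \<le> 11950848 * real (card S') ^ 10 * Z ^ 5 * harm (card B) ^ 9"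
  proof (rule additive_growth[OF fin(1) finB _ fin(2) A(2,1)])
    show "finite ((*) \<tau> ` B)" using finB by simp
    show "card ((*) \<tau> ` B) = card B" using \<tau> by (intro card_image) (auto simp: inj_on_def)
    show "shifts ((*) \<tau> ` B) ((*) \<tau> ` B) d = shifts B B d" for d
      by (rule shifts_scale_sign[OF finB \<tau>])
    show "u * (a - b) \<in> S'" if uab: "u \<in> A" "a \<in> (*) \<tau> ` B" "b \<in> B" for u a b
    proof -
      obtain x where "a = \<tau> * x" "x \<in> B" using uab(2) by blast
      then show ?thesis using S'(1)[of u x b] uab BA by blast
    qed
  qed (use \<open>B \<noteq> {}\<close> S'(2) Z in auto)
  also have "\<dots> \<le> 11950848 * real (card S') ^ 10 * Z ^ 5 * harm (card A) ^ 9"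
    by (intro mult_left_mono power_mono harm_mono card_mono fin BA) (simp_all add: harm_nonneg Z_def)
  finally have main: "real (card B) ^ 30 * card A
      \<le> 11950848 * real (card S') ^ 10 * Z ^ 5 * harm (card A) ^ 9" .
  have pos: "0 < real (card A)" "0 < real (card B)" "0 < real (card W)" "0 < real \<rho>" "0 < real t"
    "0 < real (card S')" "real t \<le> real (card A)"
    using A1 b0 w0 W(4) t S'(2) by auto
  show ?thesis
    by (rule additive_growth_arith[OF pos(1-5) _ pos(6) _ _ pos(7) \<Gamma> W(6) main[unfolded Z_def]])
      (simp_all add: harm_nonneg)
qed


section \<open>Growth of shifted products\<close>

lemma card_rich_dilations_le:
  fixes A W D :: "real set"
  assumes fin: "finite A" "finite W" "finite D" and nz: "0 \<notin> A" "0 \<notin> D"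
    and t: "\<And>d. d \<in> D \<Longrightarrow> t \<le> dilated_shifts A W d"
  shows "real t ^ 3 * card D \<le> 1728 * (real (card A) * card W * card W)\<^sup>2"
proof -
  define T where "T = {(x, y, d, c). x \<in> A \<and> y \<in> W \<and> d \<in> D \<and> c \<in> W \<and> y = d * x + c}"
  have finT: "finite T"
    by (rule finite_subset[of _ "A \<times> W \<times> D \<times> W"]) (use fin in \<open>auto simp: T_def\<close>)
  have "t * card D \<le> (\<Sum>d\<in>D. dilated_shifts A W d)"
    using sum_mono[of D "\<lambda>_. t" "dilated_shifts A W"] t by (simp add: mult.commute)
  also have "\<dots> = card (SIGMA d:D. SIGMA a:A. {c \<in> W. a * d + c \<in> W})"
    using fin by (simp add: dilated_shifts_def shifts_def)
  also have "\<dots> \<le> card T"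
    by (rule card_inj_on_le[OF _ _ finT, of "\<lambda>(d, a, c). (a, a * d + c, d, c)"])
      (auto simp: inj_on_def T_def mult.commute)
  finally have "(t * card D) ^ 3 \<le> card T ^ 3" by (rule power_mono) simp
  also have "\<dots> \<le> 1728 * (card A * card W * card D * card W)\<^sup>2"
    unfolding T_def by (rule szemeredi_trotter_cartesian[OF fin(1,2,3,2) nz])
  finally have "(card D)\<^sup>2 * (t ^ 3 * card D) \<le> (card D)\<^sup>2 * (1728 * (card A * card W * card W)\<^sup>2)"
    by (simp add: power_mult_distrib power2_eq_square power3_eq_cube mult_ac)
  then have "t ^ 3 * card D \<le> 1728 * (card A * card W * card W)\<^sup>2" by (cases "card D = 0") auto
  then have "real (t ^ 3 * card D) \<le> real (1728 * (card A * card W * card W)\<^sup>2)" unfolding of_nat_le_iff .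
  then show ?thesis by simp
qed

text \<open>For fixed a, a coincidence g (h + a) = g1 (h1 + a) of popular pairs says g h - g1 h1 = a
  (g1 - g) with both products in W, so it is counted by \<open>shifts W W (a * (g1 - g))\<close>.
  All values lie in A(A+a); Cauchy-Schwarz for each a and summation over a give the claim.\<close>

lemma popular_pairs_power2_le:
  fixes A B W :: "real set"
  assumes fin: "finite A" "finite W" and A: "0 \<notin> A" "B \<subseteq> A"
    and M: "\<And>a. a \<in> A \<Longrightarrow> card (A * (a +o A)) \<le> M"
  shows "card A * (\<Sum>g\<in>B. card {h \<in> A. g * h \<in> W})\<^sup>2 \<le> M * (\<Sum>g\<in>B. \<Sum>g'\<in>B. dilated_shifts A W (g - g'))"
proof -
  have finB: "finite B" using A fin finite_subset by blast
  define S where "S = (SIGMA g:B. {h \<in> A. g * h \<in> W})"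
  have finS: "finite S" using finB fin by (auto simp: S_def)
  have S: "card S = (\<Sum>g\<in>B. card {h \<in> A. g * h \<in> W})" using finB fin by (simp add: S_def)
  have one: "(card S)\<^sup>2 \<le> M * (\<Sum>g\<in>B. \<Sum>g'\<in>B. shifts W W (a * (g - g')))" if a: "a \<in> A" for a
  proof -
    define \<phi> where "\<phi> = (\<lambda>(g, h). g * (h + a))"
    let ?K = "SIGMA p:B \<times> B. {c \<in> W. a * (fst p - snd p) + c \<in> W}"
    have "card (coll \<phi> S) \<le> card ?K"
    proof (rule card_inj_on_le[of "\<lambda>((g, h), (g1, h1)). ((g1, g), g1 * h1)"])
      show "inj_on (\<lambda>((g, h), (g1, h1)). ((g1, g), g1 * h1)) (coll \<phi> S)"
      proof (rule inj_onI)
        fix p q assume p: "p \<in> coll \<phi> S" and q: "q \<in> coll \<phi> S"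
          and e: "(\<lambda>((g, h), (g1, h1)). ((g1, g), g1 * h1)) p = (\<lambda>((g, h), (g1, h1)). ((g1, g), g1 * h1)) q"
        obtain g h g1 h1 where pe: "p = ((g, h), (g1, h1))" by (metis prod.collapse)
        obtain k l k1 l1 where qe: "q = ((k, l), (k1, l1))" by (metis prod.collapse)
        have eq: "k = g" "k1 = g1" and "g1 * h1 = k1 * l1"
          using e unfolding pe qe prod.case prod.inject by metis+
        have "g \<in> A" "g1 \<in> A" using p A by (auto simp: pe S_def)
        then have nz: "g \<noteq> 0" "g1 \<noteq> 0" using A(1) by metis+
        have "h1 = l1" using \<open>g1 * h1 = k1 * l1\<close> unfolding eq using nz by simp
        moreover have "g * (h + a) = g * (l + a)"
          using p q eq \<open>h1 = l1\<close> by (simp add: pe qe \<phi>_def)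
        ultimately show "p = q" using nz eq by (simp add: pe qe)
      qed
      show "(\<lambda>((g, h), (g1, h1)). ((g1, g), g1 * h1)) ` coll \<phi> S \<subseteq> ?K"
      proof (rule image_subsetI)
        fix p assume p: "p \<in> coll \<phi> S"
        obtain g h g1 h1 where pe: "p = ((g, h), (g1, h1))" by (metis prod.collapse)
        have "a * (g1 - g) + g1 * h1 = g * h" using p by (simp add: pe \<phi>_def algebra_simps)
        then show "(\<lambda>((g, h), (g1, h1)). ((g1, g), g1 * h1)) p \<in> ?K" using p by (simp add: pe S_def)
      qed
      show "finite ?K" using finB fin by (intro finite_SigmaI) auto
    qed
    also have "card ?K = (\<Sum>g\<in>B. \<Sum>g'\<in>B. shifts W W (a * (g - g')))"
      using finB fin by (simp add: shifts_def sum.cartesian_product')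
    finally have c: "card (coll \<phi> S) \<le> (\<Sum>g\<in>B. \<Sum>g'\<in>B. shifts W W (a * (g - g')))" .
    have "a +o A = (+) a ` A" by (auto simp: elt_set_plus_def)
    then have "finite (A * (a +o A))" using fin by (simp add: finite_set_times)
    moreover have "\<phi> ` S \<subseteq> A * (a +o A)"
      using A(2) by (fastforce simp: \<phi>_def S_def set_times_def elt_set_plus_def add.commute)
    ultimately have "card (\<phi> ` S) \<le> M" using M[OF a] card_mono order_trans by blast
    then show ?thesis using card_power2_le_collisions[OF finS, of \<phi>] c mult_le_mono order_trans by blast
  qed
  have "card A * (card S)\<^sup>2 = (\<Sum>a\<in>A. (card S)\<^sup>2)" by simp
  also have "\<dots> \<le> (\<Sum>a\<in>A. M * (\<Sum>g\<in>B. \<Sum>g'\<in>B. shifts W W (a * (g - g'))))" by (intro sum_mono one)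
  also have "\<dots> = M * (\<Sum>a\<in>A. \<Sum>g\<in>B. \<Sum>g'\<in>B. shifts W W (a * (g - g')))" by (simp add: sum_distrib_left)
  also have "(\<Sum>a\<in>A. \<Sum>g\<in>B. \<Sum>g'\<in>B. shifts W W (a * (g - g')))
      = (\<Sum>g\<in>B. \<Sum>a\<in>A. \<Sum>g'\<in>B. shifts W W (a * (g - g')))" by (rule sum.swap)
  also have "\<dots> = (\<Sum>g\<in>B. \<Sum>g'\<in>B. dilated_shifts A W (g - g'))"
    unfolding dilated_shifts_def by (intro sum.cong refl sum.swap)
  finally show ?thesis unfolding S .
qed

text \<open>On the diagonal g2 = g3 the third factor is the constant |A||W|.\<close>

lemma dilated_form_split:
  fixes A B W :: "real set"
  assumes fin: "finite A" "finite B" "finite W"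
  shows "real (\<Sum>(a, g1, g2, g3)\<in>A \<times> B \<times> B \<times> B.
        shifts W W (a * (g1 - g2)) * shifts W W (a * (g1 - g3)) * dilated_shifts A W (g2 - g3))
    = real (\<Sum>(a, g1, g2, g3)\<in>{(a, g1, g2, g3) \<in> A \<times> B \<times> B \<times> B. g2 \<noteq> g3}.
        shifts W W (a * (g1 - g2)) * shifts W W (a * (g1 - g3)) * dilated_shifts A W (g2 - g3))
    + real (card A) * card W * (\<Sum>(a, g1, g2)\<in>A \<times> B \<times> B. (real (shifts W W (a * (g1 - g2))))\<^sup>2)"
proof -
  let ?f = "\<lambda>(a, g1, g2, g3). shifts W W (a * (g1 - g2)) * shifts W W (a * (g1 - g3)) * dilated_shifts A W (g2 - g3)"
  define Q R where "Q = {(a, g1, g2, g3) \<in> A \<times> B \<times> B \<times> B. g2 \<noteq> g3}"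
    and "R = {(a, g1, g2, g3) \<in> A \<times> B \<times> B \<times> B. g2 = g3}"
  have QR: "Q \<subseteq> A \<times> B \<times> B \<times> B" "R \<subseteq> A \<times> B \<times> B \<times> B" by (auto simp: Q_def R_def)
  then have finQR: "finite Q" "finite R" using fin by (meson finite_SigmaI finite_subset)+
  have "A \<times> B \<times> B \<times> B = Q \<union> R" "Q \<inter> R = {}" by (auto simp: Q_def R_def)
  then have "sum ?f (A \<times> B \<times> B \<times> B) = sum ?f Q + sum ?f R" using finQR by (simp add: sum.union_disjoint)
  moreover have R_image: "R = (\<lambda>(a, g1, g2). (a, g1, g2, g2)) ` (A \<times> B \<times> B)" by (force simp: R_def image_iff)
  then have "sum ?f R = (\<Sum>(a, g1, g2)\<in>A \<times> B \<times> B. shifts W W (a * (g1 - g2)) * shifts W W (a * (g1 - g2)) * dilated_shifts A W 0)"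
    by (subst R_image, subst sum.reindex) (auto simp: inj_on_def case_prod_unfold)
  moreover have "dilated_shifts A W 0 = card A * card W" by (simp add: dilated_shifts_def shifts_def)
  ultimately show ?thesis unfolding Q_def
    by (simp add: case_prod_unfold power2_eq_square sum_distrib_left mult_ac)
qed

text \<open>X is controlled through its sixth power, so the bound for \<Phi>^3 is raised to the
  sixth. The factor q^9 \<rho>^12 clears the denominators in the bounds for E3^3 and Zp^4. Up to
  constants and H the outcome is E^34 <= N^74 M^18.\<close>

lemma off_diagonal_arith:
  fixes N \<beta> w \<rho> q H M E \<Phi> X E3 Zp Zd :: real
  assumes pos: "0 < N" "0 \<le> \<beta>" "0 < w" "0 < \<rho>" "0 \<le> H" "0 \<le> M" "0 \<le> E" "0 \<le> \<Phi>" "0 \<le> X" "0 \<le> E3" "0 \<le> Zp" "0 \<le> Zd"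
    and q: "q = \<rho> * w" "q \<le> N\<^sup>2" and "\<beta> \<le> N" and e: "E \<le> 2 * (\<rho>\<^sup>2 * w) * H"
    and \<Phi>: "N * (q / 2)\<^sup>2 \<le> M * \<Phi>" "\<Phi> ^ 3 \<le> N * \<beta> ^ 3 * (2 * X)"
    and X: "X ^ 6 \<le> 1728 * N ^ 5 * E3 ^ 3 * Zp ^ 4 * Zd ^ 2 * H ^ 18"
    and E3: "E3 * q ^ 3 \<le> 41472 * (w * N * \<beta>)\<^sup>2 * N ^ 3 * H"
    and Zp: "Zp * \<rho> ^ 3 \<le> 1728 * (N * N * w)\<^sup>2" and Zd: "Zd \<le> 1728 * (N * w * w)\<^sup>2"
  shows "E ^ 34 \<le> (2 ^ 34 * 4 ^ 18 * 64 * 1728 ^ 7 * 41472 ^ 3) * (N ^ 74 * M ^ 18 * H ^ 55)"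
proof -
  define c :: real where "c = 4 ^ 18 * 64 * 1728 ^ 7 * 41472 ^ 3"
  have c0: "c > 0" by (simp add: c_def)
  have q0: "q > 0" using pos q by simp
  have "\<Phi> ^ 18 = (\<Phi> ^ 3) ^ 6" by (simp flip: power_mult)
  also have "\<dots> \<le> (N * \<beta> ^ 3 * (2 * X)) ^ 6" using \<Phi> pos by (intro power_mono) auto
  also have "\<dots> = 64 * N ^ 6 * \<beta> ^ 18 * X ^ 6" by (simp add: power_mult_distrib flip: power_mult)
  also have "\<dots> \<le> 64 * N ^ 6 * \<beta> ^ 18 * (1728 * N ^ 5 * E3 ^ 3 * Zp ^ 4 * Zd ^ 2 * H ^ 18)"
    using X pos by (intro mult_left_mono) auto
  finally have "q ^ 9 * \<rho> ^ 12 * \<Phi> ^ 18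
      \<le> q ^ 9 * \<rho> ^ 12 * (64 * N ^ 6 * \<beta> ^ 18 * (1728 * N ^ 5 * E3 ^ 3 * Zp ^ 4 * Zd ^ 2 * H ^ 18))"
    using pos q0 by (intro mult_left_mono) auto
  also have "\<dots> = 64 * 1728 * N ^ 6 * N ^ 5 * \<beta> ^ 18 * H ^ 18 * ((E3 * q ^ 3) ^ 3 * (Zp * \<rho> ^ 3) ^ 4 * Zd ^ 2)"
    by (simp add: power_mult_distrib flip: power_mult)
  also have "\<dots> \<le> 64 * 1728 * N ^ 6 * N ^ 5 * \<beta> ^ 18 * H ^ 18 *
      ((41472 * (w * N * \<beta>)\<^sup>2 * N ^ 3 * H) ^ 3 * (1728 * (N * N * w)\<^sup>2) ^ 4 * (1728 * (N * w * w)\<^sup>2) ^ 2)"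
    using pos q0 by (intro mult_left_mono mult_mono power_mono E3 Zp Zd) auto
  also have "\<dots> = 64 * 1728 ^ 7 * 41472 ^ 3 * (N ^ 46 * \<beta> ^ 24 * w ^ 22 * H ^ 21)"
  proof -
    have "H ^ 3 * (\<beta> ^ 6 * (N ^ 11 * (H ^ 18 * (\<beta> ^ 18 * N ^ 35))))
        = (H ^ 3 * H ^ 18) * ((\<beta> ^ 6 * \<beta> ^ 18) * (N ^ 11 * N ^ 35))" by (simp only: mult_ac)
    also have "\<dots> = H ^ 21 * (\<beta> ^ 24 * N ^ 46)" by (simp flip: power_add)
    finally show ?thesis by (simp add: power_mult_distrib mult_ac flip: power_mult)
  qed
  also have "\<dots> \<le> 64 * 1728 ^ 7 * 41472 ^ 3 * (N ^ 46 * N ^ 24 * w ^ 22 * H ^ 21)"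
    using pos \<open>\<beta> \<le> N\<close> by (intro mult_left_mono mult_right_mono power_mono) auto
  finally have up: "q ^ 9 * \<rho> ^ 12 * \<Phi> ^ 18 \<le> 64 * 1728 ^ 7 * 41472 ^ 3 * (N ^ 46 * N ^ 24 * w ^ 22 * H ^ 21)" .
  have "(N * (q / 2)\<^sup>2) ^ 18 \<le> (M * \<Phi>) ^ 18" using \<Phi>(1) pos by (intro power_mono) auto
  then have "4 ^ 18 * (N * (q / 2)\<^sup>2) ^ 18 \<le> 4 ^ 18 * (M * \<Phi>) ^ 18" by simp
  also have "4 ^ 18 * (N * (q / 2)\<^sup>2) ^ 18 = N ^ 18 * q ^ 36"
    by (simp add: power_mult_distrib power_divide flip: power_mult)
  finally have "q ^ 9 * \<rho> ^ 12 * (N ^ 18 * q ^ 36) \<le> q ^ 9 * \<rho> ^ 12 * (4 ^ 18 * (M * \<Phi>) ^ 18)"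
    using pos q0 by (intro mult_left_mono) auto
  also have "\<dots> = 4 ^ 18 * M ^ 18 * (q ^ 9 * \<rho> ^ 12 * \<Phi> ^ 18)" by (simp add: power_mult_distrib)
  also have "\<dots> \<le> 4 ^ 18 * M ^ 18 * (64 * 1728 ^ 7 * 41472 ^ 3 * (N ^ 46 * N ^ 24 * w ^ 22 * H ^ 21))"
    using up pos by (intro mult_left_mono) auto
  also have "\<dots> = (N ^ 18 * w ^ 22) * (c * M ^ 18 * N ^ 52 * H ^ 21)"
  proof -
    have "N ^ 46 * N ^ 24 = N ^ 18 * N ^ 52" by (simp flip: power_add)
    then show ?thesis by (simp add: c_def)
  qed
  also have "q ^ 9 * \<rho> ^ 12 * (N ^ 18 * q ^ 36) = (N ^ 18 * w ^ 22) * (\<rho> ^ 57 * w ^ 23)"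
  proof -
    have "\<rho> ^ 9 * (w ^ 9 * (\<rho> ^ 48 * w ^ 36)) = (\<rho> ^ 9 * \<rho> ^ 48) * (w ^ 9 * w ^ 36)" by (simp only: mult_ac)
    also have "\<dots> = \<rho> ^ 57 * (w ^ 22 * w ^ 23)" by (simp flip: power_add)
    also have "\<dots> = w ^ 22 * (\<rho> ^ 57 * w ^ 23)" by (simp only: mult_ac)
    finally show ?thesis by (simp add: q power_mult_distrib)
  qed
  finally have a: "\<rho> ^ 57 * w ^ 23 \<le> c * M ^ 18 * N ^ 52 * H ^ 21" using pos by simp
  \<comment> \<open>The powers 57 and 23 are not in the ratio 2 : 1 of \<rho>^2 w. Eleven uses of
    \<rho>^2 w <= \<rho> N^2 repair this: 57 = 46 + 11, and 34 = 23 + 11.\<close>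
  have "\<rho> * q \<le> \<rho> * N\<^sup>2" using q pos by (intro mult_left_mono) auto
  then have "(\<rho>\<^sup>2 * w) ^ 11 \<le> (\<rho> * N\<^sup>2) ^ 11"
    using pos by (intro power_mono) (simp_all add: q power2_eq_square mult_ac)
  then have "(\<rho>\<^sup>2 * w) ^ 23 * (\<rho>\<^sup>2 * w) ^ 11 \<le> (\<rho>\<^sup>2 * w) ^ 23 * (\<rho> * N\<^sup>2) ^ 11"
    using pos by (intro mult_left_mono) auto
  also have "\<dots> = (\<rho> ^ 57 * w ^ 23) * N ^ 22"
    by (simp add: power_mult_distrib mult_ac flip: power_mult power_add)
  also have "\<dots> \<le> (c * M ^ 18 * N ^ 52 * H ^ 21) * N ^ 22" using a pos by (intro mult_right_mono) auto
  finally have b: "(\<rho>\<^sup>2 * w) ^ 34 \<le> (c * M ^ 18 * N ^ 52 * H ^ 21) * N ^ 22" by (simp flip: power_add)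
  have "E ^ 34 \<le> (2 * (\<rho>\<^sup>2 * w) * H) ^ 34" using e pos by (intro power_mono) auto
  also have "\<dots> = 2 ^ 34 * (\<rho>\<^sup>2 * w) ^ 34 * H ^ 34" by (simp add: power_mult_distrib)
  also have "\<dots> \<le> 2 ^ 34 * ((c * M ^ 18 * N ^ 52 * H ^ 21) * N ^ 22) * H ^ 34"
    using b pos by (intro mult_right_mono mult_left_mono) auto
  also have "\<dots> = (2 ^ 34 * c) * ((N ^ 52 * N ^ 22) * M ^ 18 * (H ^ 21 * H ^ 34))" by (simp only: mult_ac)
  also have "\<dots> = (2 ^ 34 * c) * (N ^ 74 * M ^ 18 * H ^ 55)" by (simp flip: power_add)
  finally show ?thesis unfolding c_def by (simp only: mult.assoc)
qed

text \<open>Squaring the bound for \<Phi>^3 brings in R^2 and with it one \<Phi>, which cancels and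
  leaves a bound for \<Phi>^5. With N q^2 / 4 <= M \<Phi> this controls \<rho>^13 w^6, and one
  factor q = \<rho> w <= N^2 completes it to (\<rho>^2 w)^7.\<close>

lemma diagonal_arith:
  fixes N \<beta> w \<rho> q H M E \<Phi> R E3 :: real
  assumes pos: "0 < N" "0 \<le> \<beta>" "0 < w" "0 < \<rho>" "0 \<le> H" "0 \<le> M" "0 \<le> E" "0 \<le> \<Phi>" "0 \<le> R" "0 \<le> E3"
    and q: "q = \<rho> * w" "q \<le> N\<^sup>2" and "\<beta> \<le> N" and e: "E \<le> 2 * (\<rho>\<^sup>2 * w) * H"
    and \<Phi>: "N * (q / 2)\<^sup>2 \<le> M * \<Phi>" "\<Phi> ^ 3 \<le> N * \<beta> ^ 3 * (2 * (N * w * R))"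
    and R: "R\<^sup>2 \<le> \<Phi> * (N * \<beta> * E3)" and E3: "E3 * \<rho> ^ 3 \<le> 5184 * (N * N * w)\<^sup>2 * H"
  shows "E ^ 7 \<le> (2 ^ 7 * 4 ^ 5 * 4 * 5184) * (N ^ 13 * M ^ 5 * H ^ 8)"
proof -
  have q0: "q > 0" using pos q by simp
  have "0 < N * (q / 2)\<^sup>2" using pos q0 by simp
  then have "0 < M * \<Phi>" using \<Phi>(1) by linarith
  then have \<Phi>0: "0 < \<Phi>" using pos by (simp add: zero_less_mult_iff)
  have "\<Phi> * \<Phi> ^ 5 = (\<Phi> ^ 3)\<^sup>2" by (simp flip: power_mult power_Suc)
  also have "\<dots> \<le> (N * \<beta> ^ 3 * (2 * (N * w * R)))\<^sup>2" using \<Phi>(2) pos by (intro power_mono) auto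
  also have "\<dots> = 4 * N ^ 4 * \<beta> ^ 6 * w\<^sup>2 * R\<^sup>2"
  proof -
    have "N ^ 4 = N\<^sup>2 * N\<^sup>2" by (simp flip: power_add)
    then show ?thesis by (simp add: power_mult_distrib flip: power_mult)
  qed
  also have "\<dots> \<le> 4 * N ^ 4 * \<beta> ^ 6 * w\<^sup>2 * (\<Phi> * (N * \<beta> * E3))" using R pos by (intro mult_left_mono) auto
  also have "\<dots> = \<Phi> * (4 * (N ^ 4 * N) * (\<beta> ^ 6 * \<beta>) * w\<^sup>2 * E3)" by (simp only: mult_ac)
  finally have "\<Phi> ^ 5 \<le> 4 * (N ^ 4 * N) * (\<beta> ^ 6 * \<beta>) * w\<^sup>2 * E3" using \<Phi>0 by simp
  then have "\<rho> ^ 3 * \<Phi> ^ 5 \<le> \<rho> ^ 3 * (4 * (N ^ 4 * N) * (\<beta> ^ 6 * \<beta>) * w\<^sup>2 * E3)"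
    using pos by (intro mult_left_mono) auto
  also have "\<dots> = 4 * (N ^ 4 * N) * (\<beta> ^ 6 * \<beta>) * w\<^sup>2 * (E3 * \<rho> ^ 3)" by simp
  also have "\<dots> \<le> 4 * (N ^ 4 * N) * (N ^ 6 * N) * w\<^sup>2 * (5184 * (N * N * w)\<^sup>2 * H)"
    using pos \<open>\<beta> \<le> N\<close> by (intro mult_mono power_mono order_refl E3) auto
  also have "\<dots> = (4 * 5184) * (N ^ 16 * w ^ 4 * H)"
  proof -
    have "N ^ 16 = (N ^ 4 * N) * (N ^ 6 * N) * N\<^sup>2 * N\<^sup>2" by (simp flip: power_add power_Suc2)
    moreover have "w ^ 4 = w\<^sup>2 * w\<^sup>2" by (simp flip: power_add)
    ultimately show ?thesis by (simp add: power_mult_distrib)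
  qed
  finally have up: "\<rho> ^ 3 * \<Phi> ^ 5 \<le> (4 * 5184) * (N ^ 16 * w ^ 4 * H)" .
  have "(N * (q / 2)\<^sup>2) ^ 5 \<le> (M * \<Phi>) ^ 5" using \<Phi>(1) pos by (intro power_mono) auto
  then have "4 ^ 5 * (N * (q / 2)\<^sup>2) ^ 5 \<le> 4 ^ 5 * (M * \<Phi>) ^ 5" by simp
  also have "4 ^ 5 * (N * (q / 2)\<^sup>2) ^ 5 = N ^ 5 * q ^ 10"
    by (simp add: power_mult_distrib power_divide flip: power_mult)
  finally have "\<rho> ^ 3 * (N ^ 5 * q ^ 10) \<le> \<rho> ^ 3 * (4 ^ 5 * (M * \<Phi>) ^ 5)"
    using pos by (intro mult_left_mono) auto
  also have "\<dots> = 4 ^ 5 * M ^ 5 * (\<rho> ^ 3 * \<Phi> ^ 5)" by (simp add: power_mult_distrib)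
  also have "\<dots> \<le> 4 ^ 5 * M ^ 5 * ((4 * 5184) * (N ^ 16 * w ^ 4 * H))" using up pos by (intro mult_left_mono) auto
  also have "\<dots> = (N ^ 5 * w ^ 4) * ((4 ^ 5 * 4 * 5184) * M ^ 5 * N ^ 11 * H)"
  proof -
    have "N ^ 16 = N ^ 5 * N ^ 11" by (simp flip: power_add)
    then show ?thesis by simp
  qed
  also have "\<rho> ^ 3 * (N ^ 5 * q ^ 10) = (N ^ 5 * w ^ 4) * (\<rho> ^ 13 * w ^ 6)"
  proof -
    have "\<rho> ^ 13 = \<rho> ^ 3 * \<rho> ^ 10" "w ^ 4 * w ^ 6 = w ^ 10" by (simp_all flip: power_add)
    then show ?thesis by (simp add: q power_mult_distrib)
  qed
  finally have a: "\<rho> ^ 13 * w ^ 6 \<le> (4 ^ 5 * 4 * 5184) * M ^ 5 * N ^ 11 * H" using pos by simp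
  have "(\<rho>\<^sup>2 * w) ^ 7 = (\<rho> ^ 13 * w ^ 6) * q"
  proof -
    have "\<rho> ^ 14 = \<rho> ^ 13 * \<rho>" "w ^ 7 = w ^ 6 * w" by (simp_all flip: power_Suc2)
    then show ?thesis by (simp add: q power_mult_distrib flip: power_mult)
  qed
  also have "\<dots> \<le> ((4 ^ 5 * 4 * 5184) * M ^ 5 * N ^ 11 * H) * N\<^sup>2" using pos q0 by (intro mult_mono[OF a q(2)]) auto
  finally have b: "(\<rho>\<^sup>2 * w) ^ 7 \<le> ((4 ^ 5 * 4 * 5184) * M ^ 5 * N ^ 11 * H) * N\<^sup>2" .
  have "E ^ 7 \<le> (2 * (\<rho>\<^sup>2 * w) * H) ^ 7" using e pos by (intro power_mono) auto
  also have "\<dots> = 2 ^ 7 * (\<rho>\<^sup>2 * w) ^ 7 * H ^ 7" by (simp add: power_mult_distrib)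
  also have "\<dots> \<le> 2 ^ 7 * (((4 ^ 5 * 4 * 5184) * M ^ 5 * N ^ 11 * H) * N\<^sup>2) * H ^ 7"
    using b pos by (intro mult_right_mono mult_left_mono) auto
  also have "\<dots> = (2 ^ 7 * 4 ^ 5 * 4 * 5184) * ((N ^ 11 * N\<^sup>2) * M ^ 5 * (H * H ^ 7))" by (simp only: mult_ac)
  also have "\<dots> = (2 ^ 7 * 4 ^ 5 * 4 * 5184) * (N ^ 13 * M ^ 5 * H ^ 8)" by (simp flip: power_add power_Suc)
  finally show ?thesis .
qed


text \<open>The alternatives correspond to whether the off-diagonal or the diagonal part of the
  triple count dominates. H is taken at |A|^3 to exceed every harmonic number that occurs, in
  particular the one at |A||W|.\<close>

lemma energy_le_of_shifted_products:
  fixes A :: "real set"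
  assumes fin: "finite A" and A: "A \<noteq> {}" "0 \<notin> A"
    and M: "\<And>a. a \<in> A \<Longrightarrow> card (A * (a +o A)) \<le> M"
  defines "N \<equiv> real (card A)" and "H \<equiv> harm (card A ^ 3) :: real" and "E \<equiv> real (mult_energy A)"
  shows "E ^ 34 \<le> (2 ^ 34 * 4 ^ 18 * 64 * 1728 ^ 7 * 41472 ^ 3) * (N ^ 74 * real M ^ 18 * H ^ 55)
    \<or> E ^ 7 \<le> (2 ^ 7 * 4 ^ 5 * 4 * 5184) * (N ^ 13 * real M ^ 5 * H ^ 8)"
proof -
  obtain W \<rho> where W: "finite W" "W \<noteq> {}" "0 \<notin> W" "1 \<le> \<rho>"
    "\<And>w. w \<in> W \<Longrightarrow> \<rho> \<le> card {(x, d). x \<in> A \<and> d \<in> A \<and> w = d * x}"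
    "real (mult_energy A) \<le> 2 * ((real \<rho>)\<^sup>2 * card W) * harm (card A)"
    "\<rho> * card W \<le> (card A)\<^sup>2" "\<rho> * card W \<le> (\<Sum>g\<in>A. card {h \<in> A. g * h \<in> W})"
    by (rule popular_products[OF fin A]) (rule that, assumption+)
  define w q where "w = real (card W)" and "q = real \<rho> * w"
  define f where "f g = card {h \<in> A. g * h \<in> W}" for g
  \<comment> \<open>Half of the average: the elements below this threshold carry at most q / 2
    popular pairs, so B keeps at least q / 2.\<close>
  define \<theta> where "\<theta> = q / (2 * N)"
  define B where "B = {g \<in> A. \<theta> \<le> real (f g)}"
  define \<beta> where "\<beta> = real (card B)"
  have A1: "1 \<le> card A" using fin A(1) by (simp add: Suc_leI card_gt_0_iff)
  have W1: "1 \<le> card W" using W(1,2) by (simp add: Suc_leI card_gt_0_iff)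
  have N: "1 \<le> N" and w: "1 \<le> w" and \<rho>: "1 \<le> real \<rho>" using A1 W1 W(4) by (simp_all add: N_def w_def)
  have q0: "0 < q" using w \<rho> unfolding q_def by simp
  then have \<theta>0: "0 < \<theta>" using N by (simp add: \<theta>_def)
  have qN: "q \<le> N\<^sup>2"
  proof -
    have "real (\<rho> * card W) \<le> real ((card A)\<^sup>2)" using W(7) unfolding of_nat_le_iff .
    then show ?thesis by (simp add: q_def w_def N_def)
  qed
  have BA: "B \<subseteq> A" and finB: "finite B" using fin by (auto simp: B_def)
  have \<beta>N: "\<beta> \<le> N" unfolding \<beta>_def N_def using card_mono[OF fin BA] by simp
  have H0: "0 \<le> H" by (simp add: H_def harm_nonneg)
  have A_le: "card A \<le> card A ^ 3" using A1 by (intro self_le_power) auto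
  have W_le: "card A * card W \<le> card A ^ 3"
  proof -
    have "1 * card W \<le> \<rho> * card W" using W(4) by (intro mult_le_mono1)
    then have "card A * card W \<le> card A * (card A)\<^sup>2" using W(7) by (intro mult_le_mono2) linarith
    then show ?thesis by (simp add: power2_eq_square power3_eq_cube)
  qed
  have hle: "(harm k :: real) \<le> H" if "k \<le> card A ^ 3" for k unfolding H_def using that by (rule harm_mono)
  have harm_le: "(harm (card A) :: real) \<le> H" "(harm (card B) :: real) \<le> H" "(harm (card W) :: real) \<le> H"
    "(harm (card A * card W) :: real) \<le> H"
  proof -
    show "(harm (card A) :: real) \<le> H" using A_le by (rule hle)
    show "(harm (card B) :: real) \<le> H" using card_mono[OF fin BA] A_le by (intro hle) linarith
    show "(harm (card A * card W) :: real) \<le> H" using W_le by (rule hle)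
    have "1 * card W \<le> card A * card W" using A1 by (intro mult_le_mono1)
    then show "(harm (card W) :: real) \<le> H" using W_le by (intro hle) linarith
  qed
  have e: "E \<le> 2 * ((real \<rho>)\<^sup>2 * w) * H"
    unfolding E_def w_def by (rule order_trans[OF W(6)], intro mult_left_mono harm_le) simp
  define \<Gamma> where "\<Gamma> = real (\<Sum>g\<in>B. f g)"
  have \<Gamma>: "q / 2 \<le> \<Gamma>"
  proof -
    have "q \<le> real (\<Sum>g\<in>A. f g)"
      using W(8) unfolding q_def w_def f_def of_nat_mult[symmetric] of_nat_le_iff .
    also have "\<dots> = (\<Sum>g\<in>A - B. real (f g)) + \<Gamma>"
      unfolding \<Gamma>_def of_nat_sum by (rule sum.subset_diff[OF BA fin])
    also have "(\<Sum>g\<in>A - B. real (f g)) \<le> (\<Sum>g\<in>A - B. \<theta>)" by (intro sum_mono) (auto simp: B_def)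
    also have "\<dots> \<le> N * \<theta>" using card_Diff_subset_Int[of A B] \<theta>0 fin
      by (simp add: N_def card_mono mult_right_mono)
    also have "\<dots> = q / 2" using N by (simp add: \<theta>_def)
    finally show ?thesis by linarith
  qed
  define \<Phi> where "\<Phi> = real (\<Sum>g\<in>B. \<Sum>g'\<in>B. dilated_shifts A W (g - g'))"
  have \<Phi>0: "0 \<le> \<Phi>" unfolding \<Phi>_def by (rule of_nat_0_le_iff)
  have \<Phi>1: "N * (q / 2)\<^sup>2 \<le> M * \<Phi>"
  proof -
    have "N * (q / 2)\<^sup>2 \<le> N * \<Gamma>\<^sup>2" using \<Gamma> q0 N by (intro mult_left_mono power_mono) auto
    also have "\<dots> = real (card A * (\<Sum>g\<in>B. card {h \<in> A. g * h \<in> W})\<^sup>2)" by (simp add: N_def \<Gamma>_def f_def)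
    also have "\<dots> \<le> real (M * (\<Sum>g\<in>B. \<Sum>g'\<in>B. dilated_shifts A W (g - g')))"
      unfolding of_nat_le_iff by (rule popular_pairs_power2_le[OF fin W(1) A(2) BA M])
    finally show ?thesis by (simp add: \<Phi>_def)
  qed
  define DB DW where "DB = (\<lambda>(b, c). b - c) ` (B \<times> B)" and "DW = (\<lambda>(b, c). b - c) ` (W \<times> W)"
  have finD: "finite DB" "finite DW" using finB W(1) by (simp_all add: DB_def DW_def)
  define E3 E3W where "E3 = (\<Sum>d\<in>DB. real (shifts B B d ^ 3))" and "E3W = (\<Sum>p\<in>DW. real (shifts W W p ^ 3))"
  have E30: "0 \<le> E3" "0 \<le> E3W" unfolding E3_def E3W_def by (intro sum_nonneg; simp)+
  have repsW: "real \<rho> \<le> card {(x, d). x \<in> A \<and> d \<in> A \<and> v = d * x}" if "v \<in> W" for v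
    using W(5)[OF that] by simp
  have E3W: "E3W * real \<rho> ^ 3 \<le> 5184 * (N * N * w)\<^sup>2 * H"
  proof -
    have "E3W \<le> 5184 * (N * N * w)\<^sup>2 / real \<rho> ^ 3 * harm (card W)"
      unfolding E3W_def N_def w_def
      by (rule third_moment_shifts_le[OF fin fin W(1) finD(2) A(2) A(2) _ repsW]) (use \<rho> in auto)
    also have "\<dots> \<le> 5184 * (N * N * w)\<^sup>2 / real \<rho> ^ 3 * H" by (intro mult_left_mono harm_le) simp
    finally show ?thesis using \<rho> by (simp add: field_simps)
  qed
  have inv: "card (inverse ` A) = card A" by (simp add: card_image inj_on_def)
  have repsB: "\<theta> \<le> card {(x, d). x \<in> W \<and> d \<in> inverse ` A \<and> g = d * x}" if "g \<in> B" for g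
  proof -
    have "\<theta> \<le> real (f g)" "g \<noteq> 0" using that A(2) by (auto simp: B_def)
    then show ?thesis using quotient_representations[OF fin A(2), of g W] unfolding f_def by simp
  qed
  have E3: "E3 * q ^ 3 \<le> 41472 * (w * N * \<beta>)\<^sup>2 * N ^ 3 * H"
  proof -
    have "E3 \<le> 5184 * (real (card W) * card (inverse ` A) * card B)\<^sup>2 / \<theta> ^ 3 * harm (card B)"
      unfolding E3_def
      by (rule third_moment_shifts_le[OF W(1) _ finB finD(1) W(3) _ \<theta>0 repsB]) (use fin A in auto)
    also have "\<dots> \<le> 5184 * (w * N * \<beta>)\<^sup>2 / \<theta> ^ 3 * H"
      unfolding inv w_def N_def \<beta>_def using \<theta>0 by (intro mult_left_mono harm_le) simp
    \<comment> \<open>41472 = 8 * 5184, with 8 from the cube of the 2 in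
      \<open>\<theta>\<close>.\<close>
    also have "\<dots> = 41472 * (w * N * \<beta>)\<^sup>2 * N ^ 3 * H / q ^ 3"
      using N q0 by (simp add: \<theta>_def power_divide power_mult_distrib)
    finally show ?thesis using q0 by (simp add: field_simps)
  qed
  define Zp Zd where "Zp = 1728 * (N * N * w)\<^sup>2 / real \<rho> ^ 3" and "Zd = 1728 * (N * w * w)\<^sup>2"
  have Z0: "0 \<le> Zp" "0 \<le> Zd" by (simp_all add: Zp_def Zd_def)
  have Zp: "real t ^ 3 * card {p \<in> DW. t \<le> shifts W W p} \<le> Zp" for t
  proof -
    have "card {p \<in> DW. t \<le> shifts W W p} * real t ^ 3 * real \<rho> ^ 3 \<le> 1728 * (real (card A) * card A * card W)\<^sup>2"
      by (rule card_rich_shifts_le[OF fin fin W(1) _ A(2) A(2) _ repsW]) (use finD in auto)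
    then show ?thesis using \<rho> unfolding Zp_def N_def w_def by (simp add: pos_le_divide_eq mult_ac)
  qed
  have Zd: "real t ^ 3 * card {d \<in> DB - {0}. t \<le> dilated_shifts A W d} \<le> Zd" for t
    unfolding Zd_def N_def w_def
    by (rule card_rich_dilations_le[OF fin W(1) _ A(2)]) (use finD in auto)
  have shW: "shifts W W p \<le> card W" for p unfolding shifts_def using W(1) by (intro card_mono) auto
  have n: "shifts W W p \<le> card A * card W" "dilated_shifts A W d \<le> card A * card W" for p d
  proof -
    have "1 * card W \<le> card A * card W" using A1 by (intro mult_le_mono1)
    then show "shifts W W p \<le> card A * card W" using shW[of p] by linarith
    show "dilated_shifts A W d \<le> card A * card W"
      unfolding dilated_shifts_def using sum_bounded_above[of A _ "card W"] shW by simp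
  qed
  define X where "X = real (\<Sum>(a, g1, g2, g3)\<in>{(a, g1, g2, g3) \<in> A \<times> B \<times> B \<times> B. g2 \<noteq> g3}.
        shifts W W (a * (g1 - g2)) * shifts W W (a * (g1 - g3)) * dilated_shifts A W (g2 - g3))"
  define R where "R = (\<Sum>(a, g1, g2)\<in>A \<times> B \<times> B. (real (shifts W W (a * (g1 - g2))))\<^sup>2)"
  have X0: "0 \<le> X" unfolding X_def by (rule of_nat_0_le_iff)
  have R0: "0 \<le> R" unfolding R_def by (intro sum_nonneg) auto
  have "X ^ 6 \<le> 1728 * real (card A) ^ 5 * E3 ^ 3 * Zp ^ 4 * Zd ^ 2 * harm (card A * card W) ^ 18"
    unfolding X_def E3_def DB_def
    by (rule dilated_off_diagonal_le[OF fin finB W(1) A(2) Zp[unfolded DW_def] Zd[unfolded DB_def] n])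
  also have "\<dots> \<le> 1728 * N ^ 5 * E3 ^ 3 * Zp ^ 4 * Zd ^ 2 * H ^ 18"
    unfolding N_def using E30 Z0 by (intro mult_left_mono power_mono harm_le) (auto simp: harm_nonneg)
  finally have X6: "X ^ 6 \<le> 1728 * N ^ 5 * E3 ^ 3 * Zp ^ 4 * Zd ^ 2 * H ^ 18" .
  have R2: "R\<^sup>2 \<le> \<Phi> * (N * \<beta> * E3W)"
    unfolding R_def \<Phi>_def N_def \<beta>_def E3W_def DW_def by (rule dilated_diagonal_le[OF fin finB W(1) A(2)])
  have \<Phi>3: "\<Phi> ^ 3 \<le> N * \<beta> ^ 3 * (X + N * w * R)"
    unfolding \<Phi>_def N_def \<beta>_def w_def X_def R_def dilated_form_split[OF fin finB W(1), symmetric]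
    using dilated_energy_power3_le[OF fin finB W(1)] by simp
  have pos: "0 < N" "0 \<le> \<beta>" "0 < w" "0 < real \<rho>" "0 \<le> real M" "0 \<le> E"
    using N w \<rho> by (simp_all add: \<beta>_def E_def)
  show ?thesis
  proof (cases "N * w * R \<le> X")
    case True
    then have "\<Phi> ^ 3 \<le> N * \<beta> ^ 3 * (2 * X)"
      using \<Phi>3 pos by (smt (verit) mult_left_mono mult_nonneg_nonneg zero_le_power)
    moreover have "Zp * real \<rho> ^ 3 \<le> 1728 * (N * N * w)\<^sup>2" using \<rho> by (simp add: Zp_def)
    ultimately have "E ^ 34 \<le> (2 ^ 34 * 4 ^ 18 * 64 * 1728 ^ 7 * 41472 ^ 3) * (N ^ 74 * real M ^ 18 * H ^ 55)"
      by (intro off_diagonal_arith[OF pos(1-4) H0 pos(5,6) \<Phi>0 X0 E30(1) Z0 q_def qN \<beta>N e \<Phi>1 _ X6 E3])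
        (simp_all add: Zd_def)
    then show ?thesis by (rule disjI1)
  next
    case False
    then have "\<Phi> ^ 3 \<le> N * \<beta> ^ 3 * (2 * (N * w * R))"
      using \<Phi>3 pos by (smt (verit) mult_left_mono mult_nonneg_nonneg zero_le_power)
    then have "E ^ 7 \<le> (2 ^ 7 * 4 ^ 5 * 4 * 5184) * (N ^ 13 * real M ^ 5 * H ^ 8)"
      by (intro diagonal_arith[OF pos(1-4) H0 pos(5,6) \<Phi>0 R0 E30(2) q_def qN \<beta>N e \<Phi>1 _ R2 E3W])
    then show ?thesis by (rule disjI2)
  qed
qed

text \<open>\<open>A'\<close> is A for sums and -A for differences. The set A \<union> -A' holds all
  abscissae and has at most 2 N elements; 1327104 = 16 * 2^4 * 5184, with 16 from N - 1 >= N /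
  2.\<close>

lemma energy_lower_bound:
  fixes A A' :: "real set"
  assumes fin: "finite A" "finite A'" and A: "0 \<notin> A" "2 \<le> card A" "card A' = card A"
    and M: "\<And>a. a \<in> A' \<Longrightarrow> card (A * (a +o A)) \<le> M"
  shows "real (card A) ^ 6 \<le> 1327104 * ((real M)\<^sup>2 * mult_energy A * harm (card A ^ 3))"
proof -
  define N E H where "N = real (card A)" and "E = real (mult_energy A)" and "H = (harm (card A ^ 3) :: real)"
  define Z where "Z = A \<union> uminus ` A'"
  have N: "2 \<le> N" using A(2) by (simp add: N_def)
  have finZ: "finite Z" using fin by (simp add: Z_def)
  have "card Z \<le> card A + card (uminus ` A')" unfolding Z_def by (rule card_Un_le)
  also have "card (uminus ` A') = card A" using A(3) by (simp add: card_image)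
  finally have Z: "card Z \<le> 2 * card A" by simp
  have "2 * card A \<le> card A ^ 3"
  proof -
    have "2 * 1 * card A \<le> card A * card A * card A" using A(2) by (intro mult_le_mono) auto
    then show ?thesis by (simp add: power3_eq_cube)
  qed
  then have HZ: "(harm (card Z) :: real) \<le> H" unfolding H_def using Z by (intro harm_mono) linarith
  have ZN: "real (card Z) ^ 4 \<le> (2 * N) ^ 4" using Z by (intro power_mono) (auto simp: N_def)
  have "N ^ 10 / 16 = (N * (N * (N / 2))\<^sup>2)\<^sup>2"
    by (simp add: power_mult_distrib power_divide flip: power_mult power_add power_Suc)
  also have "\<dots> \<le> (N * (N * (N - 1))\<^sup>2)\<^sup>2" using N by (intro power_mono mult_left_mono) auto
  also have "\<dots> \<le> (real M)\<^sup>2 * (E * (5184 * real (card Z) ^ 4 * harm (card Z)))"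
    using shifted_products_energy_le[OF fin(1) A(1) finZ _ _ fin(2) M] unfolding N_def E_def A(3)
    by (simp add: Z_def)
  also have "\<dots> \<le> (real M)\<^sup>2 * (E * (5184 * (2 * N) ^ 4 * H))"
    using HZ ZN by (intro mult_left_mono mult_mono) (auto simp: E_def harm_nonneg)
  finally have "N ^ 4 * N ^ 6 \<le> N ^ 4 * (1327104 * ((real M)\<^sup>2 * E * H))"
    by (simp add: power_mult_distrib mult_ac flip: power_add)
  then have "N ^ 6 \<le> 1327104 * ((real M)\<^sup>2 * E * H)" by (rule mult_left_le_imp_le) (use N in simp)
  then show ?thesis unfolding N_def E_def H_def .
qed

section \<open>Absorbing the logarithms\<close>

lemma harm_le_one_plus_ln:
  assumes "1 \<le> n"
  shows "(harm n :: real) \<le> 1 + ln n"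
proof -
  obtain m where m: "n = Suc m" using assms by (cases n) auto
  have "harm (Suc m) - ln (Suc m) \<le> harm (Suc 0) - ln (real (Suc 0))"
    using decseqD[OF decseq_harm_diff_ln, of 0 m] by simp
  moreover have "(harm (Suc 0) :: real) = 1" by (simp add: harm_def)
  ultimately show ?thesis by (simp add: m)
qed

text \<open>The exponent 1/500 is a choice, small enough that the powers H^49, H^89 and H^15 met
  below fit into the margins over the claimed exponents. 1501 = 1 + 3 * 500.\<close>

lemma harm_cube_le_powr:
  assumes "1 \<le> n"
  shows "(harm (n ^ 3) :: real) \<le> 1501 * real n powr (1 / 500)"
proof -
  have "(harm (n ^ 3) :: real) \<le> 1 + ln (real (n ^ 3))" using assms by (intro harm_le_one_plus_ln) simp
  also have "ln (real (n ^ 3)) = 3 * ln n" using assms by (simp add: ln_realpow)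
  also have "ln (real n) \<le> real n powr (1 / 500) / (1 / 500)" using assms by (intro ln_powr_bound) auto
  also have "1 + 3 * (real n powr (1 / 500) / (1 / 500)) \<le> 1501 * real n powr (1 / 500)"
    using assms ge_one_powr_ge_zero[of "real n" "1 / 500"] by simp
  finally show ?thesis by simp
qed

lemma powr_le_of_power_le:
  fixes N K M H L \<delta> e :: real
  assumes pos: "1 \<le> N" "0 \<le> K" "0 \<le> M" "0 \<le> H" "0 \<le> L" and q: "0 < q"
    and main: "N ^ p \<le> K * (M ^ q * H ^ r)" and H: "H \<le> L * N powr \<delta>" and e: "e * q \<le> p - r * \<delta>"
  shows "N powr e \<le> root q (K * L ^ r) * M"
proof -
  have N0: "0 < N" using pos by simp
  have "N powr (r * \<delta>) * (N powr e) ^ q = N powr (r * \<delta> + e * q)"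
    using N0 by (simp add: powr_add powr_powr mult.commute flip: powr_realpow)
  also have "\<dots> \<le> N powr p" using e pos by (intro powr_mono) auto
  also have "\<dots> = N ^ p" using N0 by (rule powr_realpow)
  also have "\<dots> \<le> K * (M ^ q * H ^ r)" by (rule main)
  also have "\<dots> \<le> K * (M ^ q * (L * N powr \<delta>) ^ r)" using H pos by (intro mult_left_mono power_mono) auto
  also have "(L * N powr \<delta>) ^ r = L ^ r * N powr (r * \<delta>)"
    using N0 by (simp add: power_mult_distrib powr_powr mult.commute flip: powr_realpow)
  finally have "N powr (r * \<delta>) * (N powr e) ^ q \<le> N powr (r * \<delta>) * (K * L ^ r * M ^ q)" by (simp add: mult_ac)
  then have "(N powr e) ^ q \<le> K * L ^ r * M ^ q" using N0 by simp
  also have "\<dots> = (root q (K * L ^ r) * M) ^ q"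
    using pos q by (simp add: power_mult_distrib real_root_pow_pos2)
  finally have "(N powr e) ^ q \<le> (root q (K * L ^ r) * M) ^ q" .
  moreover have "0 \<le> root q (K * L ^ r) * M"
    using pos by (intro mult_nonneg_nonneg real_root_ge_zero zero_le_power) auto
  ultimately show ?thesis using q by (simp add: power_mono_iff)
qed


section \<open>Elimination of the energy and the resulting growth exponents\<close>

lemma eliminate_energy:
  fixes N M E H K1 K2 :: real
  assumes pos: "0 < N" "0 \<le> M" "0 \<le> E" "0 \<le> H" "0 \<le> K1" "0 \<le> K2"
    and "N ^ 6 \<le> K1 * (M\<^sup>2 * E * H)" "E ^ j \<le> K2 * (N ^ a * M ^ b * H ^ c)" and j: "6 * j = a + d"
  shows "N ^ d \<le> K1 ^ j * K2 * (M ^ (2 * j + b) * H ^ (j + c))"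
proof -
  have "N ^ a * N ^ d = (N ^ 6) ^ j" by (simp add: j flip: power_add power_mult)
  also have "\<dots> \<le> (K1 * (M\<^sup>2 * E * H)) ^ j" using assms by (intro power_mono) auto
  also have "\<dots> = K1 ^ j * M ^ (2 * j) * H ^ j * E ^ j" by (simp add: power_mult_distrib power_mult)
  also have "\<dots> \<le> K1 ^ j * M ^ (2 * j) * H ^ j * (K2 * (N ^ a * M ^ b * H ^ c))"
    using assms by (intro mult_left_mono) auto
  also have "\<dots> = N ^ a * (K1 ^ j * K2 * (M ^ (2 * j + b) * H ^ (j + c)))" by (simp add: power_add)
  finally show ?thesis using pos by simp
qed

text \<open>The constant of \<open>powr_le_of_power_le\<close> for N^46 <= K M^30 H^49.\<close>

definition small_energy_const :: real
  where "small_energy_const = root 30 (1327104 ^ 10 * (1024 * 11950848 * 1728 ^ 5) * 1501 ^ 49)"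

lemma small_energy_const_nonneg: "0 \<le> small_energy_const"
  unfolding small_energy_const_def by (intro real_root_ge_zero) simp

text \<open>22951/15000 = (46 - 49/500) / 30 is 23/15 less the price of the logarithms, and exceeds
  both 32/21 and 7239/4733.\<close>

lemma dilated_sumset_growth:
  fixes A A' S' :: "real set"
  assumes fin: "finite A" "finite A'" "finite S'" and A: "0 \<notin> A" "2 \<le> card A" "card A' = card A"
    and \<tau>: "\<tau> = 1 \<or> \<tau> = -1"
    and S': "\<And>u a b. \<lbrakk>u \<in> A; a \<in> A; b \<in> A\<rbrakk> \<Longrightarrow> u * (\<tau> * a - b) \<in> S'" "card A \<le> card S'"
    and M: "\<And>a. a \<in> A' \<Longrightarrow> card (A * (a +o A)) \<le> card S'" and e: "e \<le> 22951 / 15000"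
  shows "real (card A) powr e \<le> small_energy_const * card S'"
proof -
  define N M E H where "N = real (card A)" and "M = real (card S')"
    and "E = real (mult_energy A)" and "H = (harm (card A ^ 3) :: real)"
  have ne: "A \<noteq> {}" using A(2) by auto
  have N: "1 \<le> N" using A(2) by (simp add: N_def)
  have H0: "0 \<le> H" by (simp add: H_def harm_nonneg)
  have M0: "0 \<le> M" "0 \<le> E" by (simp_all add: M_def E_def)
  have "card A \<le> card A ^ 3" using A(2) by (intro self_le_power) auto
  then have harm_le: "(harm (card A) :: real) \<le> H" unfolding H_def by (rule harm_mono)
  have lower: "N ^ 6 \<le> 1327104 * (M\<^sup>2 * E * H)"
    unfolding N_def M_def E_def H_def by (rule energy_lower_bound[OF fin(1,2) A(1-3) M])
  have "E ^ 10 \<le> 1024 * 11950848 * 1728 ^ 5 * (N ^ 14 * M ^ 10 * harm (card A) ^ 39)"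
    unfolding N_def M_def E_def by (rule energy_le_of_dilated_sumset[OF fin(1,3) ne A(1) \<tau> S'])
  also have "\<dots> \<le> 1024 * 11950848 * 1728 ^ 5 * (N ^ 14 * M ^ 10 * H ^ 39)"
    using N M0 by (intro mult_left_mono power_mono harm_le) (auto simp: harm_nonneg)
  finally have upper: "E ^ 10 \<le> 1024 * 11950848 * 1728 ^ 5 * (N ^ 14 * M ^ 10 * H ^ 39)" .
  have "N ^ 46 \<le> 1327104 ^ 10 * (1024 * 11950848 * 1728 ^ 5) * (M ^ (2 * 10 + 10) * H ^ (10 + 39))"
    by (rule eliminate_energy[OF _ M0 H0 _ _ lower upper]) (use N in simp_all)
  then have power: "N ^ 46 \<le> 1327104 ^ 10 * (1024 * 11950848 * 1728 ^ 5) * (M ^ 30 * H ^ 49)" by simp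
  have HN: "H \<le> 1501 * N powr (1 / 500)"
    using harm_cube_le_powr[of "card A"] A(2) by (simp add: H_def N_def)
  have "N powr e \<le> root 30 (1327104 ^ 10 * (1024 * 11950848 * 1728 ^ 5) * 1501 ^ 49) * M"
    by (rule powr_le_of_power_le[OF N _ M0(1) H0 _ _ power HN]) (use e in auto)
  then show ?thesis unfolding small_energy_const_def N_def M_def .
qed

lemma products_with_sums_growth:
  fixes A :: "real set"
  assumes fin: "finite A" and A: "0 \<notin> A" "2 \<le> card A" and e: "e \<le> 22951 / 15000"
  shows "real (card A) powr e \<le> small_energy_const * card (A * (A + A))"
proof -
  define S where "S = A * (A + A)"
  have finS: "finite S" using fin by (simp add: S_def finite_set_times finite_set_plus)
  have cS: "card (uminus ` S) = card S" by (simp add: card_image)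
  have mem: "u * (a + b) \<in> S" if "u \<in> A" "a \<in> A" "b \<in> A" for u a b
    unfolding S_def using that by (intro set_times_intro set_plus_intro)
  obtain a where a: "a \<in> A" using A(2) by fastforce
  then have a0: "a + a \<noteq> 0" using A(1) by auto
  have "card A \<le> card S"
  proof (rule card_inj_on_le[OF _ _ finS])
    show "inj_on (\<lambda>u. u * (a + a)) A" using a0 by (auto simp: inj_on_def)
    show "(\<lambda>u. u * (a + a)) ` A \<subseteq> S" using mem a by blast
  qed
  moreover have "card (A * (c +o A)) \<le> card S" if "c \<in> A" for c
    by (rule card_mono[OF finS]) (use that mem in \<open>auto simp: set_times_def elt_set_plus_def\<close>)
  \<comment> \<open>The sums are reached through -S, which has the cardinality of S.\<close>
  moreover have "u * ((- 1) * a - b) \<in> uminus ` S" if "u \<in> A" "a \<in> A" "b \<in> A" for u a b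
    using mem[OF that] by (intro image_eqI[of _ _ "u * (a + b)"]) (auto simp: algebra_simps)
  ultimately have "real (card A) powr e \<le> small_energy_const * card (uminus ` S)"
    by (intro dilated_sumset_growth[OF fin fin _ A refl, of _ "- 1"]) (use e in \<open>auto simp: cS finS\<close>)
  then show ?thesis unfolding cS unfolding S_def .
qed

lemma products_with_differences_growth:
  fixes A :: "real set"
  assumes fin: "finite A" and A: "0 \<notin> A" "2 \<le> card A" and e: "e \<le> 22951 / 15000"
  shows "real (card A) powr e \<le> small_energy_const * card (A * difference_set A A)"
proof -
  define S where "S = A * difference_set A A"
  have "difference_set A A = (\<lambda>(x, y). x - y) ` (A \<times> A)" by (auto simp: difference_set_def)
  then have finS: "finite S" using fin by (simp add: S_def finite_set_times)
  have mem: "u * (a - b) \<in> S" if "u \<in> A" "a \<in> A" "b \<in> A" for u a b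
    unfolding S_def using that by (intro set_times_intro) (auto simp: difference_set_def)
  obtain a b where ab: "a \<in> A" "b \<in> A" "a \<noteq> b"
    using A(2) card_le_Suc0_iff_eq[OF fin] by fastforce
  have "card A \<le> card S"
  proof (rule card_inj_on_le[OF _ _ finS])
    show "inj_on (\<lambda>u. u * (a - b)) A" using ab(3) by (auto simp: inj_on_def)
    show "(\<lambda>u. u * (a - b)) ` A \<subseteq> S" using mem ab by blast
  qed
  \<comment> \<open>Here the shifts are c = -b with b in A, since A + c must consist of
    differences.\<close>
  moreover have "card (A * (c +o A)) \<le> card S" if c: "c \<in> uminus ` A" for c
  proof (rule card_mono[OF finS], rule subsetI)
    fix x assume "x \<in> A * (c +o A)"
    then obtain u h where "u \<in> A" "h \<in> A" "x = u * (c + h)"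
      by (auto simp: set_times_def elt_set_plus_def)
    moreover obtain b where "b \<in> A" "c = - b" using c by blast
    ultimately show "x \<in> S" using mem[of u h b] by simp
  qed
  moreover have "card (uminus ` A) = card A" by (simp add: card_image)
  ultimately show ?thesis unfolding S_def[symmetric]
    by (intro dilated_sumset_growth[OF fin _ finS A, of "uminus ` A" 1]) (use e in \<open>auto simp: fin mem\<close>)
qed

definition shifted_product_const :: real
  where "shifted_product_const =
    max (root 86 (1327104 ^ 34 * (2 ^ 34 * 4 ^ 18 * 64 * 1728 ^ 7 * 41472 ^ 3) * 1501 ^ 89))
      (root 19 (1327104 ^ 7 * (2 ^ 7 * 4 ^ 5 * 4 * 5184) * 1501 ^ 15))"

lemma shifted_product_const_nonneg: "0 \<le> shifted_product_const"
  unfolding shifted_product_const_def by (intro max.coboundedI1 real_root_ge_zero) simp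

text \<open>The a with the largest |A(A+a)| is taken, so that its cardinality bounds those for all
  shifts. After the logarithms the exponents are (130 - 89/500) / 86 and (29 - 15/500) / 19, both
  above 229/152.\<close>

lemma ex_shifted_product_growth:
  fixes A :: "real set"
  assumes fin: "finite A" and A: "0 \<notin> A" "2 \<le> card A" and e: "e \<le> 229 / 152"
  shows "\<exists>a\<in>A. real (card A) powr e \<le> shifted_product_const * card (A * (a +o A))"
proof -
  define s where "s a = card (A * (a +o A))" for a
  have ne: "A \<noteq> {}" using A(2) by auto
  obtain a where a: "a \<in> A" "s a = Max (s ` A)"
    using Max_in[of "s ` A"] fin ne by fastforce
  have s_le: "card (A * (b +o A)) \<le> s a" if "b \<in> A" for b
    using a(2) that fin by (simp flip: s_def)
  define N M E H where "N = real (card A)" and "M = real (s a)"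
    and "E = real (mult_energy A)" and "H = (harm (card A ^ 3) :: real)"
  have N: "1 \<le> N" using A(2) by (simp add: N_def)
  have H0: "0 \<le> H" by (simp add: H_def harm_nonneg)
  have M0: "0 \<le> M" "0 \<le> E" by (simp_all add: M_def E_def)
  have HN: "H \<le> 1501 * N powr (1 / 500)"
    using harm_cube_le_powr[of "card A"] A(2) by (simp add: H_def N_def)
  have lower: "N ^ 6 \<le> 1327104 * (M\<^sup>2 * E * H)"
    unfolding N_def M_def E_def H_def by (rule energy_lower_bound[OF fin fin A refl s_le])
  have "E ^ 34 \<le> (2 ^ 34 * 4 ^ 18 * 64 * 1728 ^ 7 * 41472 ^ 3) * (N ^ 74 * M ^ 18 * H ^ 55)
      \<or> E ^ 7 \<le> (2 ^ 7 * 4 ^ 5 * 4 * 5184) * (N ^ 13 * M ^ 5 * H ^ 8)"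
    unfolding N_def M_def E_def H_def
    by (rule energy_le_of_shifted_products[OF fin ne A(1)]) (rule s_le)
  then have "N powr e \<le> shifted_product_const * M"
  proof (elim disjE)
    assume "E ^ 34 \<le> (2 ^ 34 * 4 ^ 18 * 64 * 1728 ^ 7 * 41472 ^ 3) * (N ^ 74 * M ^ 18 * H ^ 55)"
    \<comment> \<open>130 = 6 * 34 - 74; in the other case 29 = 6 * 7 - 13.\<close>
    from eliminate_energy[OF _ M0 H0 _ _ lower this, of 130]
    have "N ^ 130 \<le> 1327104 ^ 34 * (2 ^ 34 * 4 ^ 18 * 64 * 1728 ^ 7 * 41472 ^ 3) * (M ^ (2 * 34 + 18) * H ^ (34 + 55))"
      using N by simp
    then have power: "N ^ 130 \<le> 1327104 ^ 34 * (2 ^ 34 * 4 ^ 18 * 64 * 1728 ^ 7 * 41472 ^ 3) * (M ^ 86 * H ^ 89)" by simp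
    have "N powr e \<le> root 86 (1327104 ^ 34 * (2 ^ 34 * 4 ^ 18 * 64 * 1728 ^ 7 * 41472 ^ 3) * 1501 ^ 89) * M"
      by (rule powr_le_of_power_le[OF N _ M0(1) H0 _ _ power HN]) (use e in auto)
    also have "\<dots> \<le> shifted_product_const * M"
      using M0 unfolding shifted_product_const_def by (intro mult_right_mono) auto
    finally show ?thesis .
  next
    assume "E ^ 7 \<le> (2 ^ 7 * 4 ^ 5 * 4 * 5184) * (N ^ 13 * M ^ 5 * H ^ 8)"
    from eliminate_energy[OF _ M0 H0 _ _ lower this, of 29]
    have "N ^ 29 \<le> 1327104 ^ 7 * (2 ^ 7 * 4 ^ 5 * 4 * 5184) * (M ^ (2 * 7 + 5) * H ^ (7 + 8))"
      using N by simp
    then have power: "N ^ 29 \<le> 1327104 ^ 7 * (2 ^ 7 * 4 ^ 5 * 4 * 5184) * (M ^ 19 * H ^ 15)" by simp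
    have "N powr e \<le> root 19 (1327104 ^ 7 * (2 ^ 7 * 4 ^ 5 * 4 * 5184) * 1501 ^ 15) * M"
      by (rule powr_le_of_power_le[OF N _ M0(1) H0 _ _ power HN]) (use e in auto)
    also have "\<dots> \<le> shifted_product_const * M"
      using M0 unfolding shifted_product_const_def by (intro mult_right_mono) auto
    finally show ?thesis .
  qed
  then show ?thesis using a(1) unfolding N_def M_def s_def by blast
qed

section \<open>Restoring zero, small sets, and the common constant\<close>

lemma card_powr_le_remove_zero:
  fixes A S S0 :: "real set" and e C :: real
  assumes fin: "finite A" "finite S" and A: "2 \<le> card (A - {0})" and S: "S0 \<subseteq> S"
    and e: "0 \<le> e" "e \<le> 2" and C: "0 \<le> C"
    and main: "real (card (A - {0})) powr e \<le> C * card S0"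
  shows "real (card A) powr e \<le> 4 * C * card S"
proof -
  have "card A \<le> Suc (card (A - {0}))" using card_Suc_Diff1[of A 0] fin by (cases "0 \<in> A") auto
  then have "real (card A) powr e \<le> (2 * real (card (A - {0}))) powr e"
    using A e by (intro powr_mono2) auto
  also have "\<dots> = 2 powr e * real (card (A - {0})) powr e" by (simp add: powr_mult)
  also have "\<dots> \<le> 2 powr 2 * (C * card S0)"
    using e main by (intro mult_mono powr_mono) auto
  also have "\<dots> \<le> 4 * (C * card S)" using card_mono[OF fin(2) S] C by (simp add: mult_left_mono)
  finally show ?thesis by simp
qed

theorem theorem1p6:
  shows "\<exists>C1 C2 C3 :: real \<Rightarrow> real.
    (\<forall>\<epsilon>>0. C1 \<epsilon> > 0 \<and> C2 \<epsilon> > 0 \<and> C3 \<epsilon> > 0) \<and>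
    (\<forall>A :: real set. finite A \<and> A \<noteq> {} \<longrightarrow>
      (\<exists>a\<in>A. \<forall>\<epsilon>>0.
        real (card A) powr (229 / 152 - \<epsilon>) \<le> C1 \<epsilon> * real (card (A * (a +o A))) \<and>
        real (card A) powr (32 / 21 - \<epsilon>) \<le> C2 \<epsilon> * real (card (A * (A + A))) \<and>
        real (card A) powr (7239 / 4733 - \<epsilon>) \<le> C3 \<epsilon> * real (card (A * difference_set A A))))"
proof -
  define C where "C = 4 * (1 + shifted_product_const + small_energy_const)"
  have C: "4 \<le> C" "4 * shifted_product_const \<le> C" "4 * small_energy_const \<le> C"
    using small_energy_const_nonneg shifted_product_const_nonneg by (auto simp: C_def)
  have main: "\<exists>a\<in>A. real (card A) powr (229 / 152) \<le> C * real (card (A * (a +o A))) \<and>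
      real (card A) powr (32 / 21) \<le> C * real (card (A * (A + A))) \<and>
      real (card A) powr (7239 / 4733) \<le> C * real (card (A * difference_set A A))"
    if fin: "finite A" and ne: "A \<noteq> {}" for A :: "real set"
  proof -
    have "difference_set A A = (\<lambda>(x, y). x - y) ` (A \<times> A)" by (auto simp: difference_set_def)
    then have finD: "finite (A * difference_set A A)" using fin by (simp add: finite_set_times)
    have finS: "finite (A * (A + A))" using fin by (simp add: finite_set_times finite_set_plus)
    have finT: "finite (A * (a +o A))" for a
    proof -
      have "a +o A = (+) a ` A" by (auto simp: elt_set_plus_def)
      then show ?thesis using fin by (simp add: finite_set_times)
    qed
    show ?thesis
    proof (cases "2 \<le> card (A - {0})")
      case True
      define A0 where "A0 = A - {0}"
      have A0: "finite A0" "0 \<notin> A0" "2 \<le> card A0" "A0 \<subseteq> A" using fin True by (auto simp: A0_def)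
      have sub: "A0 * (a +o A0) \<subseteq> A * (a +o A)" "A0 * (A0 + A0) \<subseteq> A * (A + A)"
        "A0 * difference_set A0 A0 \<subseteq> A * difference_set A A" for a
        using A0(4) by (auto simp: set_times_def elt_set_plus_def set_plus_def difference_set_def) blast+
      \<comment> \<open>Only the first of the three bounds involves a, so the element chosen for it
        serves all of them.\<close>
      obtain a where a: "a \<in> A0" "real (card A0) powr (229 / 152) \<le> shifted_product_const * card (A0 * (a +o A0))"
        using ex_shifted_product_growth[OF A0(1-3)] by blast
      have "real (card A) powr (229 / 152) \<le> 4 * shifted_product_const * card (A * (a +o A))"
        by (rule card_powr_le_remove_zero[OF fin finT True sub(1)[unfolded A0_def] _ _ shifted_product_const_nonneg a(2)[unfolded A0_def]])
          simp_all
      moreover have "real (card A) powr (32 / 21) \<le> 4 * small_energy_const * card (A * (A + A))"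
        by (rule card_powr_le_remove_zero[OF fin finS True sub(2)[unfolded A0_def] _ _ small_energy_const_nonneg
              products_with_sums_growth[OF A0(1-3), unfolded A0_def]]) simp_all
      moreover have "real (card A) powr (7239 / 4733) \<le> 4 * small_energy_const * card (A * difference_set A A)"
        by (rule card_powr_le_remove_zero[OF fin finD True sub(3)[unfolded A0_def] _ _ small_energy_const_nonneg
              products_with_differences_growth[OF A0(1-3), unfolded A0_def]]) simp_all
      moreover have "4 * shifted_product_const * real k \<le> C * real k"
        "4 * small_energy_const * real k \<le> C * real k" for k
        using C by (simp_all add: mult_right_mono)
      moreover have "a \<in> A" using a(1) A0(4) by blast
      ultimately show ?thesis by (meson order_trans)
    next
      case False
      \<comment> \<open>With at most one nonzero element every power of |A| is at most 4 <= C, and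
        it suffices that the three product sets are nonempty.\<close>
      then have "card A \<le> 2" using card_Suc_Diff1[of A 0] fin by (cases "0 \<in> A") auto
      then have small: "real (card A) powr e \<le> C" if "0 \<le> e" "e \<le> 2" for e
      proof -
        have "real (card A) powr e \<le> 2 powr e" using \<open>card A \<le> 2\<close> that by (intro powr_mono2) auto
        also have "\<dots> \<le> 2 powr 2" using that by (intro powr_mono) auto
        finally show ?thesis using C(1) by simp
      qed
      have large: "C \<le> C * real (card S)" if "finite S" "S \<noteq> {}" for S :: "real set"
        using that C(1) by (simp add: Suc_leI card_gt_0_iff)
      obtain a where a: "a \<in> A" using ne by blast
      have "a + a \<in> a +o A" using a by (rule set_plus_intro2)
      moreover have "a + a \<in> A + A" using a a by (rule set_plus_intro)
      moreover have "a - a \<in> difference_set A A" using a by (auto simp: difference_set_def)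
      ultimately have "a * (a + a) \<in> A * (a +o A)" "a * (a + a) \<in> A * (A + A)" "a * (a - a) \<in> A * difference_set A A"
        using a by (auto simp only: set_times_intro)
      then have "C \<le> C * card (A * (a +o A))" "C \<le> C * card (A * (A + A))"
        "C \<le> C * card (A * difference_set A A)"
        using large[OF finT] large[OF finS] large[OF finD] by blast+
      moreover have "real (card A) powr (229 / 152) \<le> C" "real (card A) powr (32 / 21) \<le> C"
        "real (card A) powr (7239 / 4733) \<le> C" by (rule small; simp)+
      ultimately show ?thesis using a by (meson order_trans)
    qed
  qed
  show ?thesis
  proof (intro exI[of _ "\<lambda>_. C"] conjI allI impI)
    fix A :: "real set" assume A: "finite A \<and> A \<noteq> {}"
    then have "1 \<le> card A" by (simp add: Suc_leI card_gt_0_iff)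
    then have mono: "real (card A) powr (e - \<epsilon>) \<le> real (card A) powr e" if "0 < \<epsilon>" for e \<epsilon>
      using that by (intro powr_mono) auto
    from main[of A] A obtain a where "a \<in> A" "real (card A) powr (229 / 152) \<le> C * real (card (A * (a +o A)))"
      "real (card A) powr (32 / 21) \<le> C * real (card (A * (A + A)))"
      "real (card A) powr (7239 / 4733) \<le> C * real (card (A * difference_set A A))" by blast
    then show "\<exists>a\<in>A. \<forall>\<epsilon>>0.
        real (card A) powr (229 / 152 - \<epsilon>) \<le> C * real (card (A * (a +o A))) \<and>
        real (card A) powr (32 / 21 - \<epsilon>) \<le> C * real (card (A * (A + A))) \<and>
        real (card A) powr (7239 / 4733 - \<epsilon>) \<le> C * real (card (A * difference_set A A))"
      using mono order_trans by (intro bexI[of _ a]) blast+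
  qed (use C(1) in auto)
qed

end
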